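(* Let $J,K$ be non-negative integers or half-integers and let $k=2(K-J)\in\mathbb{Z}$. For every density matrix $\rho$ on $\mathcal{H}_J$ and every $\omega\in\mathbb{S}^2$, the sequence of eigenvalues of the density matrix $\Phi^k(\rho)$ on $\mathcal{H}_K$ is majorized by the sequence of eigenvalues of $\Phi^k(|\omega\rangle_J\,{}_J\langle\omega|)$; by $SU(2)$ invariance the latter sequence is independent of $\omega\in\mathbb{S}^2$.
   Context: For each integer or half-integer $L\ge 0$, $\mathcal{H}_L=\mathbb{C}^{2L+1}$ is the irreducible spin-$L$ representation space of $SU(2)$, with spin operators $\mathbf{S}_L=(S_x,S_y,S_z)$ (self-adjoint, $[S_x,S_y]=iS_z$ and cyclic permutations). For $\omega\in\mathbb{S}^2$ the Bloch coherent state $|\omega\rangle_J\in\mathcal{H}_J$ is a unit vector, unique up to phase, spanning the eigenspace of $\omega\cdot\mathbf{S}_J$ with eigenvalue $J$. $P_-$ is the orthogonal projection in $\mathcal{H}_J\otimes\mathcal{H}_K$ onto the subspace of minimal total spin $|K-J|$, i.e. onto the unique copy of $\mathcal{H}_{|K-J|}$ in the tensor product representation. With $k=2K-2J\in\mathbb{Z}$, the map $\Phi^k$ from operators on $\mathcal{H}_J$ to operators on $\mathcal{H}_K$ is defined by the partial trace over $\mathcal{H}_J$: $$\Phi^k(\rho)=\frac{2J+1}{2|K-J|+1}\operatorname{Tr}_J\big(P_-(\rho\otimes I_K)\big),$$ where $I_K$ is the identity on $\mathcal{H}_K$. (The dependence of $P_-$ and $\Phi^k$ on $J,K$ is suppressed.)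 It is completely positive and trace preserving. Majorization: for real sequences $a_1\ge\dots\ge a_M$ and $b_1\ge\dots\ge b_M$, $(a_i)$ majorizes $(b_i)$ if $\sum_{i=1}^m a_i\ge\sum_{i=1}^m b_i$ for $m=1,\dots,M-1$ and $\sum_{i=1}^M a_i=\sum_{i=1}^M b_i$. Eigenvalues are listed in decreasing order with multiplicity. A density matrix is a positive semi-definite operator of trace $1$. *)

theory Defs
  imports
    "HOL-Analysis.Analysis"
    "HOL-Computational_Algebra.Fundamental_Theorem_Algebra"
    "Jordan_Normal_Form.Schur_Decomposition"
    "Jordan_Normal_Form.Char_Poly"
begin

unbundle no vec_syntax
unbundle no inner_syntax

section \<open>Spin operators\<close>

definition is_spin :: "real \<Rightarrow> bool" where
  "is_spin L \<longleftrightarrow> 2 * L \<in> \<nat>"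

definition spin_dim :: "real \<Rightarrow> nat" where
  "spin_dim L = nat \<lfloor>2 * L + 1\<rfloor>"

text \<open>
  The spin-\<open>L\<close> representation is realised on \<open>\<complex>\<^sup>2\<^sup>L\<^sup>+\<^sup>1\<close> in the usual orthonormal basis of
  eigenvectors of the third spin operator; the basis vector with index \<open>i\<close> has magnetic quantum
  number \<open>L - i\<close>, so that the raising operator maps index \<open>Suc i\<close> to index \<open>i\<close>, with the coefficient
  \<open>sqrt (L (L + 1) - m (m + 1))\<close> for \<open>m = L - Suc i\<close>. The lemmas \<open>spin_self_adjoint\<close>,
  \<open>spin_commutators\<close> and \<open>spin_casimir\<close> below confirm that this is the spin-\<open>L\<close> representation.
\<close>

definition spin_raise :: "real \<Rightarrow> complex mat" where
  "spin_raise L = mat (spin_dim L) (spin_dim L) (\<lambda>(i, j).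
     if j = Suc i then complex_of_real (sqrt (L * (L + 1) - (L - real j) * (L - real j + 1))) else 0)"

definition spin_x :: "real \<Rightarrow> complex mat" where
  "spin_x L = (1 / 2) \<cdot>\<^sub>m (spin_raise L + mat_adjoint (spin_raise L))"

definition spin_y :: "real \<Rightarrow> complex mat" where
  "spin_y L = (1 / (2 * \<i>)) \<cdot>\<^sub>m (spin_raise L - mat_adjoint (spin_raise L))"

definition spin_z :: "real \<Rightarrow> complex mat" where
  "spin_z L = mat (spin_dim L) (spin_dim L) (\<lambda>(i, j).
     if i = j then complex_of_real (L - real i) else 0)"

definition raise_coeff :: "nat \<Rightarrow> nat \<Rightarrow> complex" where
  "raise_coeff n i = complex_of_real (sqrt (real (Suc i) * (real n - real i)))"

definition raise_entry :: "nat \<Rightarrow> nat \<Rightarrow> nat \<Rightarrow> complex" where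
  "raise_entry n i j = (if j = Suc i then raise_coeff n i else 0)"

lemma is_spinE:
  assumes "is_spin L"
  obtains n where "L = real n / 2" "spin_dim L = Suc n"
proof -
  from assms obtain n where n: "2 * L = real n"
    by (auto simp: is_spin_def elim: Nats_cases)
  have "spin_dim L = Suc n"
    unfolding spin_dim_def n by linarith
  with n that show thesis by auto
qed

lemma mat_adjoint_dim [simp]:
  "dim_row (mat_adjoint A) = dim_col A" "dim_col (mat_adjoint A) = dim_row A"
  by (auto simp: mat_adjoint_def)

lemma mat_adjoint_index [simp]:
  "i < dim_col A \<Longrightarrow> j < dim_row A \<Longrightarrow> mat_adjoint A $$ (i, j) = conjugate (A $$ (j, i))"
  by (simp add: mat_adjoint_def mat_of_rows_index)

context
  fixes L :: real and n :: nat
  assumes L: "L = real n / 2" and d: "spin_dim L = Suc n"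
begin

lemma raise_coeff_eq:
  "L * (L + 1) - (L - real (Suc i)) * (L - real (Suc i) + 1) = real (Suc i) * (real n - real i)"
  by (simp add: L field_simps)

lemma spin_raise_eq: "spin_raise L = mat (Suc n) (Suc n) (\<lambda>(i, j). raise_entry n i j)"
  unfolding spin_raise_def d raise_entry_def raise_coeff_def
  by (rule cong_mat) (auto simp only: raise_coeff_eq [symmetric] split: if_splits)

lemma cnj_raise_entry [simp]: "cnj (raise_entry n i j) = raise_entry n i j"
  by (simp add: raise_entry_def raise_coeff_def)

lemma spin_carrier [simp]:
  "spin_x L \<in> carrier_mat (Suc n) (Suc n)"
  "spin_y L \<in> carrier_mat (Suc n) (Suc n)"
  "spin_z L \<in> carrier_mat (Suc n) (Suc n)"
  by (auto simp: spin_x_def spin_y_def spin_z_def spin_raise_eq d)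

lemma spin_dims [simp]:
  "dim_row (spin_x L) = Suc n" "dim_col (spin_x L) = Suc n"
  "dim_row (spin_y L) = Suc n" "dim_col (spin_y L) = Suc n"
  "dim_row (spin_z L) = Suc n" "dim_col (spin_z L) = Suc n"
  by (auto simp: spin_x_def spin_y_def spin_z_def spin_raise_eq d)

lemma spin_x_index: "i < Suc n \<Longrightarrow> j < Suc n \<Longrightarrow>
    spin_x L $$ (i, j) = (raise_entry n i j + raise_entry n j i) / 2"
  by (simp add: spin_x_def spin_raise_eq)

lemma spin_y_index: "i < Suc n \<Longrightarrow> j < Suc n \<Longrightarrow>
    spin_y L $$ (i, j) = (raise_entry n i j - raise_entry n j i) / (2 * \<i>)"
  by (simp add: spin_y_def spin_raise_eq)

lemma spin_z_index: "i < Suc n \<Longrightarrow> j < Suc n \<Longrightarrow>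
    spin_z L $$ (i, j) = (if i = j then complex_of_real (L - real i) else 0)"
  by (simp add: spin_z_def d)

lemma mult_index:
  "A \<in> carrier_mat (Suc n) (Suc n) \<Longrightarrow> B \<in> carrier_mat (Suc n) (Suc n) \<Longrightarrow> i < Suc n \<Longrightarrow> j < Suc n
   \<Longrightarrow> (A * B) $$ (i, j) = (\<Sum>k<Suc n. A $$ (i, k) * B $$ (k, j))"
  by (simp add: scalar_prod_def lessThan_atLeast0 del: sum.lessThan_Suc)

lemma raise_coeff_sq:
  "i \<le> n \<Longrightarrow> raise_coeff n i * raise_coeff n i = of_nat (Suc i) * (of_nat n - of_nat i)"
proof -
  assume "i \<le> n"
  then have "raise_coeff n i * raise_coeff n i = complex_of_real (real (Suc i) * (real n - real i))"
    unfolding raise_coeff_def of_real_mult [symmetric] by (subst real_sqrt_mult_self) simp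
  then show ?thesis by simp
qed

lemma sum_raise_lower:
  assumes "i < Suc n" "j < Suc n"
  shows "(\<Sum>k<Suc n. raise_entry n i k * raise_entry n j k)
           = (if i = j then of_nat (Suc i) * (of_nat n - of_nat i) else 0)"
proof -
  have "(\<Sum>k<Suc n. raise_entry n i k * raise_entry n j k)
      = (\<Sum>k<Suc n. if k = Suc i then raise_coeff n i * raise_entry n j (Suc i) else 0)"
    by (intro sum.cong) (auto simp: raise_entry_def)
  also have "\<dots> = (if Suc i < Suc n then raise_coeff n i * raise_entry n j (Suc i) else 0)"
    by (subst sum.delta) auto
  also have "\<dots> = (if i = j then of_nat (Suc i) * (of_nat n - of_nat i) else 0)"
    using assms by (auto simp: raise_entry_def raise_coeff_sq less_Suc_eq)
  finally show ?thesis .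
qed

lemma sum_lower_raise:
  assumes "i < Suc n" "j < Suc n"
  shows "(\<Sum>k<Suc n. raise_entry n k i * raise_entry n k j)
           = (if i = j then of_nat i * (of_nat n + 1 - of_nat i) else 0)"
proof (cases i)
  case 0
  then show ?thesis by (simp add: raise_entry_def)
next
  case (Suc m)
  have "(\<Sum>k<Suc n. raise_entry n k i * raise_entry n k j)
      = (\<Sum>k<Suc n. if k = m then raise_coeff n m * raise_entry n m j else 0)"
    by (intro sum.cong) (auto simp: raise_entry_def Suc)
  also have "\<dots> = raise_coeff n m * raise_entry n m j"
    using assms Suc by (subst sum.delta) auto
  also have "\<dots> = (if i = j then of_nat i * (of_nat n + 1 - of_nat i) else 0)"
    using assms by (auto simp: raise_entry_def raise_coeff_sq Suc)
  finally show ?thesis .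
qed

lemma sum_diag:
  fixes f :: "nat \<Rightarrow> complex"
  shows "i < Suc n \<Longrightarrow> (\<Sum>k<Suc n. (if i = k then a else 0) * f k) = a * f i"
    and "i < Suc n \<Longrightarrow> (\<Sum>k<Suc n. f k * (if k = i then g k else 0)) = f i * g i"
proof -
  assume i: "i < Suc n"
  have "(\<Sum>k<Suc n. (if i = k then a else 0) * f k) = (\<Sum>k<Suc n. if k = i then a * f k else 0)"
    by (intro sum.cong) auto
  with i show "(\<Sum>k<Suc n. (if i = k then a else 0) * f k) = a * f i" by (subst (asm) sum.delta) auto
  have "(\<Sum>k<Suc n. f k * (if k = i then g k else 0)) = (\<Sum>k<Suc n. if k = i then f k * g k else 0)"
    by (intro sum.cong) auto
  with i show "(\<Sum>k<Suc n. f k * (if k = i then g k else 0)) = f i * g i"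
    by (subst (asm) sum.delta) auto
qed

lemma spin_xy_index:
  assumes "i < Suc n" "j < Suc n"
  shows "(spin_x L * spin_y L - spin_y L * spin_x L) $$ (i, j) = (\<i> \<cdot>\<^sub>m spin_z L) $$ (i, j)"
proof -
  let ?r = "raise_entry n"
  have "(spin_x L * spin_y L - spin_y L * spin_x L) $$ (i, j)
      = (\<Sum>k<Suc n. (?r i k + ?r k i) / 2 * ((?r k j - ?r j k) / (2 * \<i>)))
        - (\<Sum>k<Suc n. (?r i k - ?r k i) / (2 * \<i>) * ((?r k j + ?r j k) / 2))"
    using assms by (simp add: mult_index spin_x_index spin_y_index del: index_mult_mat(1) sum.lessThan_Suc cong: sum.cong_simp)
  also have "\<dots> = (\<Sum>k<Suc n. (?r k i * ?r k j - ?r i k * ?r j k) / (2 * \<i>))"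
    unfolding sum_subtractf [symmetric] by (intro sum.cong) (auto simp: field_simps)
  also have "\<dots> = ((\<Sum>k<Suc n. ?r k i * ?r k j) - (\<Sum>k<Suc n. ?r i k * ?r j k)) / (2 * \<i>)"
    unfolding sum_subtractf [symmetric] by (simp only: sum_divide_distrib)
  also have "\<dots> = \<i> * (if i = j then complex_of_real (L - real i) else 0)"
    unfolding sum_lower_raise [OF assms] sum_raise_lower [OF assms] by (simp add: L field_simps)
  also have "\<dots> = (\<i> \<cdot>\<^sub>m spin_z L) $$ (i, j)"
    using assms by (simp add: spin_z_index)
  finally show ?thesis .
qed

lemma spin_commutators_aux:
  "spin_x L * spin_y L - spin_y L * spin_x L = \<i> \<cdot>\<^sub>m spin_z L"
  "spin_y L * spin_z L - spin_z L * spin_y L = \<i> \<cdot>\<^sub>m spin_x L"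
  "spin_z L * spin_x L - spin_x L * spin_z L = \<i> \<cdot>\<^sub>m spin_y L"
proof -
  show "spin_x L * spin_y L - spin_y L * spin_x L = \<i> \<cdot>\<^sub>m spin_z L"
    by (rule eq_matI) (auto simp del: index_smult_mat(1) index_minus_mat(1) intro!: spin_xy_index)
  have z1: "(spin_z L * A) $$ (i, j) = complex_of_real (L - real i) * A $$ (i, j)"
    and z2: "(A * spin_z L) $$ (i, j) = A $$ (i, j) * complex_of_real (L - real j)"
    if "A \<in> carrier_mat (Suc n) (Suc n)" "i < Suc n" "j < Suc n" for A i j
    using that sum_diag(1) [OF that(2), of "complex_of_real (L - real i)" "\<lambda>k. A $$ (k, j)"]
      sum_diag(2) [OF that(3), of "\<lambda>k. A $$ (i, k)" "\<lambda>k. complex_of_real (L - real k)"]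
    by (simp_all add: mult_index spin_z_index del: index_mult_mat(1) sum.lessThan_Suc cong: sum.cong_simp)
  show "spin_y L * spin_z L - spin_z L * spin_y L = \<i> \<cdot>\<^sub>m spin_x L"
    by (rule eq_matI)
      (auto simp: z1 z2 spin_x_index spin_y_index raise_entry_def field_simps simp del: index_mult_mat(1))
  show "spin_z L * spin_x L - spin_x L * spin_z L = \<i> \<cdot>\<^sub>m spin_y L"
    by (rule eq_matI)
      (auto simp: z1 z2 spin_x_index spin_y_index raise_entry_def field_simps simp del: index_mult_mat(1))
qed

lemma spin_self_adjoint_aux:
  "mat_adjoint (spin_x L) = spin_x L"
  "mat_adjoint (spin_y L) = spin_y L"
  "mat_adjoint (spin_z L) = spin_z L"
  by (rule eq_matI; simp add: spin_x_index spin_y_index spin_z_index field_simps)+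

lemma spin_casimir_aux:
  "spin_x L * spin_x L + spin_y L * spin_y L + spin_z L * spin_z L
     = complex_of_real (L * (L + 1)) \<cdot>\<^sub>m 1\<^sub>m (spin_dim L)"
proof (rule eq_matI)
  fix i j
  assume "i < dim_row (complex_of_real (L * (L + 1)) \<cdot>\<^sub>m 1\<^sub>m (spin_dim L))"
    and "j < dim_col (complex_of_real (L * (L + 1)) \<cdot>\<^sub>m 1\<^sub>m (spin_dim L))"
  then have ij: "i < Suc n" "j < Suc n" by (simp_all add: d)
  let ?r = "raise_entry n"
  have "(spin_x L * spin_x L) $$ (i, j) + (spin_y L * spin_y L) $$ (i, j)
      = (\<Sum>k<Suc n. (?r i k + ?r k i) / 2 * ((?r k j + ?r j k) / 2))
        + (\<Sum>k<Suc n. (?r i k - ?r k i) / (2 * \<i>) * ((?r k j - ?r j k) / (2 * \<i>)))"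
    using ij by (simp add: mult_index spin_x_index spin_y_index del: index_mult_mat(1) sum.lessThan_Suc cong: sum.cong_simp)
  also have "\<dots> = (\<Sum>k<Suc n. (?r k i * ?r k j + ?r i k * ?r j k) / 2)"
    unfolding sum.distrib [symmetric] by (intro sum.cong) (auto simp: field_simps)
  also have "\<dots> = ((\<Sum>k<Suc n. ?r k i * ?r k j) + (\<Sum>k<Suc n. ?r i k * ?r j k)) / 2"
    unfolding sum.distrib [symmetric] by (simp only: sum_divide_distrib)
  finally have xy: "(spin_x L * spin_x L) $$ (i, j) + (spin_y L * spin_y L) $$ (i, j) = \<dots>" .
  have z: "(spin_z L * spin_z L) $$ (i, j)
      = (if i = j then complex_of_real ((L - real i) * (L - real i)) else 0)"
    using ij sum_diag(2) [OF ij(2), of "\<lambda>k. spin_z L $$ (i, k)" "\<lambda>k. complex_of_real (L - real k)"]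
    by (simp add: mult_index spin_z_index del: index_mult_mat(1) sum.lessThan_Suc cong: sum.cong_simp)
  have "(spin_x L * spin_x L + spin_y L * spin_y L + spin_z L * spin_z L) $$ (i, j)
      = (spin_x L * spin_x L) $$ (i, j) + (spin_y L * spin_y L) $$ (i, j) + (spin_z L * spin_z L) $$ (i, j)"
    using ij by (simp del: index_mult_mat(1))
  also have "\<dots> = (if i = j then complex_of_real (L * (L + 1)) else 0)"
    unfolding xy z sum_lower_raise [OF ij] sum_raise_lower [OF ij] by (simp add: L field_simps)
  also have "\<dots> = (complex_of_real (L * (L + 1)) \<cdot>\<^sub>m 1\<^sub>m (spin_dim L)) $$ (i, j)"
    using ij by (simp add: d)
  finally show "(spin_x L * spin_x L + spin_y L * spin_y L + spin_z L * spin_z L) $$ (i, j)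
      = (complex_of_real (L * (L + 1)) \<cdot>\<^sub>m 1\<^sub>m (spin_dim L)) $$ (i, j)" .
qed (auto simp: d)

end

lemma spin_self_adjoint:
  assumes "is_spin L"
  shows "mat_adjoint (spin_x L) = spin_x L"
    and "mat_adjoint (spin_y L) = spin_y L"
    and "mat_adjoint (spin_z L) = spin_z L"
  using is_spinE [OF assms] spin_self_adjoint_aux by metis+

lemma spin_commutators:
  assumes "is_spin L"
  shows "spin_x L * spin_y L - spin_y L * spin_x L = \<i> \<cdot>\<^sub>m spin_z L"
    and "spin_y L * spin_z L - spin_z L * spin_y L = \<i> \<cdot>\<^sub>m spin_x L"
    and "spin_z L * spin_x L - spin_x L * spin_z L = \<i> \<cdot>\<^sub>m spin_y L"
  using is_spinE [OF assms] spin_commutators_aux by metis+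

lemma spin_casimir:
  assumes "is_spin L"
  shows "spin_x L * spin_x L + spin_y L * spin_y L + spin_z L * spin_z L
     = complex_of_real (L * (L + 1)) \<cdot>\<^sub>m 1\<^sub>m (spin_dim L)"
  using is_spinE [OF assms] spin_casimir_aux by metis

definition spin_dir :: "real ^ 3 \<Rightarrow> real \<Rightarrow> complex mat" where
  "spin_dir \<omega> L = complex_of_real (vec_nth \<omega> 1) \<cdot>\<^sub>m spin_x L
     + complex_of_real (vec_nth \<omega> 2) \<cdot>\<^sub>m spin_y L
     + complex_of_real (vec_nth \<omega> 3) \<cdot>\<^sub>m spin_z L"

text \<open>
  A coherent state vector; it is determined by \<open>\<omega>\<close> only up to a phase. Note that \<open>u \<bullet>c v\<close> is
  conjugate linear in \<open>v\<close>, its \<^emph>\<open>second\<close> argument.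
\<close>

definition coherent_state :: "real \<Rightarrow> real ^ 3 \<Rightarrow> complex Matrix.vec \<Rightarrow> bool" where
  "coherent_state L \<omega> v \<longleftrightarrow> v \<in> carrier_vec (spin_dim L) \<and> v \<bullet>c v = 1
     \<and> spin_dir \<omega> L *\<^sub>v v = complex_of_real L \<cdot>\<^sub>v v"

definition ketbra :: "complex Matrix.vec \<Rightarrow> complex mat" where
  "ketbra v = mat (dim_vec v) (dim_vec v) (\<lambda>(i, j). v $ i * cnj (v $ j))"

section \<open>Density matrices, eigenvalue sequences and majorization\<close>

definition mat_trace :: "complex mat \<Rightarrow> complex" where
  "mat_trace A = (\<Sum>i<dim_row A. A $$ (i, i))"

text \<open>
  In the order on the complex numbers, \<open>0 \<le> z\<close> means that \<open>z\<close> is real and non-negative. In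
  particular a positive semi-definite matrix is self-adjoint.
\<close>

definition pos_semidef :: "nat \<Rightarrow> complex mat \<Rightarrow> bool" where
  "pos_semidef n A \<longleftrightarrow> A \<in> carrier_mat n n \<and> (\<forall>v \<in> carrier_vec n. 0 \<le> (A *\<^sub>v v) \<bullet>c v)"

definition density_matrix :: "nat \<Rightarrow> complex mat \<Rightarrow> bool" where
  "density_matrix n A \<longleftrightarrow> pos_semidef n A \<and> mat_trace A = 1"

text \<open>
  Intended for self-adjoint matrices, where the roots of the characteristic polynomial are real and
  their multiplicities as roots are the dimensions of the eigenspaces.
\<close>

definition eigenvalue_seq :: "complex mat \<Rightarrow> real list" where
  "eigenvalue_seq A = rev (sorted_list_of_multiset (image_mset Re (proots (char_poly A))))"

definition majorizes :: "real list \<Rightarrow> real list \<Rightarrow> bool" where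
  "majorizes as bs \<longleftrightarrow> sorted_wrt (\<ge>) as \<and> sorted_wrt (\<ge>) bs \<and> length as = length bs
     \<and> (\<forall>m \<in> {1..<length as}. sum_list (take m bs) \<le> sum_list (take m as))
     \<and> sum_list as = sum_list bs"

section \<open>Tensor products and partial traces\<close>

text \<open>
  \<open>\<complex>\<^sup>m \<otimes> \<complex>\<^sup>n\<close> is identified with \<open>\<complex>\<^sup>m\<^sup>n\<close> such that \<open>e\<^sub>i \<otimes> e\<^sub>j\<close> becomes the basis vector
  with index \<open>i * n + j\<close>.
\<close>

definition tensor_mat :: "complex mat \<Rightarrow> complex mat \<Rightarrow> complex mat" where
  "tensor_mat A B = mat (dim_row A * dim_row B) (dim_col A * dim_col B) (\<lambda>(i, j).
     A $$ (i div dim_row B, j div dim_col B) * B $$ (i mod dim_row B, j mod dim_col B))"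

definition partial_trace_fst :: "nat \<Rightarrow> nat \<Rightarrow> complex mat \<Rightarrow> complex mat" where
  "partial_trace_fst m n A = mat n n (\<lambda>(i, j). \<Sum>k<m. A $$ (k * n + i, k * n + j))"

section \<open>The subspace of minimal total spin and the channel\<close>

definition total_op :: "(real \<Rightarrow> complex mat) \<Rightarrow> real \<Rightarrow> real \<Rightarrow> complex mat" where
  "total_op S J K = tensor_mat (S J) (1\<^sub>m (spin_dim K)) + tensor_mat (1\<^sub>m (spin_dim J)) (S K)"

definition total_casimir :: "real \<Rightarrow> real \<Rightarrow> complex mat" where
  "total_casimir J K = total_op spin_x J K * total_op spin_x J K
     + total_op spin_y J K * total_op spin_y J K
     + total_op spin_z J K * total_op spin_z J K"

text \<open>
  The vectors of total spin \<open>s\<close>, that is, the span of all copies of the spin-\<open>s\<close> representation: the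
  eigenspace of the square of the total spin operator for the eigenvalue \<open>s (s + 1)\<close>.
\<close>

definition total_spin_space :: "real \<Rightarrow> real \<Rightarrow> real \<Rightarrow> complex Matrix.vec set" where
  "total_spin_space J K s = {v \<in> carrier_vec (spin_dim J * spin_dim K).
     total_casimir J K *\<^sub>v v = complex_of_real (s * (s + 1)) \<cdot>\<^sub>v v}"

text \<open>
  A self-adjoint idempotent is determined by its range, and every linear subspace \<open>W\<close> is the range
  of one.
\<close>

definition is_orth_proj :: "nat \<Rightarrow> complex Matrix.vec set \<Rightarrow> complex mat \<Rightarrow> bool" where
  "is_orth_proj n W P \<longleftrightarrow> P \<in> carrier_mat n n \<and> P * P = P \<and> mat_adjoint P = P
     \<and> (\<lambda>v. P *\<^sub>v v) ` carrier_vec n = W"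

definition P_minus :: "real \<Rightarrow> real \<Rightarrow> complex mat" where
  "P_minus J K = (THE P. is_orth_proj (spin_dim J * spin_dim K) (total_spin_space J K \<bar>K - J\<bar>) P)"

text \<open>\<open>\<Phi>\<^sup>k\<close> for \<open>k = 2 (K - J)\<close>, as a map from operators on spin \<open>J\<close> to operators on spin \<open>K\<close>.\<close>

definition Phi :: "real \<Rightarrow> real \<Rightarrow> complex mat \<Rightarrow> complex mat" where
  "Phi J K \<rho> = complex_of_real ((2 * J + 1) / (2 * \<bar>K - J\<bar> + 1)) \<cdot>\<^sub>m
     partial_trace_fst (spin_dim J) (spin_dim K)
       (P_minus J K * tensor_mat \<rho> (1\<^sub>m (spin_dim K)))"

end

theory Submission
  imports Defs
begin

text \<open>
  Put \<open>n = 2J\<close>, \<open>N = 2K\<close>. The minimal spin subspace is spanned by the vectors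
  \<open>(x\<^sub>1 y\<^sub>2 - x\<^sub>2 y\<^sub>1)\<^sup>n f(y)\<close> (for \<open>n \<le> N\<close>), and \<open>P_-\<close> commutes with rotations, so coherent states may
  be replaced by the highest weight state. If \<open>N < n\<close>, its image is a pure state and nothing more is
  needed. If \<open>n \<le> N\<close>, the map is, up to time reversal, \<open>\<rho> \<mapsto> P(\<rho> \<otimes> I)P\<close> with \<open>P\<close> the projection of
  spin \<open>n/2\<close> times spin \<open>m/2\<close> onto spin \<open>N/2\<close>, \<open>m = N - n\<close>. The image of a pure state \<open>\<psi>\<close> is \<open>M M\<^sup>*\<close>,
  and normal ordering shows that the \<open>(m + 1) \<times> (m + 1)\<close> matrix \<open>M\<^sup>* M\<close> is a positive combination of the
  images of the \<open>q\<close>-particle reductions of \<open>\<psi>\<close> under maps of the same family with target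
  dimension \<open>m + 1 < N + 1\<close>. Since the sums of the \<open>k\<close> largest eigenvalues are subadditive, and add up
  exactly when \<open>\<psi>\<close> is the highest weight state, induction on \<open>N\<close> gives the majorization.
\<close>

section \<open>Frames and the Ky Fan functional\<close>

text \<open>The Gram matrix belongs to the map
  \<open>e\<^sub>l \<mapsto> P (\<psi> \<otimes> e\<^sub>l)\<close>. On symmetric spins 1/2,
  \<open>P\<close> is an average over the permutations of \<open>n + m\<close> spins. A permutation
  that exchanges \<open>q\<close> spins between the two groups sees \<open>\<psi>\<close> only
  through its \<open>q\<close>-particle reduction, and the weight of \<open>q\<close> is the
  probability of such a permutation, independent of \<open>\<psi>\<close>. As partial traces
  preserve the trace, the resulting bound depends on \<open>\<psi>\<close> only through its squared
  norm; this is why the induction closes. For the highest weight state every reduction is again of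
  highest weight, and all Gram matrices are diagonal with their entries in the same order, so the
  bound is attained. For \<open>n = 0\<close> the dimension no longer drops, but then the image is a
  multiple of the identity. Time reversal enters because the minimal spin pairs one spin with the
  other through the antisymmetric invariant, which identifies a spin space with its dual. Rotations
  are constructed by recursion on the number of bosons instead of by exponentials.\<close>

definition frame :: "nat \<Rightarrow> nat \<Rightarrow> (nat \<Rightarrow> nat \<Rightarrow> complex) \<Rightarrow> bool" where
  "frame d r v \<longleftrightarrow>
     (\<forall>i<r. \<forall>j<r. (\<Sum>x<d. v i x * cnj (v j x)) = (if i = j then 1 else 0))"

definition inner_sum :: "nat \<Rightarrow> (nat \<Rightarrow> complex) \<Rightarrow> (nat \<Rightarrow> complex) \<Rightarrow> complex" where
  "inner_sum d x y = (\<Sum>a<d. x a * cnj (y a))"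

lemma frame_inner_sum:
  "frame d r v \<longleftrightarrow> (\<forall>i<r. \<forall>j<r. inner_sum d (v i) (v j) = (if i = j then 1 else 0))"
  by (simp add: frame_def inner_sum_def)

lemma inner_sum_diff_left: "inner_sum d (\<lambda>x. f x - g x) h = inner_sum d f h - inner_sum d g h"
  by (simp add: inner_sum_def left_diff_distrib sum_subtractf)

lemma inner_sum_sum_left:
  "inner_sum d (\<lambda>x. \<Sum>j\<in>I. c j * w j x) h = (\<Sum>j\<in>I. c j * inner_sum d (w j) h)"
  unfolding inner_sum_def
  by (simp add: sum_distrib_left sum_distrib_right mult.assoc) (rule sum.swap)

lemma inner_sum_commute: "inner_sum d y x = cnj (inner_sum d x y)"
  by (simp add: inner_sum_def mult.commute)

lemma inner_sum_sum_right:
  "inner_sum d h (\<lambda>x. \<Sum>j\<in>I. c j * w j x) = (\<Sum>j\<in>I. cnj (c j) * inner_sum d h (w j))"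
  by (subst inner_sum_commute) (simp add: inner_sum_sum_left flip: inner_sum_commute)

lemma inner_sum_diff_right: "inner_sum d h (\<lambda>x. f x - g x) = inner_sum d h f - inner_sum d h g"
  by (simp add: inner_sum_def right_diff_distrib sum_subtractf)

lemma inner_sum_scale_left: "inner_sum d (\<lambda>x. c * f x) h = c * inner_sum d f h"
  by (simp add: inner_sum_def sum_distrib_left mult.assoc)

lemma inner_sum_scale_right: "inner_sum d h (\<lambda>x. c * f x) = cnj c * inner_sum d h f"
  by (simp add: inner_sum_def sum_distrib_left ac_simps)

lemma inner_sum_self: "inner_sum d f f = complex_of_real (\<Sum>x<d. (cmod (f x))\<^sup>2)"
  by (simp add: inner_sum_def complex_norm_square del: of_real_power)

lemma inner_sum_cong:
  assumes "\<And>x. x < d \<Longrightarrow> f x = f' x" "\<And>x. x < d \<Longrightarrow> g x = g' x"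
  shows "inner_sum d f g = inner_sum d f' g'"
  using assms by (simp add: inner_sum_def)

lemma inner_sum_frame_expansion:
  assumes "frame d t w" "i < t"
  shows "inner_sum d (\<lambda>x. \<Sum>j<t. c j * w j x) (w i) = c i"
proof -
  have "inner_sum d (\<lambda>x. \<Sum>j<t. c j * w j x) (w i) = (\<Sum>j<t. if j = i then c i else 0)"
    unfolding inner_sum_sum_left using assms by (intro sum.cong) (auto simp: frame_inner_sum)
  with assms show ?thesis by simp
qed

text \<open>The difference of the two sides is the squared norm of \<open>y\<close> minus its
  projection \<open>p\<close>.\<close>

lemma bessel:
  assumes "frame d r v"
  shows "(\<Sum>i<r. (cmod (inner_sum d y (v i)))\<^sup>2) \<le> (\<Sum>x<d. (cmod (y x))\<^sup>2)"
proof -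
  define c where "c i = inner_sum d y (v i)" for i
  define p where "p x = (\<Sum>j<r. c j * v j x)" for x
  have fp: "inner_sum d f p = (\<Sum>j<r. cnj (c j) * inner_sum d f (v j))" for f
    unfolding p_def inner_sum_sum_right ..
  have yp: "inner_sum d y p = (\<Sum>j<r. cnj (c j) * c j)"
    unfolding fp c_def ..
  have pp: "inner_sum d p p = (\<Sum>j<r. cnj (c j) * c j)"
  proof -
    have "inner_sum d p (v j) = c j" if "j < r" for j
      using inner_sum_frame_expansion[OF assms that, of c] unfolding p_def .
    then show ?thesis unfolding fp by simp
  qed
  have real: "(\<Sum>j<r. cnj (c j) * c j) = complex_of_real (\<Sum>j<r. (cmod (c j))\<^sup>2)"
    by (simp add: complex_norm_square mult.commute del: of_real_power)
  have "inner_sum d (\<lambda>x. y x - p x) (\<lambda>x. y x - p x)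
      = inner_sum d y y - inner_sum d y p - cnj (inner_sum d y p) + inner_sum d p p"
    by (simp add: inner_sum_diff_left inner_sum_diff_right flip: inner_sum_commute)
  also have "\<dots> = inner_sum d y y - complex_of_real (\<Sum>j<r. (cmod (c j))\<^sup>2)"
    unfolding yp pp real by simp
  finally have "complex_of_real (\<Sum>x<d. (cmod (y x - p x))\<^sup>2)
      = complex_of_real ((\<Sum>x<d. (cmod (y x))\<^sup>2) - (\<Sum>j<r. (cmod (c j))\<^sup>2))"
    unfolding inner_sum_self by simp
  then have "(\<Sum>x<d. (cmod (y x))\<^sup>2) - (\<Sum>j<r. (cmod (c j))\<^sup>2) = (\<Sum>x<d. (cmod (y x - p x))\<^sup>2)"
    by (simp only: of_real_eq_iff)
  also have "\<dots> \<ge> 0" by (intro sum_nonneg) auto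
  finally show ?thesis by (simp add: c_def)
qed

lemma parseval:
  assumes "frame d t w" "\<And>x. x < d \<Longrightarrow> y x = (\<Sum>j<t. inner_sum d y (w j) * w j x)"
  shows "(\<Sum>x<d. (cmod (y x))\<^sup>2) = (\<Sum>j<t. (cmod (inner_sum d y (w j)))\<^sup>2)"
proof -
  have "inner_sum d y y = inner_sum d y (\<lambda>x. \<Sum>j<t. inner_sum d y (w j) * w j x)"
    by (rule inner_sum_cong) (use assms in auto)
  also have "\<dots> = complex_of_real (\<Sum>j<t. (cmod (inner_sum d y (w j)))\<^sup>2)"
    unfolding inner_sum_sum_right by (simp add: complex_norm_square mult.commute del: of_real_power)
  finally show ?thesis unfolding inner_sum_self by (simp only: of_real_eq_iff)
qed

text \<open>Used with \<open>s = 0\<close> for a frame that spans \<open>r\<close> given vectors,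
  where \<open>t \<le> r\<close> keeps the frame admissible in \<open>ky_fan_le\<close>, and with
  \<open>s = 1\<close> to complete a unit vector to an orthonormal basis.\<close>

lemma gram_schmidt_extension:
  fixes y :: "nat \<Rightarrow> nat \<Rightarrow> complex"
  assumes "frame d s w"
  shows "\<exists>t w'. s \<le> t \<and> t \<le> s + r \<and> frame d t w' \<and> (\<forall>i<s. w' i = w i)
    \<and> (\<forall>i<r. \<forall>x<d. y i x = (\<Sum>j<t. inner_sum d (y i) (w' j) * w' j x))"
proof (induction r)
  case 0
  with assms show ?case by (intro exI[of _ s] exI[of _ w]) auto
next
  case (Suc r)
  then obtain t w' where t: "s \<le> t" "t \<le> s + r" and fr: "frame d t w'"
    and w': "\<forall>i<s. w' i = w i"
    and y: "\<And>i x. i < r \<Longrightarrow> x < d \<Longrightarrow> y i x = (\<Sum>j<t. inner_sum d (y i) (w' j) * w' j x)"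
    by blast
  define p where "p x = (\<Sum>j<t. inner_sum d (y r) (w' j) * w' j x)" for x
  define u where "u x = y r x - p x" for x
  have uw: "inner_sum d u (w' i) = 0" if "i < t" for i
    unfolding u_def inner_sum_diff_left unfolding p_def
    using inner_sum_frame_expansion[OF fr that] by simp
  define N where "N = (\<Sum>x<d. (cmod (u x))\<^sup>2)"
  have uu: "inner_sum d u u = complex_of_real N" unfolding N_def inner_sum_self ..
  \<comment> \<open>A vector already expanded in \<open>w'\<close> has no component along the
    remainder \<open>u\<close>, so adding the normalised remainder leaves its expansion
    unchanged.\<close>
  have span: "inner_sum d f u = 0"
    if "\<And>x. x < d \<Longrightarrow> f x = (\<Sum>j<t. inner_sum d f (w' j) * w' j x)" for f
  proof -
    have "inner_sum d f u = inner_sum d (\<lambda>x. \<Sum>j<t. inner_sum d f (w' j) * w' j x) u"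
      by (rule inner_sum_cong) (use that in auto)
    also have "\<dots> = 0"
      unfolding inner_sum_sum_left using uw
      by (intro sum.neutral) (auto simp: inner_sum_commute[of d "w' _" u])
    finally show ?thesis .
  qed
  show ?case
  proof (cases "N = 0")
    case True
    then have "u x = 0" if "x < d" for x
      using that unfolding N_def by (subst (asm) sum_nonneg_eq_0_iff) auto
    then have "\<forall>i<Suc r. \<forall>x<d. y i x = (\<Sum>j<t. inner_sum d (y i) (w' j) * w' j x)"
      using y by (auto simp: less_Suc_eq u_def p_def)
    with t fr w' show ?thesis by (intro exI[of _ t] exI[of _ w']) auto
  next
    case False
    then have Npos: "N > 0" unfolding N_def by (simp add: order_less_le sum_nonneg)
    define z where "z x = complex_of_real (1 / sqrt N) * u x" for x
    define w'' where "w'' = w'(t := z)"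
    have zz: "inner_sum d z z = 1"
      unfolding z_def inner_sum_scale_left inner_sum_scale_right uu using Npos
      by (simp flip: of_real_mult)
    have zw: "inner_sum d z (w' i) = 0" "inner_sum d (w' i) z = 0" if "i < t" for i
      using uw[OF that] inner_sum_commute[of d "w' i" u]
      unfolding z_def inner_sum_scale_left inner_sum_scale_right by auto
    have fr'': "frame d (Suc t) w''"
      using fr zz zw unfolding frame_inner_sum w''_def by (auto simp: less_Suc_eq)
    have uz: "inner_sum d f z * z x = inner_sum d f u / complex_of_real N * u x" for f x
    proof -
      have "inner_sum d f z * z x
          = complex_of_real (1 / sqrt N * (1 / sqrt N)) * inner_sum d f u * u x"
        unfolding z_def inner_sum_scale_right of_real_mult complex_cnj_complex_of_real
        by (simp only: ac_simps)
      also have "1 / sqrt N * (1 / sqrt N) = 1 / N" using Npos by simp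
      finally show ?thesis by simp
    qed
    have y'': "y i x = (\<Sum>j<Suc t. inner_sum d (y i) (w'' j) * w'' j x)"
      if "i < Suc r" "x < d" for i x
    proof -
      have "(\<Sum>j<Suc t. inner_sum d (y i) (w'' j) * w'' j x)
          = (\<Sum>j<t. inner_sum d (y i) (w' j) * w' j x) + inner_sum d (y i) z * z x"
        by (simp add: w''_def)
      also have "\<dots> = y i x"
      proof (cases "i < r")
        case True
        then have "inner_sum d (y i) u = 0" using y by (intro span) auto
        with True that y show ?thesis unfolding uz by auto
      next
        case False
        with that have i: "i = r" by simp
        have pw: "inner_sum d p (w' j) = inner_sum d (y r) (w' j)" if "j < t" for j
          using inner_sum_frame_expansion[OF fr that, of "\<lambda>j. inner_sum d (y r) (w' j)"]
          unfolding p_def .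
        have "inner_sum d p u = 0"
          by (rule span) (simp add: pw p_def)
        moreover have "inner_sum d u u = inner_sum d (y r) u - inner_sum d p u"
          unfolding u_def inner_sum_diff_left ..
        ultimately have "inner_sum d (y r) u = complex_of_real N" using uu by simp
        then show ?thesis using Npos unfolding i uz by (simp add: u_def p_def)
      qed
      finally show ?thesis ..
    qed
    have "\<forall>i<s. w'' i = w i" using w' t by (auto simp: w''_def)
    with t fr'' y'' show ?thesis
      by (intro exI[of _ "Suc t"] exI[of _ w'']) auto
  qed
qed

text \<open>
  By Ky Fan's maximum principle, for a positive semi-definite \<open>A\<close> this says that the sum of the
  \<open>k\<close> largest eigenvalues is at most \<open>c\<close>.
\<close>

definition ky_fan_le :: "nat \<Rightarrow> (nat \<Rightarrow> nat \<Rightarrow> complex) \<Rightarrow> nat \<Rightarrow> real \<Rightarrow> bool" where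
  "ky_fan_le d A k c \<longleftrightarrow> (\<forall>r v. r \<le> k \<longrightarrow> frame d r v \<longrightarrow>
     Re (\<Sum>i<r. \<Sum>x<d. \<Sum>y<d. A x y * v i y * cnj (v i x)) \<le> c)"

section \<open>Calculus of the Ky Fan bound\<close>

lemma ky_fan_le_cong:
  assumes "ky_fan_le d A k c" "\<And>x y. x < d \<Longrightarrow> y < d \<Longrightarrow> A x y = B x y" "c = c'"
  shows "ky_fan_le d B k c'"
  using assms by (simp add: ky_fan_le_def)

text \<open>Subadditivity of the sum of the \<open>k\<close> largest eigenvalues: a single frame
  serves all summands, while the best frames of the summands may differ.\<close>

lemma ky_fan_le_sum:
  assumes "\<And>i. i \<in> I \<Longrightarrow> ky_fan_le d (A i) k (c i)"
  shows "ky_fan_le d (\<lambda>x y. \<Sum>i\<in>I. A i x y) k (\<Sum>i\<in>I. c i)"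
  unfolding ky_fan_le_def
proof (intro allI impI)
  fix r v assume r: "r \<le> k" "frame d r v"
  have "(\<Sum>i<r. \<Sum>x<d. \<Sum>y<d. (\<Sum>q\<in>I. A q x y) * v i y * cnj (v i x))
      = (\<Sum>i<r. \<Sum>x<d. \<Sum>y<d. \<Sum>q\<in>I. A q x y * v i y * cnj (v i x))"
    by (simp add: sum_distrib_right)
  also have "\<dots> = (\<Sum>q\<in>I. \<Sum>i<r. \<Sum>x<d. \<Sum>y<d. A q x y * v i y * cnj (v i x))"
    by (simp only: sum.swap[of _ _ I])
  finally have "Re (\<Sum>i<r. \<Sum>x<d. \<Sum>y<d. (\<Sum>q\<in>I. A q x y) * v i y * cnj (v i x))
     = (\<Sum>q\<in>I. Re (\<Sum>i<r. \<Sum>x<d. \<Sum>y<d. A q x y * v i y * cnj (v i x)))"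
    by simp
  also have "\<dots> \<le> (\<Sum>q\<in>I. c q)"
    using assms r by (intro sum_mono) (auto simp: ky_fan_le_def)
  finally show "Re (\<Sum>i<r. \<Sum>x<d. \<Sum>y<d. (\<Sum>q\<in>I. A q x y) * v i y * cnj (v i x)) \<le> (\<Sum>q\<in>I. c q)" .
qed

lemma ky_fan_le_scale:
  assumes "ky_fan_le d A k c" "0 \<le> a"
  shows "ky_fan_le d (\<lambda>x y. complex_of_real a * A x y) k (a * c)"
  unfolding ky_fan_le_def
proof (intro allI impI)
  fix r v assume r: "r \<le> k" "frame d r v"
  have "(\<Sum>i<r. \<Sum>x<d. \<Sum>y<d. complex_of_real a * A x y * v i y * cnj (v i x))
      = complex_of_real a * (\<Sum>i<r. \<Sum>x<d. \<Sum>y<d. A x y * v i y * cnj (v i x))"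
    by (simp add: sum_distrib_left mult.assoc)
  with assms r show "Re (\<Sum>i<r. \<Sum>x<d. \<Sum>y<d. complex_of_real a * A x y * v i y * cnj (v i x)) \<le> a * c"
    by (simp add: ky_fan_le_def mult_left_mono)
qed

text \<open>Applied to \<open>M\<close> and to its adjoint in \<open>ky_fan_le_gram\<close>, which
  compares the squared norms of \<open>M\<^sup>* v\<close> and \<open>M w\<close>.\<close>

lemma sum_adjoint_quadratic:
  fixes M :: "nat \<Rightarrow> nat \<Rightarrow> complex"
  shows "(\<Sum>x<p. \<Sum>y<p. (\<Sum>l<q. M x l * cnj (M y l)) * v y * cnj (v x))
    = complex_of_real (\<Sum>l<q. (cmod (\<Sum>a<p. cnj (M a l) * v a))\<^sup>2)"
proof -
  have "(\<Sum>x<p. \<Sum>y<p. (\<Sum>l<q. M x l * cnj (M y l)) * v y * cnj (v x))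
      = (\<Sum>x<p. \<Sum>y<p. \<Sum>l<q. M x l * cnj (M y l) * v y * cnj (v x))"
    by (simp add: sum_distrib_right)
  also have "\<dots> = (\<Sum>l<q. \<Sum>x<p. \<Sum>y<p. M x l * cnj (M y l) * v y * cnj (v x))"
    by (simp only: sum.swap[of _ _ "{..<q}"])
  also have "\<dots> = (\<Sum>l<q. (\<Sum>y<p. cnj (M y l) * v y) * cnj (\<Sum>x<p. cnj (M x l) * v x))"
    by (intro sum.cong refl) (simp add: sum_product, subst sum.swap, simp add: ac_simps)
  also have "\<dots> = complex_of_real (\<Sum>l<q. (cmod (\<Sum>a<p. cnj (M a l) * v a))\<^sup>2)"
    by (simp only: complex_norm_square of_real_sum)
  finally show ?thesis .
qed

text \<open>\<open>M M\<^sup>*\<close> and \<open>M\<^sup>* M\<close> have the same non-zero eigenvalues.\<close>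

lemma ky_fan_le_gram:
  fixes M :: "nat \<Rightarrow> nat \<Rightarrow> complex"
  assumes "ky_fan_le q (\<lambda>x y. \<Sum>j<p. cnj (M j x) * M j y) k c"
  shows "ky_fan_le p (\<lambda>x y. \<Sum>l<q. M x l * cnj (M y l)) k c"
  unfolding ky_fan_le_def
proof (intro allI impI)
  fix r v assume r: "r \<le> k" and fr: "frame p r v"
  define y where "y i l = (\<Sum>a<p. cnj (M a l) * v i a)" for i l
  define e where "e w j a = (\<Sum>l<q. M a l * w j l)" for w :: "nat \<Rightarrow> nat \<Rightarrow> complex" and j a
  have "frame q 0 (\<lambda>_ _. 0)" by (simp add: frame_def)
  \<comment> \<open>\<open>w\<close> spans the vectors \<open>M\<^sup>* v i\<close>. It may have
    fewer than \<open>r\<close> members, which is why \<open>ky_fan_le\<close> ranges over all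
    \<open>r \<le> k\<close>.\<close>
  from gram_schmidt_extension[OF this, of r y] obtain t w where t: "t \<le> r" and frw: "frame q t w"
    and y: "\<And>i x. i < r \<Longrightarrow> x < q \<Longrightarrow> y i x = (\<Sum>j<t. inner_sum q (y i) (w j) * w j x)"
    by auto
  have ip: "inner_sum q (y i) (w j) = cnj (inner_sum p (e w j) (v i))" for i j
  proof -
    have "inner_sum q (y i) (w j) = (\<Sum>l<q. \<Sum>a<p. cnj (M a l) * v i a * cnj (w j l))"
      by (simp add: inner_sum_def y_def sum_distrib_right)
    also have "\<dots> = (\<Sum>a<p. \<Sum>l<q. cnj (M a l) * v i a * cnj (w j l))" by (rule sum.swap)
    also have "\<dots> = cnj (inner_sum p (e w j) (v i))"
      by (simp add: inner_sum_def e_def sum_distrib_right sum_distrib_left ac_simps)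
    finally show ?thesis .
  qed
  have "(\<Sum>i<r. \<Sum>x<p. \<Sum>b<p. (\<Sum>l<q. M x l * cnj (M b l)) * v i b * cnj (v i x))
      = complex_of_real (\<Sum>i<r. \<Sum>l<q. (cmod (y i l))\<^sup>2)"
    unfolding sum_adjoint_quadratic y_def by simp
  then have "Re (\<Sum>i<r. \<Sum>x<p. \<Sum>b<p. (\<Sum>l<q. M x l * cnj (M b l)) * v i b * cnj (v i x))
      = (\<Sum>i<r. \<Sum>l<q. (cmod (y i l))\<^sup>2)" by simp
  also have "\<dots> = (\<Sum>i<r. \<Sum>j<t. (cmod (inner_sum q (y i) (w j)))\<^sup>2)"
    by (intro sum.cong refl parseval[OF frw] y) auto
  also have "\<dots> = (\<Sum>i<r. \<Sum>j<t. (cmod (inner_sum p (e w j) (v i)))\<^sup>2)"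
    unfolding ip by simp
  also have "\<dots> = (\<Sum>j<t. \<Sum>i<r. (cmod (inner_sum p (e w j) (v i)))\<^sup>2)" by (rule sum.swap)
  \<comment> \<open>\<open>e w j\<close> is the vector \<open>M w j\<close>; the left side only
    counts its components in the span of \<open>v\<close>.\<close>
  also have "\<dots> \<le> (\<Sum>j<t. \<Sum>a<p. (cmod (e w j a))\<^sup>2)"
    by (intro sum_mono bessel[OF fr])
  also have "\<dots> = Re (\<Sum>j<t. \<Sum>x<q. \<Sum>b<q. (\<Sum>a<p. cnj (M a x) * M a b) * w j b * cnj (w j x))"
    using sum_adjoint_quadratic[where M = "\<lambda>x a. cnj (M a x)"] by (simp add: e_def)
  also have "\<dots> \<le> c" using assms t r frw by (simp add: ky_fan_le_def)
  finally show "Re (\<Sum>i<r. \<Sum>x<p. \<Sum>b<p. (\<Sum>l<q. M x l * cnj (M b l)) * v i b * cnj (v i x)) \<le> c" .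
qed

text \<open>The squared moduli of all entries add up to \<open>r\<close> when summed vector by
  vector; coordinate by coordinate they add up to at most \<open>d\<close>, by Bessel's inequality
  for the standard basis vectors.\<close>

lemma frame_le_dim:
  assumes "frame d r v"
  shows "r \<le> d"
proof -
  have "real r = (\<Sum>i<r. \<Sum>x<d. (cmod (v i x))\<^sup>2)"
  proof -
    have "(\<Sum>x<d. (cmod (v i x))\<^sup>2) = 1" if "i < r" for i
      using assms that inner_sum_self[of d "v i"] unfolding frame_inner_sum
      by (metis of_real_eq_1_iff)
    then show ?thesis by simp
  qed
  also have "\<dots> = (\<Sum>x<d. \<Sum>i<r. (cmod (v i x))\<^sup>2)" by (rule sum.swap)
  also have "\<dots> \<le> (\<Sum>x<d. 1)"
  proof (intro sum_mono)
    fix x assume x: "x \<in> {..<d}"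
    define y :: "nat \<Rightarrow> complex" where "y b = (if b = x then 1 else 0)" for b
    have "inner_sum d y (v i) = cnj (v i x)" for i
    proof -
      have "inner_sum d y (v i) = (\<Sum>a<d. if a = x then cnj (v i a) else 0)"
        unfolding inner_sum_def y_def by (intro sum.cong) auto
      with x show ?thesis by simp
    qed
    then have "(\<Sum>i<r. (cmod (v i x))\<^sup>2) = (\<Sum>i<r. (cmod (inner_sum d y (v i)))\<^sup>2)" by simp
    also have "\<dots> \<le> (\<Sum>b<d. (cmod (y b))\<^sup>2)" by (rule bessel[OF assms])
    also have "\<dots> = (\<Sum>b<d. if b = x then 1 else 0)" by (intro sum.cong) (auto simp: y_def)
    also have "\<dots> = 1" using x by simp
    finally show "(\<Sum>i<r. (cmod (v i x))\<^sup>2) \<le> 1" .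
  qed
  finally show ?thesis by simp
qed

section \<open>Coupling spins: the Gram matrix recursion\<close>

text \<open>Both sides count the ways to split \<open>y + y' + e + r\<close> objects into four
  labelled blocks of these sizes.\<close>

lemma choose_product_exchange:
  "(y + y' + e + r choose (y + y')) * (y + y' choose y) * (e + r choose e)
    = (y + y' + e + r choose (y + e)) * (y + e choose y) * (y' + r choose y')"
proof -
  have "y + y' + e + r - (y + y') = e + r" "y + y' + e + r - (y + e) = y' + r" by simp_all
  then have "real ((y + y' + e + r choose (y + y')) * (y + y' choose y) * (e + r choose e))
      = real ((y + y' + e + r choose (y + e)) * (y + e choose y) * (y' + r choose y'))"
    by (simp add: binomial_fact)
  then show ?thesis by (simp only: of_nat_eq_iff)
qed

text \<open>Two four-block splittings: \<open>m\<close> into \<open>l - e\<close>,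
  \<open>q - (l - e)\<close>, \<open>e\<close>, \<open>r\<close>, and \<open>n\<close> into
  \<open>k - e\<close>, \<open>q - (k - e)\<close> and the remainders of \<open>a\<close> and
  \<open>n - a\<close>. If a block would be negative, a binomial coefficient vanishes on either
  side.\<close>

lemma normal_order_term:
  fixes n m q e r k l a :: nat
  assumes "q + e + r = m" "e \<le> k" "e \<le> l" "k - e \<le> a" "a \<le> n" "l \<le> m" "k - e \<le> q"
  shows "(m choose q) * (n choose q) *
      ((q choose (k - e)) * (q choose (l - e)) * (m - q choose e) * (n - q choose (a + e - k)))
    = (m choose l) * (n choose a) *
      ((l choose e) * (a choose (k - e)) * ((m - l choose r) * (n - a choose (m - k - r))))"
proof -
  define x where "x = k - e"
  have x: "x \<le> a" "x \<le> q" "a + e - k = a - x" "m - k - r = q - x"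
    using assms by (auto simp: x_def)
  consider "l - e > q" | "l - e \<le> q" "a - x > n - q \<or> q > n" | "l - e \<le> q" "a - x \<le> n - q" "q \<le> n"
    by linarith
  then show ?thesis
  proof cases
    case 1
    then have "m - l < r" using assms by simp
    with 1 show ?thesis by (simp add: binomial_eq_0)
  next
    case 2
    then have "n - a < q - x" using assms(5) x(1,2) by arith
    with 2 show ?thesis unfolding x by (auto simp: binomial_eq_0)
  next
    case 3
    define y where "y = l - e"
    define y' where "y' = q - y"
    define x' where "x' = q - x"
    define d where "d = a - x"
    define d' where "d' = n - q - d"
    have eqs: "q = y + y'" "l = y + e" "m = y + y' + e + r" "m - q = e + r" "m - l = y' + r"
      "q = x + x'" "a = x + d" "n = x + x' + d + d'" "n - q = d + d'" "n - a = x' + d'"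
      using assms 3 x by (auto simp: y_def y'_def x'_def d_def d'_def)
    have n: "q + d + d' = n" using 3 by (simp add: d'_def d_def)
    have 1: "(m choose q) * (q choose y) * (m - q choose e) = (m choose l) * (l choose y) * (m - l choose y')"
      using choose_product_exchange[of y y' e r] 
      by (simp only: eqs(1,2,4,5)[symmetric] assms(1))
    have 2: "(n choose q) * (q choose x) * (n - q choose d) = (n choose a) * (a choose x) * (n - a choose x')"
      using choose_product_exchange[of x x' d d'] 
      by (simp only: eqs(6,7,9,10)[symmetric] n)
    have sym: "l choose y = l choose e" "m - l choose y' = m - l choose r"
      using binomial_symmetric[of y l] binomial_symmetric[of y' "m - l"] eqs by auto
    have "(m choose q) * (n choose q) *
      ((q choose x) * (q choose y) * (m - q choose e) * (n - q choose d))
      = ((m choose q) * (q choose y) * (m - q choose e)) * ((n choose q) * (q choose x) * (n - q choose d))"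
      by (simp only: ac_simps)
    also have "\<dots> = (m choose l) * (n choose a) *
      ((l choose e) * (a choose x) * ((m - l choose r) * (n - a choose x')))"
      unfolding 1 2 sym by (simp only: ac_simps)
    finally show ?thesis unfolding x x'_def[symmetric] x_def[symmetric] y_def d_def .
  qed
qed

text \<open>
  The normal ordering of \<open>a\<^sup>m (a\<^sup>*)\<^sup>m\<close> for two modes, as an identity for binomial coefficients: it is
  the product of two Vandermonde identities, regrouped by the degree \<open>q\<close> of the normally ordered
  terms.
\<close>

lemma normal_order_sum:
  fixes n m k l a :: nat
  assumes "a \<le> n" "k \<le> m" "l \<le> m"
  shows "(\<Sum>q\<le>m. (m choose q) * (n choose q) *
       (\<Sum>e\<le>m - q. if e \<le> k \<and> e \<le> l \<and> k - e \<le> a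
          then (q choose (k - e)) * (q choose (l - e)) * (m - q choose e) * (n - q choose (a + e - k))
          else 0))
    = (m choose l) * (n choose a) * ((a + l choose k) * (n + m - (a + l) choose (m - k)))"
proof -
  define g where "g = (\<lambda>(q, e). (m choose q) * (n choose q) *
       (if e \<le> k \<and> e \<le> l \<and> k - e \<le> a
          then (q choose (k - e)) * (q choose (l - e)) * (m - q choose e) * (n - q choose (a + e - k))
          else 0))"
  define h where "h = (\<lambda>(e, r). (m choose l) * (n choose a) *
      ((l choose e) * (a choose (k - e)) * ((m - l choose r) * (n - a choose (m - k - r)))))"
  define S where "S = Sigma {..m} (\<lambda>q. {..m - q})"
  have "(\<Sum>q\<le>m. (m choose q) * (n choose q) *
       (\<Sum>e\<le>m - q. if e \<le> k \<and> e \<le> l \<and> k - e \<le> a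
          then (q choose (k - e)) * (q choose (l - e)) * (m - q choose e) * (n - q choose (a + e - k))
          else 0)) = (\<Sum>q\<le>m. \<Sum>e\<le>m - q. g (q, e))"
    by (simp only: g_def sum_distrib_left prod.case)
  also have "\<dots> = sum g S" unfolding S_def by (subst sum.Sigma) auto
  also have "\<dots> = sum g (S - {(q, e). e > k \<or> k - e > q})"
    by (rule sum.mono_neutral_right) (auto simp: S_def g_def split: if_splits)
  \<comment> \<open>On the remaining pairs \<open>k \<le> q + e\<close>, so
    \<open>r = m - q - e\<close> runs over \<open>{..m - k}\<close> independently of
    \<open>e\<close> and the double sum factorises.\<close>
  also have "\<dots> = sum h ({..k} \<times> {..m - k})"
  proof (rule sum.reindex_bij_witness[where i = "\<lambda>(e, r). (m - e - r, e)" and j = "\<lambda>(q, e). (e, m - q - e)"])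
    fix p assume "p \<in> S - {(q, e). e > k \<or> k - e > q}"
    then obtain q e where "p = (q, e)" "q \<le> m" "e \<le> m - q" "\<not> e > k" "\<not> k - e > q"
      by (auto simp: S_def)
    then have p: "p = (q, e)" "q \<le> m" "e \<le> m - q" "e \<le> k" "k - e \<le> q" by auto
    show "h (case p of (q, e) \<Rightarrow> (e, m - q - e)) = g p"
    proof (cases "e \<le> l \<and> k - e \<le> a")
      case True
      with p have cond: "e \<le> k \<and> e \<le> l \<and> k - e \<le> a" by simp
      have "(m choose q) * (n choose q) *
          ((q choose (k - e)) * (q choose (l - e)) * (m - q choose e) * (n - q choose (a + e - k)))
        = (m choose l) * (n choose a) *
          ((l choose e) * (a choose (k - e)) * ((m - l choose (m - q - e)) * (n - a choose (m - k - (m - q - e)))))"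
        by (rule normal_order_term) (use p assms cond in auto)
      then show ?thesis by (simp only: g_def h_def p prod.case cond simp_thms if_True)
    next
      case False
      then show ?thesis by (auto simp: p g_def h_def)
    qed
  qed (use assms in \<open>auto simp: S_def\<close>)
  also have "\<dots> = (\<Sum>e\<le>k. \<Sum>r\<le>m - k. h (e, r))" by (simp add: sum.cartesian_product)
  also have "\<dots> = (m choose l) * (n choose a) *
      ((\<Sum>e\<le>k. (l choose e) * (a choose (k - e))) * (\<Sum>r\<le>m - k. (m - l choose r) * (n - a choose (m - k - r))))"
    unfolding h_def prod.case by (subst sum_product) (simp add: sum_distrib_left mult.assoc)
  also have "(\<Sum>e\<le>k. (l choose e) * (a choose (k - e))) = (a + l choose k)"
    using vandermonde[of l a k] by (simp add: add.commute)
  also have "(\<Sum>r\<le>m - k. (m - l choose r) * (n - a choose (m - k - r))) = (n + m - (a + l) choose (m - k))"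
    using vandermonde[of "m - l" "n - a" "m - k"] assms by (simp add: algebra_simps)
  finally show ?thesis .
qed

section \<open>Clebsch-Gordan coefficients of the largest total spin\<close>

text \<open>With this factor the monomial with exponents \<open>n - a\<close> and \<open>a\<close>
  is a unit vector in the rotation invariant inner product of homogeneous polynomials of degree
  \<open>n\<close>, normalised so that pure powers have norm one. Products of such unit vectors
  expand with the coefficients \<open>cg\<close>.\<close>

definition sqrt_binom :: "nat \<Rightarrow> nat \<Rightarrow> real" where
  "sqrt_binom n a = sqrt (real (n choose a))"

lemma sqrt_binom_sq [simp]: "sqrt_binom n a * sqrt_binom n a = real (n choose a)"
  by (simp add: sqrt_binom_def)

lemma sqrt_binom_pos: "a \<le> n \<Longrightarrow> sqrt_binom n a > 0"
  by (simp add: sqrt_binom_def)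

text \<open>
  The Clebsch--Gordan coefficient of the projection of \<open>e\<^sub>a \<otimes> e\<^sub>l\<close> from spin \<open>n/2\<close> times spin \<open>m/2\<close>
  to the basis vector \<open>e\<^sub>j\<close> of spin \<open>(n + m)/2\<close>.
\<close>

definition cg :: "nat \<Rightarrow> nat \<Rightarrow> nat \<Rightarrow> nat \<Rightarrow> nat \<Rightarrow> real" where
  "cg n m l j a = (if j = a + l then sqrt_binom n a * sqrt_binom m l / sqrt_binom (n + m) j else 0)"

lemma cg_sq:
  "cg n m l j a * cg n m l j a
    = (if j = a + l then real (n choose a) * real (m choose l) / real (n + m choose j) else 0)"
proof (cases "j = a + l")
  case True
  then have "cg n m l j a * cg n m l j a = (sqrt_binom n a * sqrt_binom n a) *
      (sqrt_binom m l * sqrt_binom m l) / (sqrt_binom (n + m) j * sqrt_binom (n + m) j)"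
    by (simp add: cg_def del: sqrt_binom_sq)
  with True show ?thesis by simp
qed (simp add: cg_def)

lemma sum_shift_delta:
  fixes g :: "nat \<Rightarrow> 'a :: comm_monoid_add"
  shows "(\<Sum>x\<le>q. if k = x + e then g x else 0)
    = (if e \<le> k \<and> k - e \<le> q then g (k - e) else 0)"
proof -
  have "(\<Sum>x\<le>q. if k = x + e then g x else 0)
      = (\<Sum>x\<le>q. if x = k - e then (if e \<le> k then g (k - e) else 0) else 0)"
    by (intro sum.cong) auto
  then show ?thesis by auto
qed

text \<open>The adjoint of the coupling is an isometry from spin \<open>(n + m) / 2\<close> into the
  tensor product; for the basis vector with index \<open>a\<close> this is Vandermonde's
  identity.\<close>

lemma cg_partial_trace:
  assumes "a \<le> n + m"
  shows "(\<Sum>d\<le>m. \<Sum>x\<le>n. cg n m d a x * cg n m d a x) = 1"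
proof -
  have "(\<Sum>d\<le>m. \<Sum>x\<le>n. cg n m d a x * cg n m d a x)
      = (\<Sum>d\<le>m. if d \<le> a \<and> a - d \<le> n then real (n choose (a - d)) * real (m choose d) / real (n + m choose a) else 0)"
    unfolding cg_sq sum_shift_delta ..
  also have "\<dots> = (\<Sum>d\<le>a. real (n choose (a - d)) * real (m choose d) / real (n + m choose a))"
    by (rule sum.mono_neutral_cong) auto
  also have "\<dots> = real (\<Sum>d\<le>a. (m choose d) * (n choose (a - d))) / real (n + m choose a)"
    by (simp add: sum_divide_distrib mult.commute)
  also have "\<dots> = 1" using assms vandermonde[of m n a] by (simp add: add.commute)
  finally show ?thesis .
qed

lemma ratio_cancel: "(real m + 1) / (real q + 1) * ((real q + 1) / (real m + 1)) = 1"
proof -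
  have "x / y * (y / x) = 1" if "x > 0" "y > 0" for x y :: real using that by simp
  then show ?thesis by simp
qed

text \<open>The probability that a random permutation of \<open>n + m\<close> objects moves exactly
  \<open>q\<close> of the first \<open>n\<close> into the last \<open>m\<close> places, a
  hypergeometric weight.\<close>

definition gram_weight :: "nat \<Rightarrow> nat \<Rightarrow> nat \<Rightarrow> real" where
  "gram_weight n m q = real (m choose q) * real (n choose q) / real (n + m choose n)"

text \<open>For spins 1/2 in two symmetric groups of \<open>n\<close> and \<open>m\<close>, the left
  side is an entry of the projection onto the symmetric subspace, an average over permutations.
  Grouped by the number \<open>q\<close> of exchanged spins, \<open>x\<close> and \<open>y\<close>
  index the exchanged ones, \<open>e\<close> and \<open>d\<close> those that stay in the groups of
  \<open>m\<close> and of \<open>n\<close>. Once the square roots are collected in \<open>D\<close>,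
  the identity is \<open>normal_order_sum\<close>.\<close>

lemma cg_gram:
  assumes "a \<le> n" "b \<le> n" "k \<le> m" "l \<le> m"
  shows "(\<Sum>j\<le>n + m. cg n m k j b * cg n m l j a)
    = (\<Sum>q\<le>m. gram_weight n m q * (\<Sum>e\<le>m - q. \<Sum>d\<le>n - q. \<Sum>x\<le>q. \<Sum>y\<le>q.
         cg q (m - q) e k x * cg q (m - q) e l y * (cg q (n - q) d a x * cg q (n - q) d b y)))"
proof (cases "a + l = b + k")
  case False
  then have "(\<Sum>j\<le>n + m. cg n m k j b * cg n m l j a) = 0"
    by (intro sum.neutral) (auto simp: cg_def)
  moreover have "cg q (m - q) e k x * cg q (m - q) e l y * (cg q (n - q) d a x * cg q (n - q) d b y) = 0"
    for q e d x y using False by (auto simp: cg_def)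
  ultimately show ?thesis by simp
next
  case True
  define D where "D = sqrt_binom m k * sqrt_binom m l * sqrt_binom n a * sqrt_binom n b"
  have Dpos: "D > 0" unfolding D_def by (intro mult_pos_pos sqrt_binom_pos assms)
  have DD: "D * D = real (m choose k) * real (m choose l) * real (n choose a) * real (n choose b)"
  proof -
    have "D * D = (sqrt_binom m k * sqrt_binom m k) * (sqrt_binom m l * sqrt_binom m l)
      * (sqrt_binom n a * sqrt_binom n a) * (sqrt_binom n b * sqrt_binom n b)"
      unfolding D_def by (simp only: ac_simps)
    then show ?thesis by simp
  qed
  define F where "F q = (\<Sum>e\<le>m - q. if e \<le> k \<and> e \<le> l \<and> k - e \<le> a
          then (q choose (k - e)) * (q choose (l - e)) * (m - q choose e) * (n - q choose (a + e - k))
          else 0)" for q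
  have "(\<Sum>j\<le>n + m. cg n m k j b * cg n m l j a)
      = (\<Sum>j\<le>n + m. if j = a + l then D / (sqrt_binom (n + m) j * sqrt_binom (n + m) j) else 0)"
    using True by (intro sum.cong) (auto simp: cg_def D_def)
  also have "\<dots> = D / real (n + m choose (a + l))" using assms by simp
  finally have lhs: "(\<Sum>j\<le>n + m. cg n m k j b * cg n m l j a) = D / real (n + m choose (a + l))" .
  \<comment> \<open>The square roots in the numerators, with upper arguments \<open>q\<close>,
    \<open>m - q\<close> and \<open>n - q\<close>, occur in equal pairs; the unpaired denominators
    make up \<open>D\<close>.\<close>
  have inner: "(\<Sum>e\<le>m - q. \<Sum>d\<le>n - q. \<Sum>x\<le>q. \<Sum>y\<le>q.
         cg q (m - q) e k x * cg q (m - q) e l y * (cg q (n - q) d a x * cg q (n - q) d b y))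
      = real (F q) / D" if q: "q \<le> m" "q \<le> n" for q
  proof -
    define G where "G e d x y = real (q choose x) * real (q choose y) * real (m - q choose e)
      * real (n - q choose d) / D" for e d x y
    have "cg q (m - q) e k x * cg q (m - q) e l y * (cg q (n - q) d a x * cg q (n - q) d b y)
      = (if l = y + e then if k = x + e then if a = d + x then G e d x y else 0 else 0 else 0)" for e d x y
    proof (cases "l = y + e \<and> k = x + e \<and> a = d + x")
      case c: True
      have "cg q (m - q) e k x * cg q (m - q) e l y * (cg q (n - q) d a x * cg q (n - q) d b y)
        = (sqrt_binom q x * sqrt_binom q x) * (sqrt_binom q y * sqrt_binom q y)
         * (sqrt_binom (m - q) e * sqrt_binom (m - q) e) * (sqrt_binom (n - q) d * sqrt_binom (n - q) d) / D"
        using c True q unfolding D_def by (auto simp: cg_def ac_simps simp del: sqrt_binom_sq)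
      with c show ?thesis by (simp add: G_def)
    qed (auto simp: cg_def)
    then have "(\<Sum>e\<le>m - q. \<Sum>d\<le>n - q. \<Sum>x\<le>q. \<Sum>y\<le>q.
         cg q (m - q) e k x * cg q (m - q) e l y * (cg q (n - q) d a x * cg q (n - q) d b y))
      = (\<Sum>e\<le>m - q. \<Sum>d\<le>n - q. \<Sum>x\<le>q. \<Sum>y\<le>q.
          if l = y + e then if k = x + e then if a = d + x then G e d x y else 0 else 0 else 0)"
      by simp
    also have "\<dots> = (\<Sum>e\<le>m - q. \<Sum>d\<le>n - q. \<Sum>x\<le>q. if k = x + e then
          (if e \<le> l \<and> l - e \<le> q then if a = d + x then G e d x (l - e) else 0 else 0) else 0)"
      by (intro sum.cong refl, subst sum_shift_delta, auto)
    also have "\<dots> = (\<Sum>e\<le>m - q. \<Sum>d\<le>n - q. if a = d + (k - e) then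
          (if e \<le> k \<and> k - e \<le> q \<and> e \<le> l \<and> l - e \<le> q then G e d (k - e) (l - e) else 0) else 0)"
      by (intro sum.cong refl, subst sum_shift_delta, auto)
    also have "\<dots> = (\<Sum>e\<le>m - q. real (if e \<le> k \<and> e \<le> l \<and> k - e \<le> a
          then (q choose (k - e)) * (q choose (l - e)) * (m - q choose e) * (n - q choose (a + e - k))
          else 0) / D)"
      by (intro sum.cong refl, subst sum_shift_delta, auto simp: G_def not_le)
    also have "\<dots> = real (F q) / D" unfolding F_def by (simp only: sum_divide_distrib of_nat_sum)
    finally show ?thesis .
  qed
  have "(\<Sum>q\<le>m. gram_weight n m q * (\<Sum>e\<le>m - q. \<Sum>d\<le>n - q. \<Sum>x\<le>q. \<Sum>y\<le>q.
         cg q (m - q) e k x * cg q (m - q) e l y * (cg q (n - q) d a x * cg q (n - q) d b y)))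
      = (\<Sum>q\<le>m. real ((m choose q) * (n choose q) * F q) / (D * real (n + m choose n)))"
  proof (intro sum.cong refl)
    fix q assume q: "q \<in> {..m}"
    show "gram_weight n m q * (\<Sum>e\<le>m - q. \<Sum>d\<le>n - q. \<Sum>x\<le>q. \<Sum>y\<le>q.
         cg q (m - q) e k x * cg q (m - q) e l y * (cg q (n - q) d a x * cg q (n - q) d b y))
        = real ((m choose q) * (n choose q) * F q) / (D * real (n + m choose n))"
    proof (cases "q \<le> n")
      case True
      then show ?thesis using q by (subst inner) (auto simp: gram_weight_def)
    qed (simp add: gram_weight_def binomial_eq_0)
  qed
  also have "\<dots> = real (\<Sum>q\<le>m. (m choose q) * (n choose q) * F q) / (D * real (n + m choose n))"
    by (simp only: sum_divide_distrib of_nat_sum)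
  also have "(\<Sum>q\<le>m. (m choose q) * (n choose q) * F q)
      = (m choose l) * (n choose a) * ((a + l choose k) * (n + m - (a + l) choose (m - k)))"
    unfolding F_def by (rule normal_order_sum) (use assms in auto)
  also have "real ((m choose l) * (n choose a) * ((a + l choose k) * (n + m - (a + l) choose (m - k))))
      / (D * real (n + m choose n)) = D / real (n + m choose (a + l))"
  proof -
    \<comment> \<open>A four-block splitting of \<open>n + m\<close> into \<open>k\<close>,
      \<open>m - k\<close>, \<open>b\<close>, \<open>n - b\<close>; it turns the remaining binomials
      into \<open>D * D\<close>, up to \<open>n + m choose n\<close>.\<close>
    have "(n + m choose (a + l)) * (a + l choose k) * (n + m - (a + l) choose (m - k))
        = (n + m choose m) * (m choose k) * (n choose b)"
    proof -
      have "k + (m - k) = m" "b + (n - b) = n" "m + b + (n - b) = n + m" using assms by auto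
      note exchange = choose_product_exchange[of k "m - k" b "n - b", unfolded this]
      have "a + l = k + b" "n + m - (k + b) = (m - k) + (n - b)" using assms True by auto
      then show ?thesis by (simp only: exchange)
    qed
    then have "real (n + m choose (a + l)) * real (a + l choose k) * real (n + m - (a + l) choose (m - k))
        = real (n + m choose m) * real (m choose k) * real (n choose b)"
      by (metis of_nat_mult)
    moreover have "n + m choose m = n + m choose n" by (metis add.commute binomial_symmetric diff_add_inverse le_add1)
    moreover have "real (n + m choose (a + l)) > 0" "real (n + m choose n) > 0"
      using assms by auto
    ultimately show ?thesis using Dpos
      by (simp add: field_simps DD)
  qed
  finally show ?thesis using lhs by simp
qed


section \<open>The cloning map and the induction on its target dimension\<close>

text \<open>The universal cloning channel from \<open>n\<close> to \<open>n + m\<close> spins 1/2, a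
  multiple of \<open>P (\<sigma> \<otimes> I) P\<close>; the prefactor, a ratio of dimensions, makes
  it trace preserving.\<close>

definition clone :: "nat \<Rightarrow> nat \<Rightarrow> (nat \<Rightarrow> nat \<Rightarrow> complex) \<Rightarrow> nat \<Rightarrow> nat \<Rightarrow> complex" where
  "clone n m \<sigma> j j' = complex_of_real ((real n + 1) / (real (n + m) + 1)) *
     (\<Sum>l\<le>m. \<Sum>a\<le>n. \<Sum>b\<le>n. complex_of_real (cg n m l j a * cg n m l j' b) * \<sigma> a b)"

text \<open>The sum of the \<open>k\<close> largest eigenvalues of the image of a coherent state.\<close>

definition coherent_sum :: "nat \<Rightarrow> nat \<Rightarrow> nat \<Rightarrow> real" where
  "coherent_sum n m k = (\<Sum>i<k. (real n + 1) / (real (n + m) + 1) * (real (m choose i) / real (n + m choose i)))"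

text \<open>The diagonal of \<open>clone_gram\<close> for the highest weight state, that is,
  \<open>normal_order_sum\<close> at \<open>a = 0\<close> and \<open>k = l = i\<close>. It shows
  that the induction reproduces its bound without loss.\<close>

lemma coherent_sum_recursion:
  "(\<Sum>q\<le>m. (real n + 1) / (real (n + m) + 1) * gram_weight n m q * ((real m + 1) / (real q + 1))
      * coherent_sum q (m - q) k) = coherent_sum n m k"
proof -
  have i: "(\<Sum>q\<le>m. gram_weight n m q * (real (m - q choose i) / real (m choose i)))
      = real (m choose i) / real (n + m choose i)" for i
  proof (cases "i \<le> m")
    case True
    have F: "(\<Sum>e\<le>m - q. if e \<le> i \<and> e \<le> i \<and> i - e \<le> 0
          then (q choose (i - e)) * (q choose (i - e)) * (m - q choose e) * (n - q choose (0 + e - i))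
          else 0) = (m - q choose i)" for q
    proof -
      have "(\<Sum>e\<le>m - q. if e \<le> i \<and> e \<le> i \<and> i - e \<le> 0
          then (q choose (i - e)) * (q choose (i - e)) * (m - q choose e) * (n - q choose (0 + e - i))
          else 0) = (\<Sum>e\<le>m - q. if e = i then m - q choose i else 0)"
        by (intro sum.cong) auto
      then show ?thesis by auto
    qed
    have "(\<Sum>q\<le>m. (m choose q) * (n choose q) * (m - q choose i))
        = (m choose i) * (n + m - i choose (m - i))"
      using normal_order_sum[of 0 n i m i] True unfolding F by simp
    moreover have "(n + m choose m) * (m choose i) = (n + m choose i) * (n + m - i choose (m - i))"
      using choose_mult[of i m "n + m"] True by simp
    moreover have "n + m choose m = n + m choose n"
      by (metis add.commute binomial_symmetric diff_add_inverse le_add1)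
    ultimately have "(\<Sum>q\<le>m. (m choose q) * (n choose q) * (m - q choose i)) * (n + m choose i)
        = (m choose i) * (m choose i) * (n + m choose n)" by (simp add: ac_simps)
    then have "real (\<Sum>q\<le>m. (m choose q) * (n choose q) * (m - q choose i)) * real (n + m choose i)
        = real (m choose i) * real (m choose i) * real (n + m choose n)"
      by (metis of_nat_mult)
    moreover have "real (m choose i) > 0" "real (n + m choose i) > 0" "real (n + m choose n) > 0"
      using True by auto
    ultimately have "real (\<Sum>q\<le>m. (m choose q) * (n choose q) * (m - q choose i))
        / (real (n + m choose n) * real (m choose i)) = real (m choose i) / real (n + m choose i)"
      by (simp add: field_simps)
    then show ?thesis
      by (simp add: gram_weight_def sum_divide_distrib)
  qed (simp add: binomial_eq_0)
  have "(\<Sum>q\<le>m. (real n + 1) / (real (n + m) + 1) * gram_weight n m q * ((real m + 1) / (real q + 1))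
      * coherent_sum q (m - q) k)
    = (\<Sum>q\<le>m. \<Sum>i<k. (real n + 1) / (real (n + m) + 1) *
        (gram_weight n m q * (real (m - q choose i) / real (m choose i))))"
  proof (intro sum.cong refl)
    fix q assume q: "q \<in> {..m}"
    then have e: "real (q + (m - q)) + 1 = real m + 1" "q + (m - q) = m" by auto
    show "(real n + 1) / (real (n + m) + 1) * gram_weight n m q * ((real m + 1) / (real q + 1))
      * coherent_sum q (m - q) k = (\<Sum>i<k. (real n + 1) / (real (n + m) + 1) *
        (gram_weight n m q * (real (m - q choose i) / real (m choose i))))"
      unfolding coherent_sum_def e sum_distrib_left
    proof (intro sum.cong refl)
      fix i
      note ratio_cancel[of m q]
      moreover have "x * g * u * (w * t) = (u * w) * (x * (g * t))" for x g u w t :: real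
        by (simp only: ac_simps)
      ultimately show "(real n + 1) / (real (n + m) + 1) * gram_weight n m q * ((real m + 1) / (real q + 1))
          * ((real q + 1) / (real m + 1) * (real (m - q choose i) / real (m choose i)))
        = (real n + 1) / (real (n + m) + 1) * (gram_weight n m q * (real (m - q choose i) / real (m choose i)))"
        by simp
    qed
  qed
  also have "\<dots> = (\<Sum>i<k. \<Sum>q\<le>m. (real n + 1) / (real (n + m) + 1) *
        (gram_weight n m q * (real (m - q choose i) / real (m choose i))))"
    by (rule sum.swap)
  also have "\<dots> = coherent_sum n m k"
    unfolding coherent_sum_def sum_distrib_left[symmetric] i ..
  finally show ?thesis .
qed

text \<open>The base of the induction, where passing to the Gram matrix would not lower the
  dimension. The image is a multiple of the identity, so only the size of the frame counts, at most
  \<open>min k (Suc m)\<close>.\<close>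

lemma clone_vacuum_ky_fan:
  "ky_fan_le (Suc m) (clone 0 m (\<lambda>a b. \<psi> a * cnj (\<psi> b))) k (coherent_sum 0 m k * (cmod (\<psi> 0))\<^sup>2)"
  unfolding ky_fan_le_def
proof (intro allI impI)
  fix r v assume r: "r \<le> k" and fr: "frame (Suc m) r v"
  have c: "clone 0 m (\<lambda>a b. \<psi> a * cnj (\<psi> b)) x y
      = (if x = y then complex_of_real ((cmod (\<psi> 0))\<^sup>2 / (real m + 1)) else 0)"
    if "x < Suc m" "y < Suc m" for x y
  proof -
    have "complex_of_real (cg 0 m l x 0 * cg 0 m l y 0) * (\<psi> 0 * cnj (\<psi> 0))
       = (if l = x then if x = y then complex_of_real ((cmod (\<psi> 0))\<^sup>2) else 0 else 0)" if "l \<le> m" for l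
    proof (cases "x = l \<and> y = l")
      case True
      then show ?thesis using cg_sq[of 0 m l l 0] \<open>x < Suc m\<close>
        by (simp add: complex_norm_square del: of_real_mult of_real_power)
    qed (auto simp: cg_def)
    then have "(\<Sum>l\<le>m. complex_of_real (cg 0 m l x 0 * cg 0 m l y 0) * (\<psi> 0 * cnj (\<psi> 0)))
       = (\<Sum>l\<le>m. if l = x then if x = y then complex_of_real ((cmod (\<psi> 0))\<^sup>2) else 0 else 0)"
      by (intro sum.cong) auto
    also have "\<dots> = (if x = y then complex_of_real ((cmod (\<psi> 0))\<^sup>2) else 0)"
      using that by simp
    finally show ?thesis by (simp add: clone_def)
  qed
  have inner: "(\<Sum>x<Suc m. \<Sum>y<Suc m. clone 0 m (\<lambda>a b. \<psi> a * cnj (\<psi> b)) x y * v i y * cnj (v i x))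
      = complex_of_real ((cmod (\<psi> 0))\<^sup>2 / (real m + 1))" if "i < r" for i
  proof -
    have "(\<Sum>x<Suc m. \<Sum>y<Suc m. clone 0 m (\<lambda>a b. \<psi> a * cnj (\<psi> b)) x y * v i y * cnj (v i x))
        = (\<Sum>x<Suc m. \<Sum>y<Suc m. if x = y then complex_of_real ((cmod (\<psi> 0))\<^sup>2 / (real m + 1)) * v i y * cnj (v i x) else 0)"
      by (intro sum.cong refl) (auto simp: c)
    also have "\<dots> = (\<Sum>x<Suc m. complex_of_real ((cmod (\<psi> 0))\<^sup>2 / (real m + 1)) * (v i x * cnj (v i x)))"
      by (intro sum.cong refl) (simp del: sum.lessThan_Suc)
    also have "\<dots> = complex_of_real ((cmod (\<psi> 0))\<^sup>2 / (real m + 1)) * (\<Sum>x<Suc m. v i x * cnj (v i x))"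
      by (rule sum_distrib_left[symmetric])
    also have "(\<Sum>x<Suc m. v i x * cnj (v i x)) = 1"
      using fr that by (simp add: frame_def)
    finally show ?thesis by simp
  qed
  have "coherent_sum 0 m k = (\<Sum>i<k. if i < Suc m then 1 / (real m + 1) else 0)"
    unfolding coherent_sum_def by (intro sum.cong) (auto simp: binomial_eq_0)
  also have "\<dots> = (\<Sum>i\<in>{..<k} \<inter> {..<Suc m}. 1 / (real m + 1))"
    by (simp add: sum.inter_restrict del: sum_constant)
  also have "{..<k} \<inter> {..<Suc m} = {..<min k (Suc m)}" by auto
  finally have cs: "coherent_sum 0 m k = real (min k (Suc m)) / (real m + 1)" by simp
  have "Re (\<Sum>i<r. \<Sum>x<Suc m. \<Sum>y<Suc m. clone 0 m (\<lambda>a b. \<psi> a * cnj (\<psi> b)) x y * v i y * cnj (v i x))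
      = real r / (real m + 1) * (cmod (\<psi> 0))\<^sup>2"
    using inner by simp
  also have "\<dots> \<le> coherent_sum 0 m k * (cmod (\<psi> 0))\<^sup>2"
    unfolding cs using r frame_le_dim[OF fr]
    by (intro mult_right_mono divide_right_mono) auto
  finally show "Re (\<Sum>i<r. \<Sum>x<Suc m. \<Sum>y<Suc m. clone 0 m (\<lambda>a b. \<psi> a * cnj (\<psi> b)) x y * v i y * cnj (v i x))
      \<le> coherent_sum 0 m k * (cmod (\<psi> 0))\<^sup>2" .
qed

text \<open>
  The Gram matrix of the vectors making up the image of a pure state is a mixture of images, under
  maps of the same family but with the smaller target dimension \<open>m + 1\<close>, of reduced states.
\<close>

lemma clone_gram:
  fixes \<psi> :: "nat \<Rightarrow> complex" and n m :: nat
  defines "\<phi> q d x \<equiv> \<Sum>a\<le>n. complex_of_real (cg q (n - q) d a x) * \<psi> a"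
  assumes kl: "k \<le> m" "l \<le> m"
  shows "(\<Sum>j\<le>n + m. cnj (\<Sum>b\<le>n. complex_of_real (cg n m k j b) * \<psi> b) * (\<Sum>a\<le>n. complex_of_real (cg n m l j a) * \<psi> a))
    = (\<Sum>q\<le>m. complex_of_real (gram_weight n m q * ((real m + 1) / (real q + 1))) *
        (\<Sum>d\<le>n - q. clone q (m - q) (\<lambda>x y. \<phi> q d x * cnj (\<phi> q d y)) k l))"
proof -
  let ?P = "\<lambda>a b. \<psi> a * cnj (\<psi> b)"
  \<comment> \<open>The factor \<open>(m + 1) / (q + 1)\<close> undoes the normalisation in
    \<open>clone q (m - q)\<close>.\<close>
  have cl: "complex_of_real ((real m + 1) / (real q + 1)) *
        (\<Sum>d\<le>n - q. clone q (m - q) (\<lambda>x y. \<phi> q d x * cnj (\<phi> q d y)) k l)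
      = (\<Sum>a\<le>n. \<Sum>b\<le>n. complex_of_real (\<Sum>e\<le>m - q. \<Sum>d\<le>n - q. \<Sum>x\<le>q. \<Sum>y\<le>q.
         cg q (m - q) e k x * cg q (m - q) e l y * (cg q (n - q) d a x * cg q (n - q) d b y)) * ?P a b)"
    if "q \<le> m" for q
  proof -
    have \<phi>\<phi>: "\<phi> q d x * cnj (\<phi> q d y)
      = (\<Sum>a\<le>n. \<Sum>b\<le>n. complex_of_real (cg q (n - q) d a x * cg q (n - q) d b y) * ?P a b)" for d x y
      unfolding \<phi>_def cnj_sum sum_product by (simp add: ac_simps)
    have "complex_of_real ((real m + 1) / (real q + 1)) * complex_of_real ((real q + 1) / (real (q + (m - q)) + 1)) = 1"
      unfolding of_real_mult[symmetric] using that ratio_cancel[of m q] by simp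
    then have "complex_of_real ((real m + 1) / (real q + 1)) *
        (\<Sum>d\<le>n - q. clone q (m - q) (\<lambda>x y. \<phi> q d x * cnj (\<phi> q d y)) k l)
      = (\<Sum>d\<le>n - q. \<Sum>e\<le>m - q. \<Sum>x\<le>q. \<Sum>y\<le>q.
          complex_of_real (cg q (m - q) e k x * cg q (m - q) e l y) * (\<phi> q d x * cnj (\<phi> q d y)))"
      unfolding clone_def sum_distrib_left[symmetric] mult.assoc[symmetric] by simp
    also have "\<dots> = (\<Sum>d\<le>n - q. \<Sum>e\<le>m - q. \<Sum>x\<le>q. \<Sum>y\<le>q. \<Sum>a\<le>n. \<Sum>b\<le>n.
          complex_of_real (cg q (m - q) e k x * cg q (m - q) e l y * (cg q (n - q) d a x * cg q (n - q) d b y)) * ?P a b)"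
      unfolding \<phi>\<phi> sum_distrib_left of_real_mult by (simp only: mult.assoc)
    also have "\<dots> = (\<Sum>a\<le>n. \<Sum>b\<le>n. \<Sum>e\<le>m - q. \<Sum>d\<le>n - q. \<Sum>x\<le>q. \<Sum>y\<le>q.
          complex_of_real (cg q (m - q) e k x * cg q (m - q) e l y * (cg q (n - q) d a x * cg q (n - q) d b y)) * ?P a b)"
      by (simp only: sum.swap[where A = "{..q}" and B = "{..n}"] sum.swap[where A = "{..m - q}" and B = "{..n}"]
          sum.swap[where A = "{..n - q}" and B = "{..n}"] sum.swap[where A = "{..n - q}" and B = "{..m - q}"])
    finally show ?thesis by (simp only: of_real_sum sum_distrib_right)
  qed
  have "(\<Sum>j\<le>n + m. cnj (\<Sum>b\<le>n. complex_of_real (cg n m k j b) * \<psi> b) * (\<Sum>a\<le>n. complex_of_real (cg n m l j a) * \<psi> a))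
      = (\<Sum>j\<le>n + m. \<Sum>a\<le>n. \<Sum>b\<le>n. complex_of_real (cg n m k j b * cg n m l j a) * ?P a b)"
    by (intro sum.cong refl) (simp add: sum_product, subst sum.swap, simp add: ac_simps)
  also have "\<dots> = (\<Sum>a\<le>n. \<Sum>b\<le>n. \<Sum>j\<le>n + m. complex_of_real (cg n m k j b * cg n m l j a) * ?P a b)"
    by (subst sum.swap) (simp only: sum.swap[where A = "{..n + m}"])
  also have "\<dots> = (\<Sum>a\<le>n. \<Sum>b\<le>n. complex_of_real (\<Sum>j\<le>n + m. cg n m k j b * cg n m l j a) * ?P a b)"
    by (simp only: of_real_sum sum_distrib_right)
  also have "\<dots> = (\<Sum>a\<le>n. \<Sum>b\<le>n. \<Sum>q\<le>m. complex_of_real (gram_weight n m q) *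
      (complex_of_real (\<Sum>e\<le>m - q. \<Sum>d\<le>n - q. \<Sum>x\<le>q. \<Sum>y\<le>q.
         cg q (m - q) e k x * cg q (m - q) e l y * (cg q (n - q) d a x * cg q (n - q) d b y)) * ?P a b))"
  proof (intro sum.cong refl)
    fix a b assume ab: "a \<in> {..n}" "b \<in> {..n}"
    have pull: "complex_of_real (\<Sum>q\<le>m. g q * Q q) * p
        = (\<Sum>q\<le>m. complex_of_real (g q) * (complex_of_real (Q q) * p))" for g Q p
      by (simp add: sum_distrib_right mult.assoc)
    show "complex_of_real (\<Sum>j\<le>n + m. cg n m k j b * cg n m l j a) * ?P a b
      = (\<Sum>q\<le>m. complex_of_real (gram_weight n m q) *
      (complex_of_real (\<Sum>e\<le>m - q. \<Sum>d\<le>n - q. \<Sum>x\<le>q. \<Sum>y\<le>q.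
         cg q (m - q) e k x * cg q (m - q) e l y * (cg q (n - q) d a x * cg q (n - q) d b y)) * ?P a b))"
      unfolding cg_gram[OF ab[unfolded atMost_iff] kl] by (rule pull)
  qed
  also have "\<dots> = (\<Sum>q\<le>m. \<Sum>a\<le>n. \<Sum>b\<le>n. complex_of_real (gram_weight n m q) *
      (complex_of_real (\<Sum>e\<le>m - q. \<Sum>d\<le>n - q. \<Sum>x\<le>q. \<Sum>y\<le>q.
         cg q (m - q) e k x * cg q (m - q) e l y * (cg q (n - q) d a x * cg q (n - q) d b y)) * ?P a b))"
    by (simp only: sum.swap[where B = "{..m}"])
  also have "\<dots> = (\<Sum>q\<le>m. complex_of_real (gram_weight n m q * ((real m + 1) / (real q + 1))) *
        (\<Sum>d\<le>n - q. clone q (m - q) (\<lambda>x y. \<phi> q d x * cnj (\<phi> q d y)) k l))"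
  proof (intro sum.cong refl)
    fix q assume "q \<in> {..m}"
    then have q: "q \<le> m" by simp
    show "(\<Sum>a\<le>n. \<Sum>b\<le>n. complex_of_real (gram_weight n m q) *
      (complex_of_real (\<Sum>e\<le>m - q. \<Sum>d\<le>n - q. \<Sum>x\<le>q. \<Sum>y\<le>q.
         cg q (m - q) e k x * cg q (m - q) e l y * (cg q (n - q) d a x * cg q (n - q) d b y)) * ?P a b))
      = complex_of_real (gram_weight n m q * ((real m + 1) / (real q + 1))) *
        (\<Sum>d\<le>n - q. clone q (m - q) (\<lambda>x y. \<phi> q d x * cnj (\<phi> q d y)) k l)"
      unfolding of_real_mult mult.assoc[of "complex_of_real (gram_weight n m q)"] cl[OF q]
      unfolding sum_distrib_left ..
  qed
  finally show ?thesis .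
qed

text \<open>The sums over \<open>a\<close> are the components of what remains of
  \<open>\<psi>\<close> when \<open>n - q\<close> particles are found in state \<open>d\<close>.
  Over all \<open>d\<close> these vectors make up the reduced state, and a partial trace preserves
  the trace. For given \<open>d\<close> and \<open>x\<close> only \<open>a = x + d\<close>
  contributes, so no cross terms arise.\<close>

lemma reduced_state_norm:
  fixes \<psi> :: "nat \<Rightarrow> complex"
  assumes "q \<le> n"
  shows "(\<Sum>d\<le>n - q. \<Sum>x\<le>q. (cmod (\<Sum>a\<le>n. complex_of_real (cg q (n - q) d a x) * \<psi> a))\<^sup>2)
    = (\<Sum>a\<le>n. (cmod (\<psi> a))\<^sup>2)"
proof -
  have single: "(cmod (\<Sum>a\<le>n. complex_of_real (cg q (n - q) d a x) * \<psi> a))\<^sup>2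
      = (\<Sum>a\<le>n. cg q (n - q) d a x * cg q (n - q) d a x * (cmod (\<psi> a))\<^sup>2)"
    if "d \<le> n - q" "x \<le> q" for d x
  proof -
    have "(\<Sum>a\<le>n. complex_of_real (cg q (n - q) d a x) * \<psi> a)
        = (\<Sum>a\<le>n. if a = x + d then complex_of_real (cg q (n - q) d (x + d) x) * \<psi> (x + d) else 0)"
      by (intro sum.cong) (auto simp: cg_def)
    also have "\<dots> = complex_of_real (cg q (n - q) d (x + d) x) * \<psi> (x + d)"
      using that assms by auto
    finally have 1: "(cmod (\<Sum>a\<le>n. complex_of_real (cg q (n - q) d a x) * \<psi> a))\<^sup>2
        = cg q (n - q) d (x + d) x * cg q (n - q) d (x + d) x * (cmod (\<psi> (x + d)))\<^sup>2"
      by (simp add: norm_mult power_mult_distrib) (simp add: power2_eq_square)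
    have "(\<Sum>a\<le>n. cg q (n - q) d a x * cg q (n - q) d a x * (cmod (\<psi> a))\<^sup>2)
        = (\<Sum>a\<le>n. if a = x + d then cg q (n - q) d (x + d) x * cg q (n - q) d (x + d) x * (cmod (\<psi> (x + d)))\<^sup>2 else 0)"
      by (intro sum.cong) (auto simp: cg_def)
    also have "\<dots> = cg q (n - q) d (x + d) x * cg q (n - q) d (x + d) x * (cmod (\<psi> (x + d)))\<^sup>2"
      using that assms by auto
    finally show ?thesis using 1 by simp
  qed
  have "(\<Sum>d\<le>n - q. \<Sum>x\<le>q. (cmod (\<Sum>a\<le>n. complex_of_real (cg q (n - q) d a x) * \<psi> a))\<^sup>2)
      = (\<Sum>d\<le>n - q. \<Sum>x\<le>q. \<Sum>a\<le>n. cg q (n - q) d a x * cg q (n - q) d a x * (cmod (\<psi> a))\<^sup>2)"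
    by (intro sum.cong refl single) auto
  also have "\<dots> = (\<Sum>a\<le>n. \<Sum>d\<le>n - q. \<Sum>x\<le>q. cg q (n - q) d a x * cg q (n - q) d a x * (cmod (\<psi> a))\<^sup>2)"
    by (simp only: sum.swap[where B = "{..n}"])
  also have "\<dots> = (\<Sum>a\<le>n. (\<Sum>d\<le>n - q. \<Sum>x\<le>q. cg q (n - q) d a x * cg q (n - q) d a x) * (cmod (\<psi> a))\<^sup>2)"
    by (simp only: sum_distrib_right)
  also have "\<dots> = (\<Sum>a\<le>n. (cmod (\<psi> a))\<^sup>2)"
    using assms by (intro sum.cong refl) (subst cg_partial_trace, auto)
  finally show ?thesis .
qed

text \<open>Stated for unnormalised \<open>\<psi>\<close>, since the reduction of a pure state is a
  sum of pure states of various norms. The bound is linear in the squared norm and hence adds up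
  over them by \<open>reduced_state_norm\<close>.\<close>

theorem clone_pure_ky_fan:
  "ky_fan_le (Suc (n + m)) (clone n m (\<lambda>a b. \<psi> a * cnj (\<psi> b))) k
     (coherent_sum n m k * (\<Sum>a\<le>n. (cmod (\<psi> a))\<^sup>2))"
proof (induction "n + m" arbitrary: n m \<psi> rule: less_induct)
  case less
  show ?case
  proof (cases "n = 0")
    case True
    with clone_vacuum_ky_fan show ?thesis by simp
  next
    case False
    define s where "s = (\<Sum>a\<le>n. (cmod (\<psi> a))\<^sup>2)"
    define \<kappa> where "\<kappa> = (real n + 1) / (real (n + m) + 1)"
    define M where "M j l = (\<Sum>a\<le>n. complex_of_real (cg n m l j a) * \<psi> a)" for j l
    define \<phi> where "\<phi> q d x = (\<Sum>a\<le>n. complex_of_real (cg q (n - q) d a x) * \<psi> a)" for q d x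
    define c where "c q = gram_weight n m q * ((real m + 1) / (real q + 1))" for q
    have c: "c q \<ge> 0" for q unfolding c_def gram_weight_def by auto
    have "ky_fan_le (Suc m) (\<lambda>x y. complex_of_real (c q) *
        (\<Sum>d\<le>n - q. clone q (m - q) (\<lambda>x y. \<phi> q d x * cnj (\<phi> q d y)) x y)) k
        (c q * (coherent_sum q (m - q) k * s))" if "q \<le> m" for q
    proof (cases "q \<le> n")
      case True
      have eq: "q + (m - q) = m" using that by simp
      \<comment> \<open>The induction hypothesis applies because
        \<open>q + (m - q) = m < n + m\<close> for \<open>n \<noteq> 0\<close>.\<close>
      have "ky_fan_le (Suc (q + (m - q))) (clone q (m - q) (\<lambda>x y. \<phi> q d x * cnj (\<phi> q d y))) k
        (coherent_sum q (m - q) k * (\<Sum>x\<le>q. (cmod (\<phi> q d x))\<^sup>2))" for d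
        by (rule less) (use False that in auto)
      then have "ky_fan_le (Suc m) (\<lambda>x y. \<Sum>d\<le>n - q. clone q (m - q) (\<lambda>x y. \<phi> q d x * cnj (\<phi> q d y)) x y) k
        (\<Sum>d\<le>n - q. coherent_sum q (m - q) k * (\<Sum>x\<le>q. (cmod (\<phi> q d x))\<^sup>2))"
        unfolding eq by (intro ky_fan_le_sum)
      also have "(\<Sum>d\<le>n - q. coherent_sum q (m - q) k * (\<Sum>x\<le>q. (cmod (\<phi> q d x))\<^sup>2))
          = coherent_sum q (m - q) k * s"
        unfolding sum_distrib_left[symmetric] \<phi>_def reduced_state_norm[OF True] s_def ..
      finally show ?thesis by (intro ky_fan_le_scale c)
    next
      case False
      then have "c q = 0" by (simp add: c_def gram_weight_def binomial_eq_0)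
      then show ?thesis by (simp add: ky_fan_le_def)
    qed
    then have "ky_fan_le (Suc m) (\<lambda>x y. \<Sum>q\<le>m. complex_of_real (c q) *
        (\<Sum>d\<le>n - q. clone q (m - q) (\<lambda>x y. \<phi> q d x * cnj (\<phi> q d y)) x y)) k
        (\<Sum>q\<le>m. c q * (coherent_sum q (m - q) k * s))"
      by (intro ky_fan_le_sum) auto
    then have "ky_fan_le (Suc m) (\<lambda>x y. \<Sum>j<Suc (n + m). cnj (M j x) * M j y) k
        (\<Sum>q\<le>m. c q * (coherent_sum q (m - q) k * s))"
      by (rule ky_fan_le_cong)
        (simp_all only: lessThan_Suc_atMost M_def c_def \<phi>_def clone_gram less_Suc_eq_le)
    then have "ky_fan_le (Suc (n + m)) (\<lambda>x y. \<Sum>l<Suc m. M x l * cnj (M y l)) k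
        (\<Sum>q\<le>m. c q * (coherent_sum q (m - q) k * s))"
      by (rule ky_fan_le_gram)
    then have "ky_fan_le (Suc (n + m)) (\<lambda>x y. complex_of_real \<kappa> * (\<Sum>l<Suc m. M x l * cnj (M y l))) k
        (\<kappa> * (\<Sum>q\<le>m. c q * (coherent_sum q (m - q) k * s)))"
      by (rule ky_fan_le_scale) (simp add: \<kappa>_def)
    then have "ky_fan_le (Suc (n + m)) (clone n m (\<lambda>a b. \<psi> a * cnj (\<psi> b))) k
       (\<kappa> * (\<Sum>q\<le>m. c q * (coherent_sum q (m - q) k * s)))"
      by (rule ky_fan_le_cong)
        (simp_all add: clone_def \<kappa>_def M_def lessThan_Suc_atMost sum_product ac_simps del: sum.lessThan_Suc)
    moreover have "\<kappa> * (\<Sum>q\<le>m. c q * (coherent_sum q (m - q) k * s)) = coherent_sum n m k * s"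
      unfolding coherent_sum_recursion[of n m k, symmetric] \<kappa>_def c_def
      by (simp add: sum_distrib_left sum_distrib_right ac_simps)
    ultimately show ?thesis by (simp add: s_def)
  qed
qed

section \<open>Unitary triangularisation and eigenvalue sequences\<close>

lemma mult_mat_assoc_dim:
  fixes A :: "'a :: semiring_0 mat"
  shows "dim_col A = dim_row B \<Longrightarrow> dim_col B = dim_row C \<Longrightarrow> A * B * C = A * (B * C)"
  by (rule assoc_mult_mat[of _ "dim_row A" "dim_row B" _ "dim_row C" _ "dim_col C"]) auto

lemma mult_mat_entry:
  "i < dim_row A \<Longrightarrow> j < dim_col B \<Longrightarrow> dim_col A = dim_row B \<Longrightarrow>
    (A * B) $$ (i, j) = (\<Sum>k<dim_row B. A $$ (i, k) * B $$ (k, j))"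
  by (simp add: scalar_prod_def lessThan_atLeast0)

lemma mult_mat_vec_entry:
  "i < dim_row A \<Longrightarrow> dim_col A = dim_vec v \<Longrightarrow> (A *\<^sub>v v) $ i = (\<Sum>k<dim_vec v. A $$ (i, k) * v $ k)"
  by (simp add: scalar_prod_def lessThan_atLeast0)

lemma mat_adjoint_mult:
  fixes A B :: "complex mat"
  assumes "dim_col A = dim_row B"
  shows "mat_adjoint (A * B) = mat_adjoint B * mat_adjoint A"
  using assms
  by (intro eq_matI) (auto simp: mult_mat_entry mult.commute simp del: index_mult_mat(1))

lemma mat_adjoint_adjoint [simp]: "mat_adjoint (mat_adjoint A) = (A :: complex mat)"
  by (rule eq_matI) auto

lemma mat_adjoint_one [simp]: "mat_adjoint (1\<^sub>m n) = (1\<^sub>m n :: complex mat)"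
  by (rule eq_matI) auto

lemma mat_adjoint_carrier [simp]: "A \<in> carrier_mat n m \<Longrightarrow> mat_adjoint A \<in> carrier_mat m n"
  by (intro carrier_matI) auto

definition unitary :: "nat \<Rightarrow> complex mat \<Rightarrow> bool" where
  "unitary n U \<longleftrightarrow> U \<in> carrier_mat n n \<and> mat_adjoint U * U = 1\<^sub>m n \<and> U * mat_adjoint U = 1\<^sub>m n"

lemma unitary_dims: "unitary n U \<Longrightarrow> dim_row U = n" "unitary n U \<Longrightarrow> dim_col U = n"
  by (auto simp: unitary_def)

lemma unitary_mult:
  assumes "unitary n U" "unitary n V"
  shows "unitary n (U * V)"
proof -
  note d = unitary_dims[OF assms(1)] unitary_dims[OF assms(2)]
  have "mat_adjoint (U * V) * (U * V) = mat_adjoint V * ((mat_adjoint U * U) * V)"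
    by (simp add: mat_adjoint_mult mult_mat_assoc_dim d)
  moreover have "U * V * mat_adjoint (U * V) = U * ((V * mat_adjoint V) * mat_adjoint U)"
    by (simp add: mat_adjoint_mult mult_mat_assoc_dim d)
  ultimately show ?thesis using assms by (auto simp: unitary_def)
qed

lemma unitary_similar:
  assumes "unitary n U" "A \<in> carrier_mat n n"
  shows "similar_mat (mat_adjoint U * A * U) A"
proof -
  have "similar_mat_wit (mat_adjoint U * A * U) A (mat_adjoint U) U"
    using assms by (intro similar_mat_witI[of _ _ n]) (auto simp: unitary_def)
  then show ?thesis by (auto simp: similar_mat_def)
qed

lemma cscalar_prod_eq_inner_sum:
  "u \<in> carrier_vec n \<Longrightarrow> v \<in> carrier_vec n \<Longrightarrow> u \<bullet>c v = inner_sum n (\<lambda>i. u $ i) (\<lambda>i. v $ i)"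
  by (auto simp: scalar_prod_def inner_sum_def lessThan_atLeast0 intro!: sum.cong)

section \<open>Unitary Schur form with a prescribed diagonal\<close>

lemma unitary_completion:
  assumes v: "v \<in> carrier_vec n" "v \<bullet>c v = (1 :: complex)"
  obtains W where "unitary n W" "col W 0 = v" "n > 0"
proof -
  define y :: "nat \<Rightarrow> nat \<Rightarrow> complex" where "y i x = (if x = i then 1 else 0)" for i x
  have "frame n 1 (\<lambda>_ x. v $ x)"
    using v by (simp add: frame_inner_sum cscalar_prod_eq_inner_sum[OF v(1) v(1)])
  from gram_schmidt_extension[OF this, of n y] obtain t w
    where t: "1 \<le> t" and fr: "frame n t w" and w0: "\<forall>i<1. w i = (\<lambda>x. v $ x)"
    and y: "\<And>i x. i < n \<Longrightarrow> x < n \<Longrightarrow> y i x = (\<Sum>j<t. inner_sum n (y i) (w j) * w j x)"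
    by blast
  have ip: "inner_sum n (y i) (w j) = cnj (w j i)" if "i < n" for i j
  proof -
    have "inner_sum n (y i) (w j) = (\<Sum>x<n. if x = i then cnj (w j i) else 0)"
      unfolding inner_sum_def y_def by (intro sum.cong) auto
    with that show ?thesis by simp
  qed
  have y: "y i x = (\<Sum>j<t. cnj (w j i) * w j x)" if "i < n" "x < n" for i x
    using y[OF that] by (simp add: ip[OF that(1)])
  \<comment> \<open>Both sides of the completeness relation are traced: the identity gives
    \<open>n\<close>, the \<open>t\<close> unit vectors give \<open>t\<close>.\<close>
  have "of_nat n = (\<Sum>i<n. y i i)" by (simp add: y_def)
  also have "\<dots> = (\<Sum>i<n. \<Sum>j<t. cnj (w j i) * w j i)" by (simp add: y)
  also have "\<dots> = (\<Sum>j<t. \<Sum>i<n. w j i * cnj (w j i))" by (subst sum.swap) (simp add: mult.commute)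
  also have "\<dots> = of_nat t" using fr by (simp add: frame_def)
  finally have tn: "t = n" by (simp only: of_nat_eq_iff)
  define W where "W = mat n n (\<lambda>(x, j). w j x)"
  have "mat_adjoint W * W = 1\<^sub>m n"
    using fr unfolding W_def tn frame_def
    by (intro eq_matI) (auto simp: mult_mat_entry mult.commute simp del: index_mult_mat(1))
  moreover have "W * mat_adjoint W = 1\<^sub>m n"
  proof (intro eq_matI)
    fix x i assume "x < dim_row (1\<^sub>m n :: complex mat)" "i < dim_col (1\<^sub>m n :: complex mat)"
    then have "x < n" "i < n" by auto
    then have "(W * mat_adjoint W) $$ (x, i) = (\<Sum>j<t. cnj (w j i) * w j x)"
      unfolding W_def tn by (simp add: mult_mat_entry mult.commute del: index_mult_mat(1))
    also have "\<dots> = y i x" using \<open>x < n\<close> \<open>i < n\<close> y by simp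
    finally show "(W * mat_adjoint W) $$ (x, i) = 1\<^sub>m n $$ (x, i)"
      using \<open>x < n\<close> \<open>i < n\<close> by (auto simp: y_def)
  qed (auto simp: W_def)
  ultimately have "unitary n W" by (simp add: unitary_def W_def)
  moreover have "n > 0" using t tn by simp
  moreover have "col W 0 = v" using w0 v \<open>n > 0\<close> by (intro eq_vecI) (auto simp: W_def)
  ultimately show ?thesis using that by blast
qed

lemma unit_eigenvector:
  fixes A :: "complex mat"
  assumes "A \<in> carrier_mat n n" "eigenvalue A e"
  obtains v where "v \<in> carrier_vec n" "v \<bullet>c v = 1" "A *\<^sub>v v = e \<cdot>\<^sub>v v"
proof -
  from assms obtain u where u: "u \<in> carrier_vec n" "u \<noteq> 0\<^sub>v n" "A *\<^sub>v u = e \<cdot>\<^sub>v u"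
    by (auto simp: eigenvalue_def eigenvector_def)
  define N where "N = (\<Sum>x<n. (cmod (u $ x))\<^sup>2)"
  have "N > 0"
  proof -
    obtain i where "i < n" "u $ i \<noteq> 0" using u by (metis carrier_vecD eq_vecI index_zero_vec)
    then show ?thesis unfolding N_def by (intro sum_pos2[of _ i]) auto
  qed
  define v where "v = complex_of_real (1 / sqrt N) \<cdot>\<^sub>v u"
  have v: "v \<in> carrier_vec n" using u by (simp add: v_def)
  have "inner_sum n (\<lambda>i. v $ i) (\<lambda>i. v $ i)
      = inner_sum n (\<lambda>i. complex_of_real (1 / sqrt N) * u $ i) (\<lambda>i. complex_of_real (1 / sqrt N) * u $ i)"
    using u by (intro inner_sum_cong) (auto simp: v_def)
  also have "\<dots> = complex_of_real (1 / sqrt N * (1 / sqrt N) * N)"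
    unfolding inner_sum_scale_left inner_sum_scale_right inner_sum_self N_def[symmetric]
      of_real_mult complex_cnj_complex_of_real by (simp only: ac_simps)
  also have "1 / sqrt N * (1 / sqrt N) * N = 1" using \<open>N > 0\<close> by (simp add: field_simps)
  finally have "v \<bullet>c v = 1" by (simp add: cscalar_prod_eq_inner_sum[OF v v])
  moreover have "A *\<^sub>v v = e \<cdot>\<^sub>v v"
    using u assms by (simp add: v_def mult_mat_vec smult_smult_assoc mult.commute)
  ultimately show ?thesis using v that by blast
qed

lemma unitary_block:
  assumes U: "unitary n U"
  shows "unitary (Suc n) (four_block_mat (1\<^sub>m 1) (0\<^sub>m 1 n) (0\<^sub>m n 1) U)"
    and "mat_adjoint (four_block_mat (1\<^sub>m 1) (0\<^sub>m 1 n) (0\<^sub>m n 1) U)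
      = four_block_mat (1\<^sub>m 1) (0\<^sub>m 1 n) (0\<^sub>m n 1) (mat_adjoint U)"
proof -
  have Uc: "U \<in> carrier_mat n n" using U by (simp add: unitary_def)
  then have Ua: "mat_adjoint U \<in> carrier_mat n n" by simp
  show adj: "mat_adjoint (four_block_mat (1\<^sub>m 1) (0\<^sub>m 1 n) (0\<^sub>m n 1) U)
      = four_block_mat (1\<^sub>m 1) (0\<^sub>m 1 n) (0\<^sub>m n 1) (mat_adjoint U)"
    using Uc by (intro eq_matI) auto
  have "four_block_mat (1\<^sub>m 1) (0\<^sub>m 1 n) (0\<^sub>m n 1) (1\<^sub>m n) = (1\<^sub>m (Suc n) :: complex mat)"
    using four_block_one_mat[of 1 n] by simp
  then show "unitary (Suc n) (four_block_mat (1\<^sub>m 1) (0\<^sub>m 1 n) (0\<^sub>m n 1) U)"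
    unfolding unitary_def adj using U Uc Ua
    by (auto simp: unitary_def mult_four_block_mat[of _ 1 1 _ n _ n _ _ 1 _ n])
qed

text \<open>Deflation: a unit eigenvector of the first root becomes the first column of a unitary,
  and the remaining block carries the remaining linear factors. Fixing the order of the roots in
  advance fixes the order on the diagonal.\<close>

theorem unitary_schur:
  fixes A :: "complex mat"
  assumes "A \<in> carrier_mat n n" "char_poly A = (\<Prod>e\<leftarrow>es. [:- e, 1:])"
  shows "\<exists>U. unitary n U \<and> upper_triangular (mat_adjoint U * A * U)
    \<and> diag_mat (mat_adjoint U * A * U) = es"
  using assms
proof (induction es arbitrary: n A)
  case Nil
  then have "n = 0" using degree_monic_char_poly[of A n] by simp
  with Nil show ?case
    by (intro exI[of _ "1\<^sub>m 0"]) (auto simp: unitary_def diag_mat_def upper_triangular_def)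
next
  case (Cons e es)
  note A = Cons.prems(1)
  have "eigenvalue A e" unfolding eigenvalue_root_char_poly[OF A] Cons.prems(2) by simp
  from unit_eigenvector[OF A this] obtain v
    where v: "v \<in> carrier_vec n" "v \<bullet>c v = 1" "A *\<^sub>v v = e \<cdot>\<^sub>v v" .
  from unitary_completion[OF v(1,2)] obtain W where W: "unitary n W" "col W 0 = v" and "n > 0" .
  then obtain k where n: "n = Suc k" by (cases n) auto
  have Wc: "W \<in> carrier_mat n n" using W by (simp add: unitary_def)
  define A' where "A' = mat_adjoint W * A * W"
  have A': "A' \<in> carrier_mat n n" using Wc A by (auto simp: A'_def)
  have "col A' 0 = col (mat_adjoint W * (A * W)) 0"
    unfolding A'_def using Wc A by (simp add: mult_mat_assoc_dim)
  also have "\<dots> = mat_adjoint W *\<^sub>v col (A * W) 0"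
    by (rule col_mult2[of _ n n _ n]) (use Wc A \<open>n > 0\<close> in auto)
  also have "col (A * W) 0 = A *\<^sub>v col W 0"
    by (rule col_mult2[of _ n n _ n]) (use Wc A \<open>n > 0\<close> in auto)
  also have "mat_adjoint W *\<^sub>v (A *\<^sub>v col W 0) = e \<cdot>\<^sub>v (mat_adjoint W *\<^sub>v col W 0)"
    using Wc v W by (simp add: mult_mat_vec[of _ n n])
  also have "mat_adjoint W *\<^sub>v col W 0 = col (1\<^sub>m n) 0"
    using W Wc \<open>n > 0\<close> col_mult2[of "mat_adjoint W" n n W n 0] by (simp add: unitary_def)
  finally have col0: "col A' 0 = e \<cdot>\<^sub>v col (1\<^sub>m n) 0" .
  have A'0: "A' $$ (i, 0) = (if i = 0 then e else 0)" if "i < n" for i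
    using arg_cong[OF col0, of "\<lambda>v. v $ i"] that A' by auto
  define A2 where "A2 = mat 1 k (\<lambda>(i, j). A' $$ (0, Suc j))"
  define A3 where "A3 = mat k k (\<lambda>(i, j). A' $$ (Suc i, Suc j))"
  have A2: "A2 \<in> carrier_mat 1 k" and A3: "A3 \<in> carrier_mat k k" by (auto simp: A2_def A3_def)
  let ?A1 = "mat 1 1 (\<lambda>_. e)"
  have block: "A' = four_block_mat ?A1 A2 (0\<^sub>m k 1) A3"
    using A' by (intro eq_matI) (auto simp: n A2_def A3_def A'0)
  have "[:- e, 1:] * char_poly A3 = char_poly A'"
    unfolding block char_poly_four_block_zeros_col[OF mat_carrier A2 A3]
    by (simp add: char_poly_defs det_def sign_def)
  also have "\<dots> = char_poly A"
    unfolding A'_def by (rule char_poly_similar) (rule unitary_similar[OF W(1) A])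
  also have "\<dots> = [:- e, 1:] * (\<Prod>e\<leftarrow>es. [:- e, 1:])" using Cons.prems by simp
  finally have "char_poly A3 = (\<Prod>e\<leftarrow>es. [:- e, 1:])"
    by (metis mult_cancel_left pCons_eq_0_iff zero_neq_one)
  from Cons.IH[OF A3 this] obtain U where U: "unitary k U"
    and B: "upper_triangular (mat_adjoint U * A3 * U)" "diag_mat (mat_adjoint U * A3 * U) = es" by blast
  have Uc: "U \<in> carrier_mat k k" using U by (simp add: unitary_def)
  define V where "V = four_block_mat (1\<^sub>m 1) (0\<^sub>m 1 k) (0\<^sub>m k 1) U"
  have V: "unitary n V" "mat_adjoint V = four_block_mat (1\<^sub>m 1) (0\<^sub>m 1 k) (0\<^sub>m k 1) (mat_adjoint U)"
    using unitary_block[OF U] by (simp_all add: V_def n)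
  note d = unitary_dims[OF W(1)] unitary_dims[OF V(1)]
  have "mat_adjoint (W * V) * A * (W * V) = mat_adjoint V * A' * V"
    unfolding A'_def using A d by (simp add: mat_adjoint_mult mult_mat_assoc_dim)
  also have "mat_adjoint V * A' = four_block_mat ?A1 A2 (0\<^sub>m k 1) (mat_adjoint U * A3)"
    unfolding V block using Uc A2 A3
    by (subst mult_four_block_mat[of _ 1 1 _ k _ k _ _ 1 _ k]) (auto intro!: cong_four_block_mat)
  also have "\<dots> * V = four_block_mat ?A1 (A2 * U) (0\<^sub>m k 1) (mat_adjoint U * A3 * U)"
    unfolding V_def using Uc A2 A3
    by (subst mult_four_block_mat[of _ 1 1 _ k _ k _ _ 1 _ k]) (auto intro!: cong_four_block_mat)
  finally have eq: "mat_adjoint (W * V) * A * (W * V)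
      = four_block_mat ?A1 (A2 * U) (0\<^sub>m k 1) (mat_adjoint U * A3 * U)" .
  have c: "mat_adjoint U * A3 * U \<in> carrier_mat k k" using Uc A3 by auto
  have "upper_triangular (mat_adjoint (W * V) * A * (W * V))"
    unfolding eq by (rule upper_triangular_four_block[OF _ c _ B(1)]) (auto simp: upper_triangular_def)
  moreover have "diag_mat (mat_adjoint (W * V) * A * (W * V)) = e # es"
    unfolding eq diag_four_block_mat[OF mat_carrier c] B(2) by (simp add: diag_mat_def)
  ultimately show ?case using unitary_mult[OF W(1) V(1)] by blast
qed

section \<open>Eigenvalue sequences and the Ky Fan bound\<close>

lemma proots_linear_factors: "proots (\<Prod>e\<leftarrow>es. [:- e, 1:]) = mset (es :: complex list)"
proof (induction es)
  case (Cons e es)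
  have "(\<Prod>e\<leftarrow>es. [:- e, 1:]) \<noteq> 0" by (auto simp: prod_list_zero_iff)
  then have "proots ([:- e, 1:] * (\<Prod>e\<leftarrow>es. [:- e, 1:])) = {#e#} + proots (\<Prod>e\<leftarrow>es. [:- e, 1:])"
    by (subst proots_mult) auto
  with Cons show ?case by (simp del: mult_pCons_left)
qed simp

lemma eigenvalue_seq_linear_factors:
  assumes "char_poly A = (\<Prod>e\<leftarrow>es. [:- e, 1:])"
  shows "eigenvalue_seq A = rev (sort (map Re es))"
  unfolding eigenvalue_seq_def assms proots_linear_factors
  by (simp flip: mset_map)

lemma eigenvalue_seq_sorted: "sorted_wrt (\<ge>) (eigenvalue_seq A)"
  unfolding eigenvalue_seq_def sorted_wrt_rev by simp

lemma length_eigenvalue_seq: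
  assumes "A \<in> carrier_mat n n"
  shows "length (eigenvalue_seq A) = n"
proof -
  have "length (eigenvalue_seq A) = size (proots (char_poly A))"
    unfolding eigenvalue_seq_def
    by (metis length_rev mset_sorted_list_of_multiset size_image_mset size_mset)
  with degree_monic_char_poly[OF assms] show ?thesis by (simp add: size_proots_complex)
qed

text \<open>The roots are sorted by decreasing real part before the triangularisation, so that the
  diagonal is the eigenvalue sequence itself.\<close>

lemma eigenvalue_seq_schur:
  assumes A: "A \<in> carrier_mat n n"
  obtains U where "unitary n U" "upper_triangular (mat_adjoint U * A * U)"
    "map Re (diag_mat (mat_adjoint U * A * U)) = eigenvalue_seq A"
proof -
  obtain es0 where es0: "char_poly A = (\<Prod>e\<leftarrow>es0. [:- e, 1:])"
    using char_poly_factorized[OF A] by blast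
  define es where "es = rev (sort_key Re es0)"
  have "mset es = mset es0" by (simp add: es_def)
  then have "(\<Prod>e\<leftarrow>es. [:- e, 1:]) = (\<Prod>e\<leftarrow>es0. [:- e, 1:])"
    by (metis mset_map prod_mset_prod_list)
  with es0 have es: "char_poly A = (\<Prod>e\<leftarrow>es. [:- e, 1:])" by simp
  from unitary_schur[OF A es] obtain U where U: "unitary n U"
    "upper_triangular (mat_adjoint U * A * U)" "diag_mat (mat_adjoint U * A * U) = es" by blast
  have "map Re (sort_key Re es0) = sort (map Re es0)"
    by (rule properties_for_sort[symmetric]) simp_all
  then have "map Re es = eigenvalue_seq A"
    by (simp add: eigenvalue_seq_linear_factors[OF es0] es_def flip: rev_map)
  with U that show ?thesis by auto
qed

lemma unitary_conj_entry:
  assumes "unitary n U" "A \<in> carrier_mat n n" "i < n" "j < n"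
  shows "(mat_adjoint U * A * U) $$ (i, j)
    = (\<Sum>x<n. \<Sum>y<n. A $$ (x, y) * U $$ (y, j) * cnj (U $$ (x, i)))"
proof -
  note d = unitary_dims[OF assms(1)]
  have "(mat_adjoint U * A * U) $$ (i, j) = (mat_adjoint U * (A * U)) $$ (i, j)"
    using assms d by (simp add: mult_mat_assoc_dim)
  also have "\<dots> = (\<Sum>x<n. cnj (U $$ (x, i)) * (\<Sum>y<n. A $$ (x, y) * U $$ (y, j)))"
    using assms d by (auto simp: mult_mat_entry intro!: sum.cong simp del: index_mult_mat(1))
  finally show ?thesis by (simp add: sum_distrib_left ac_simps)
qed

lemma unitary_frame:
  assumes "unitary n U" "k \<le> n"
  shows "frame n k (\<lambda>i x. U $$ (x, i))"
  unfolding frame_def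
proof (intro allI impI)
  fix i j assume ij: "i < k" "j < k"
  note d = unitary_dims[OF assms(1)]
  have "(\<Sum>x<n. U $$ (x, i) * cnj (U $$ (x, j))) = (mat_adjoint U * U) $$ (j, i)"
    using ij d assms by (auto simp: mult_mat_entry mult.commute intro!: sum.cong simp del: index_mult_mat(1))
  then show "(\<Sum>x<n. U $$ (x, i) * cnj (U $$ (x, j))) = (if i = j then 1 else 0)"
    using assms ij by (auto simp: unitary_def)
qed

lemma eigenvalue_seq_nth:
  assumes "A \<in> carrier_mat n n"
  obtains v where "frame n n v"
    "\<And>i. i < n \<Longrightarrow> eigenvalue_seq A ! i = Re (\<Sum>x<n. \<Sum>y<n. A $$ (x, y) * v i y * cnj (v i x))"
proof -
  from eigenvalue_seq_schur[OF assms] obtain U where U: "unitary n U"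
    "map Re (diag_mat (mat_adjoint U * A * U)) = eigenvalue_seq A" .
  note d = unitary_dims[OF U(1)]
  have "eigenvalue_seq A ! i = Re (\<Sum>x<n. \<Sum>y<n. A $$ (x, y) * U $$ (y, i) * cnj (U $$ (x, i)))"
    if "i < n" for i
    unfolding U(2)[symmetric] unitary_conj_entry[OF U(1) assms that that, symmetric]
    using d that assms by (simp add: diag_mat_def del: index_mult_mat(1))
  with that[OF unitary_frame[OF U(1) order_refl]] show ?thesis by blast
qed

lemma sum_list_take_nth:
  fixes xs :: "real list"
  shows "k \<le> length xs \<Longrightarrow> sum_list (take k xs) = (\<Sum>i<k. xs ! i)"
  by (simp add: sum_list_sum_nth lessThan_atLeast0)

lemma frame_mono: "frame d r v \<Longrightarrow> k \<le> r \<Longrightarrow> frame d k v"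
  by (simp add: frame_def)

text \<open>The easy half of Ky Fan's principle: the first \<open>k\<close> columns of the Schur
  unitary are an admissible frame, on which the quadratic form sums to the first \<open>k\<close>
  eigenvalues.\<close>

lemma eigenvalue_seq_ky_fan:
  assumes A: "A \<in> carrier_mat n n" and "k \<le> n" and "ky_fan_le n (\<lambda>x y. A $$ (x, y)) k c"
  shows "sum_list (take k (eigenvalue_seq A)) \<le> c"
proof -
  from eigenvalue_seq_nth[OF A] obtain v where fr: "frame n n v" and
    v: "\<And>i. i < n \<Longrightarrow> eigenvalue_seq A ! i = Re (\<Sum>x<n. \<Sum>y<n. A $$ (x, y) * v i y * cnj (v i x))" by blast
  have "sum_list (take k (eigenvalue_seq A)) = (\<Sum>i<k. eigenvalue_seq A ! i)"
    using assms by (intro sum_list_take_nth) (simp add: length_eigenvalue_seq)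
  also have "\<dots> = (\<Sum>i<k. Re (\<Sum>x<n. \<Sum>y<n. A $$ (x, y) * v i y * cnj (v i x)))"
    using assms by (intro sum.cong refl v) auto
  also have "\<dots> = Re (\<Sum>i<k. \<Sum>x<n. \<Sum>y<n. A $$ (x, y) * v i y * cnj (v i x))" by simp
  also have "\<dots> \<le> c"
    using assms frame_mono[OF fr \<open>k \<le> n\<close>] unfolding ky_fan_le_def by blast
  finally show ?thesis .
qed

lemma mat_trace_mult_commute:
  assumes "A \<in> carrier_mat n m" "B \<in> carrier_mat m n"
  shows "mat_trace (A * B) = mat_trace (B * A)"
proof -
  have "mat_trace (A * B) = (\<Sum>i<n. \<Sum>k<m. A $$ (i, k) * B $$ (k, i))"
    using assms by (auto simp: mat_trace_def mult_mat_entry simp del: index_mult_mat(1))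
  also have "\<dots> = (\<Sum>k<m. \<Sum>i<n. A $$ (i, k) * B $$ (k, i))" by (rule sum.swap)
  also have "\<dots> = mat_trace (B * A)"
    using assms by (auto simp: mat_trace_def mult_mat_entry mult.commute simp del: index_mult_mat(1))
  finally show ?thesis .
qed

lemma sum_list_eigenvalue_seq:
  assumes A: "A \<in> carrier_mat n n"
  shows "sum_list (eigenvalue_seq A) = Re (mat_trace A)"
proof -
  from eigenvalue_seq_schur[OF assms] obtain U where U: "unitary n U"
    "map Re (diag_mat (mat_adjoint U * A * U)) = eigenvalue_seq A" .
  note d = unitary_dims[OF U(1)]
  have Uc: "U \<in> carrier_mat n n" using U by (simp add: unitary_def)
  have "sum_list (eigenvalue_seq A) = Re (mat_trace (mat_adjoint U * A * U))"
    unfolding U(2)[symmetric] diag_mat_def mat_trace_def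
    by (simp add: sum_list_sum_nth lessThan_atLeast0 del: index_mult_mat(1))
  also have "mat_trace (mat_adjoint U * A * U) = mat_trace (U * (mat_adjoint U * A))"
    using Uc A by (intro mat_trace_mult_commute[of _ n n]) auto
  also have "U * (mat_adjoint U * A) = U * mat_adjoint U * A"
    using Uc A by (simp add: mult_mat_assoc_dim)
  also have "\<dots> = A" using U A by (simp add: unitary_def)
  finally show ?thesis .
qed

section \<open>Spectral decomposition of positive semi-definite matrices\<close>

lemma pos_semidef_sum:
  assumes "pos_semidef n A"
  shows "0 \<le> (\<Sum>x<n. \<Sum>y<n. A $$ (x, y) * v y * cnj (v x))"
proof -
  define u where "u = Matrix.vec n v"
  have A: "A \<in> carrier_mat n n" and u: "u \<in> carrier_vec n" using assms by (auto simp: pos_semidef_def u_def)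
  have "(A *\<^sub>v u) \<bullet>c u = (\<Sum>x<n. \<Sum>y<n. A $$ (x, y) * v y * cnj (v x))"
    using A u unfolding cscalar_prod_eq_inner_sum[OF mult_mat_vec_carrier[OF A u] u] inner_sum_def
    by (auto simp: u_def mult_mat_vec_entry sum_distrib_right intro!: sum.cong simp del: index_mult_mat_vec)
  with assms u show ?thesis unfolding pos_semidef_def by metis
qed

lemma eigenvalue_seq_nonneg:
  assumes "pos_semidef n A" "x \<in> set (eigenvalue_seq A)"
  shows "0 \<le> x"
proof -
  have A: "A \<in> carrier_mat n n" using assms by (simp add: pos_semidef_def)
  from eigenvalue_seq_nth[OF A] obtain v where
    v: "\<And>i. i < n \<Longrightarrow> eigenvalue_seq A ! i = Re (\<Sum>x<n. \<Sum>y<n. A $$ (x, y) * v i y * cnj (v i x))" by blast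
  from assms(2) obtain i where "i < n" "x = eigenvalue_seq A ! i"
    by (auto simp: in_set_conv_nth length_eigenvalue_seq[OF A])
  with v pos_semidef_sum[OF assms(1), of "v i"] show ?thesis by (simp add: less_eq_complex_def)
qed

text \<open>The values \<open>z = 1\<close> and \<open>z = \<i>\<close> isolate the imaginary and
  the real part of \<open>b\<close>.\<close>

lemma real_valued_linear_zero:
  fixes p q :: complex
  assumes "Im p = 0" "Im q = 0" "\<And>z. Im (p + (cmod z)\<^sup>2 * q + z * b) = 0"
  shows "b = 0"
  using assms(3)[of 1] assms(3)[of \<i>] assms(1,2) by (simp add: complex_eq_iff)

text \<open>The strictly upper entries of the Schur form vanish as well, because the quadratic form
  is real; the diagonal is non-negative, and its square roots scale the columns of \<open>U\<close>
  to \<open>\<phi>\<close>.\<close>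

lemma pos_semidef_decomposition:
  assumes psd: "pos_semidef n A"
  obtains \<phi> where "\<And>x y. x < n \<Longrightarrow> y < n \<Longrightarrow> A $$ (x, y) = (\<Sum>i<n. \<phi> i x * cnj (\<phi> i y))"
proof -
  have A: "A \<in> carrier_mat n n" using psd by (simp add: pos_semidef_def)
  from eigenvalue_seq_schur[OF A] obtain U where U: "unitary n U"
    "upper_triangular (mat_adjoint U * A * U)" .
  note d = unitary_dims[OF U(1)]
  have Uc: "U \<in> carrier_mat n n" using U by (simp add: unitary_def)
  define B where "B = mat_adjoint U * A * U"
  have B: "B \<in> carrier_mat n n" using Uc A by (auto simp: B_def)
  have lower: "B $$ (i, j) = 0" if "j < i" "i < n" for i j
    using U(2) that B unfolding B_def[symmetric] by auto
  have psdB: "0 \<le> (\<Sum>i<n. \<Sum>j<n. B $$ (i, j) * v j * cnj (v i))" for v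
  proof -
    have "(\<Sum>i<n. \<Sum>j<n. B $$ (i, j) * v j * cnj (v i))
        = (\<Sum>i<n. \<Sum>j<n. \<Sum>x<n. \<Sum>y<n. A $$ (x, y) * (U $$ (y, j) * v j) * cnj (U $$ (x, i) * v i))"
      using unitary_conj_entry[OF U(1) A]
      by (auto simp: B_def sum_distrib_right sum_distrib_left ac_simps intro!: sum.cong simp del: index_mult_mat(1))
    also have "\<dots> = (\<Sum>i<n. \<Sum>x<n. \<Sum>j<n. \<Sum>y<n. A $$ (x, y) * (U $$ (y, j) * v j) * cnj (U $$ (x, i) * v i))"
      by (rule sum.cong[OF refl], rule sum.swap)
    also have "\<dots> = (\<Sum>x<n. \<Sum>i<n. \<Sum>j<n. \<Sum>y<n. A $$ (x, y) * (U $$ (y, j) * v j) * cnj (U $$ (x, i) * v i))"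
      by (rule sum.swap)
    also have "\<dots> = (\<Sum>x<n. \<Sum>i<n. \<Sum>y<n. \<Sum>j<n. A $$ (x, y) * (U $$ (y, j) * v j) * cnj (U $$ (x, i) * v i))"
      by (rule sum.cong[OF refl], rule sum.cong[OF refl], rule sum.swap)
    also have "\<dots> = (\<Sum>x<n. \<Sum>y<n. \<Sum>i<n. \<Sum>j<n. A $$ (x, y) * (U $$ (y, j) * v j) * cnj (U $$ (x, i) * v i))"
      by (rule sum.cong[OF refl], rule sum.swap)
    also have "\<dots> = (\<Sum>x<n. \<Sum>y<n. A $$ (x, y) * (\<Sum>j<n. U $$ (y, j) * v j) * cnj (\<Sum>i<n. U $$ (x, i) * v i))"
      by (simp only: cnj_sum sum_distrib_left sum_distrib_right)
    finally show ?thesis using pos_semidef_sum[OF psd, of "\<lambda>y. \<Sum>j<n. U $$ (y, j) * v j"] by simp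
  qed
  have diag: "0 \<le> B $$ (i, i)" if "i < n" for i
  proof -
    have "(\<Sum>k<n. \<Sum>j<n. B $$ (k, j) * (if j = i then 1 else 0) * cnj (if k = i then 1 else 0))
      = (\<Sum>k<n. \<Sum>j<n. if j = i then (if k = i then B $$ (i, i) else 0) else 0)"
      by (intro sum.cong refl) auto
    with psdB[of "\<lambda>j. if j = i then 1 else 0"] that show ?thesis by simp
  qed
  \<comment> \<open>The form is evaluated at the vector with \<open>1\<close> at \<open>i\<close>,
    \<open>z\<close> at \<open>j\<close> and \<open>0\<close> elsewhere; the entry below the
    diagonal is already known to be zero.\<close>
  have upper: "B $$ (i, j) = 0" if "i < j" "j < n" for i j
  proof (rule real_valued_linear_zero)
    show "Im (B $$ (i, i)) = 0" "Im (B $$ (j, j)) = 0"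
      using diag[of i] diag[of j] that by (auto simp: less_eq_complex_def)
    fix z
    define v :: "nat \<Rightarrow> complex" where "v k = (if k = i then 1 else if k = j then z else 0)" for k
    have v: "(\<Sum>k<n. f k * v k) = f i + f j * z" for f
    proof -
      have "(\<Sum>k<n. f k * v k) = (\<Sum>k<n. (if k = i then f i else 0) + (if k = j then f j * z else 0))"
        using that by (intro sum.cong) (auto simp: v_def)
      then show ?thesis using that by (simp add: sum.distrib)
    qed
    have v': "(\<Sum>k<n. f k * cnj (v k)) = f i + f j * cnj z" for f
      using v[of "\<lambda>k. cnj (f k)"] by (metis (mono_tags, lifting) cnj_sum complex_cnj_add complex_cnj_cnj complex_cnj_mult sum.cong)
    have "(\<Sum>k<n. \<Sum>l<n. B $$ (k, l) * v l * cnj (v k))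
        = (B $$ (i, i) + B $$ (i, j) * z) + (B $$ (j, i) + B $$ (j, j) * z) * cnj z"
      unfolding sum_distrib_right[symmetric] v v' ..
    also have "\<dots> = B $$ (i, i) + (cmod z)\<^sup>2 * B $$ (j, j) + z * B $$ (i, j)"
      using lower[of i j] that unfolding complex_norm_square by (simp add: algebra_simps)
    finally show "Im (B $$ (i, i) + (cmod z)\<^sup>2 * B $$ (j, j) + z * B $$ (i, j)) = 0"
      using psdB[of v] by (simp add: less_eq_complex_def)
  qed
  have "A = U * B * mat_adjoint U"
  proof -
    have "U * B * mat_adjoint U = (U * mat_adjoint U) * (A * (U * mat_adjoint U))"
      unfolding B_def using A d by (simp add: mult_mat_assoc_dim)
    with U A show ?thesis by (simp add: unitary_def)
  qed
  moreover have "unitary n (mat_adjoint U)" using U(1) by (simp add: unitary_def)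
  ultimately have entry: "A $$ (x, y) = (\<Sum>i<n. \<Sum>j<n. B $$ (i, j) * cnj (U $$ (y, j)) * U $$ (x, i))"
    if "x < n" "y < n" for x y
    using unitary_conj_entry[of n "mat_adjoint U" B x y] B that d by (auto intro!: sum.cong)
  define \<phi> where "\<phi> i x = complex_of_real (sqrt (Re (B $$ (i, i)))) * U $$ (x, i)" for i x
  have "A $$ (x, y) = (\<Sum>i<n. \<phi> i x * cnj (\<phi> i y))" if "x < n" "y < n" for x y
  proof -
    have "A $$ (x, y) = (\<Sum>i<n. \<Sum>j<n. if j = i then B $$ (i, i) * cnj (U $$ (y, i)) * U $$ (x, i) else 0)"
      unfolding entry[OF that] using lower upper
      by (intro sum.cong refl) (metis lessThan_iff linorder_neqE_nat mult_zero_left)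
    also have "\<dots> = (\<Sum>i<n. \<phi> i x * cnj (\<phi> i y))"
    proof (intro sum.cong refl)
      fix i assume "i \<in> {..<n}"
      then have b: "0 \<le> Re (B $$ (i, i))" "B $$ (i, i) = complex_of_real (Re (B $$ (i, i)))"
        using diag[of i] by (auto simp: less_eq_complex_def complex_eq_iff)
      have "\<phi> i x * cnj (\<phi> i y)
          = complex_of_real (sqrt (Re (B $$ (i, i))) * sqrt (Re (B $$ (i, i)))) * cnj (U $$ (y, i)) * U $$ (x, i)"
        by (simp add: \<phi>_def del: real_sqrt_mult_self)
      also have "\<dots> = B $$ (i, i) * cnj (U $$ (y, i)) * U $$ (x, i)"
        using b by simp
      finally show "(\<Sum>j<n. if j = i then B $$ (i, i) * cnj (U $$ (y, i)) * U $$ (x, i) else 0)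
          = \<phi> i x * cnj (\<phi> i y)" using \<open>i \<in> {..<n}\<close> by simp
    qed
    finally show ?thesis .
  qed
  then show ?thesis using that by blast
qed

lemma eigenvalue_seq_diagonal:
  assumes A: "A \<in> carrier_mat n n" and diag: "\<And>i j. i < n \<Longrightarrow> j < n \<Longrightarrow> A $$ (i, j) = (if i = j then complex_of_real (d i) else 0)"
  shows "eigenvalue_seq A = rev (sort (map d [0..<n]))"
proof -
  have "char_poly A = (\<Prod>e\<leftarrow>diag_mat A. [:- e, 1:])"
    using A diag by (intro char_poly_upper_triangular[OF A]) (auto simp: upper_triangular_def)
  moreover have "map Re (diag_mat A) = map d [0..<n]"
    using A diag by (auto simp: diag_mat_def)
  ultimately show ?thesis using eigenvalue_seq_linear_factors by metis
qed

lemma eigenvalue_seq_unitary: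
  assumes "unitary n U" "A \<in> carrier_mat n n"
  shows "eigenvalue_seq (mat_adjoint U * A * U) = eigenvalue_seq A"
  unfolding eigenvalue_seq_def char_poly_similar[OF unitary_similar[OF assms]] ..

section \<open>The total Casimir operator and its minimal eigenspace\<close>

definition pair_index :: "nat \<Rightarrow> nat \<Rightarrow> nat \<Rightarrow> nat" where
  "pair_index q i j = i * q + j"

lemma pair_index_less: "i < p \<Longrightarrow> j < q \<Longrightarrow> pair_index q i j < p * q"
proof -
  assume "i < p" "j < q"
  then have "pair_index q i j < Suc i * q" "Suc i * q \<le> p * q"
    by (auto simp: pair_index_def simp del: mult_Suc intro: mult_le_mono1) (simp add: mult_Suc)
  then show ?thesis by linarith
qed

lemma pair_index_div [simp]: "j < q \<Longrightarrow> pair_index q i j div q = i"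
  and pair_index_mod [simp]: "j < q \<Longrightarrow> pair_index q i j mod q = j"
  by (auto simp: pair_index_def)

lemma pair_indexE:
  assumes "x < p * q"
  obtains i j where "i < p" "j < q" "x = pair_index q i j"
proof
  have "q > 0" using assms by (cases q) auto
  then show "x mod q < q" by simp
  show "x div q < p" using assms by (simp add: less_mult_imp_div_less)
  show "x = pair_index q (x div q) (x mod q)" by (simp add: pair_index_def)
qed

lemma pair_index_eq_iff:
  assumes "j < q" "j' < q"
  shows "pair_index q i j = pair_index q i' j' \<longleftrightarrow> i = i' \<and> j = j'"
  using pair_index_div pair_index_mod assms by metis

lemma sum_pair_index: "(\<Sum>x<p * q. f x) = (\<Sum>i<p. \<Sum>j<q. f (pair_index q i j))"
proof -
  have "(\<Sum>i<p. \<Sum>j<q. f (pair_index q i j)) = (\<Sum>(i, j)\<in>{..<p} \<times> {..<q}. f (pair_index q i j))"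
    by (rule sum.cartesian_product)
  also have "\<dots> = (\<Sum>x<p * q. f x)"
    by (rule sum.reindex_bij_witness[where i = "\<lambda>x. (x div q, x mod q)" and j = "\<lambda>(i, j). pair_index q i j"])
      (auto simp: pair_index_less elim: pair_indexE)
  finally show ?thesis ..
qed

lemma eq_mat_pairI:
  assumes "A \<in> carrier_mat (p * q) (p * q)" "B \<in> carrier_mat (p * q) (p * q)"
    and "\<And>i j i' j'. i < p \<Longrightarrow> j < q \<Longrightarrow> i' < p \<Longrightarrow> j' < q \<Longrightarrow>
      A $$ (pair_index q i j, pair_index q i' j') = B $$ (pair_index q i j, pair_index q i' j')"
  shows "A = B"
proof (rule eq_matI)
  fix x y assume "x < dim_row B" "y < dim_col B"
  then have "x < p * q" "y < p * q" using assms by auto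
  then show "A $$ (x, y) = B $$ (x, y)" using assms(3) by (elim pair_indexE) auto
qed (use assms in auto)

lemma tensor_mat_carrier:
  "A \<in> carrier_mat p p \<Longrightarrow> B \<in> carrier_mat q q \<Longrightarrow> tensor_mat A B \<in> carrier_mat (p * q) (p * q)"
  by (auto simp: tensor_mat_def)

lemma tensor_mat_entry:
  assumes "A \<in> carrier_mat p p" "B \<in> carrier_mat q q" "i < p" "j < q" "i' < p" "j' < q"
  shows "tensor_mat A B $$ (pair_index q i j, pair_index q i' j') = A $$ (i, i') * B $$ (j, j')"
  using assms by (auto simp: tensor_mat_def pair_index_less)

lemma mult_pair_entry:
  assumes "A \<in> carrier_mat (p * q) (p * q)" "B \<in> carrier_mat (p * q) (p * q)" "x < p * q" "y < p * q"
  shows "(A * B) $$ (x, y) = (\<Sum>i<p. \<Sum>j<q. A $$ (x, pair_index q i j) * B $$ (pair_index q i j, y))"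
  using assms by (simp add: mult_mat_entry sum_pair_index del: index_mult_mat(1))

lemma tensor_mat_mult:
  assumes "A \<in> carrier_mat p p" "B \<in> carrier_mat q q" "C \<in> carrier_mat p p" "D \<in> carrier_mat q q"
  shows "tensor_mat A B * tensor_mat C D = tensor_mat (A * C) (B * D)"
proof (rule eq_mat_pairI[of _ p q])
  note t = tensor_mat_carrier[OF assms(1,2)] tensor_mat_carrier[OF assms(3,4)]
  show "tensor_mat A B * tensor_mat C D \<in> carrier_mat (p * q) (p * q)" using t by simp
  have AC: "A * C \<in> carrier_mat p p" and BD: "B * D \<in> carrier_mat q q" using assms by auto
  then show "tensor_mat (A * C) (B * D) \<in> carrier_mat (p * q) (p * q)" by (rule tensor_mat_carrier)
  fix i j i' j' assume ij: "i < p" "j < q" "i' < p" "j' < q"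
  have "(tensor_mat A B * tensor_mat C D) $$ (pair_index q i j, pair_index q i' j')
     = (\<Sum>k<p. \<Sum>l<q. (A $$ (i, k) * C $$ (k, i')) * (B $$ (j, l) * D $$ (l, j')))"
    by (subst mult_pair_entry[OF t]) (use ij assms in \<open>auto simp: pair_index_less tensor_mat_entry intro!: sum.cong\<close>)
  also have "\<dots> = (A * C) $$ (i, i') * (B * D) $$ (j, j')"
    using ij assms by (simp add: mult_mat_entry sum_product del: index_mult_mat(1))
  finally show "(tensor_mat A B * tensor_mat C D) $$ (pair_index q i j, pair_index q i' j')
     = tensor_mat (A * C) (B * D) $$ (pair_index q i j, pair_index q i' j')"
    using ij by (simp add: tensor_mat_entry[OF AC BD])
qed

lemma tensor_mat_adjoint: "mat_adjoint (tensor_mat A B) = tensor_mat (mat_adjoint A) (mat_adjoint B)"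
proof -
  have less: "x mod q < q" "x div q < p" if "x < p * q" for x p q :: nat
    using that by (auto elim!: pair_indexE)
  show ?thesis
    by (rule eq_matI) (auto simp: tensor_mat_def less)
qed

lemma tensor_mat_one: "tensor_mat (1\<^sub>m p) (1\<^sub>m q) = 1\<^sub>m (p * q)"
  by (rule eq_mat_pairI[of _ p q])
    (auto simp: tensor_mat_entry[of _ p _ q] pair_index_less pair_index_eq_iff intro!: tensor_mat_carrier)

lemma partial_trace_fst_entry:
  "j < q \<Longrightarrow> j' < q \<Longrightarrow> partial_trace_fst p q A $$ (j, j') = (\<Sum>k<p. A $$ (pair_index q k j, pair_index q k j'))"
  by (simp add: partial_trace_fst_def pair_index_def)

section \<open>Matrix entries of the total Casimir operator\<close>

lemma spin_dim_half: "spin_dim (real n / 2) = Suc n"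
proof -
  have "\<lfloor>2 * (real n / 2) + 1\<rfloor> = int (Suc n)" by linarith
  then show ?thesis by (simp add: spin_dim_def)
qed

lemmas spin_half = spin_carrier[OF refl spin_dim_half] spin_x_index[OF refl spin_dim_half]
  spin_y_index[OF refl spin_dim_half] spin_z_index[OF refl spin_dim_half]

text \<open>The operators on the two factors commute, which gives the cross term its factor
  \<open>2\<close>. Summed over the three components, the two squares become scalars by
  \<open>spin_casimir\<close>.\<close>

lemma total_op_square_entry:
  assumes S: "S (real n / 2) \<in> carrier_mat (Suc n) (Suc n)" "S (real N / 2) \<in> carrier_mat (Suc N) (Suc N)"
    and ij: "i < Suc n" "j < Suc N" "i' < Suc n" "j' < Suc N"
  shows "(total_op S (real n / 2) (real N / 2) * total_op S (real n / 2) (real N / 2))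
      $$ (pair_index (Suc N) i j, pair_index (Suc N) i' j')
    = (S (real n / 2) * S (real n / 2)) $$ (i, i') * (if j = j' then 1 else 0)
      + (if i = i' then 1 else 0) * (S (real N / 2) * S (real N / 2)) $$ (j, j')
      + 2 * S (real n / 2) $$ (i, i') * S (real N / 2) $$ (j, j')"
proof -
  let ?S = "S (real n / 2)" and ?T = "S (real N / 2)" and ?p = "Suc n" and ?q = "Suc N"
  let ?A = "tensor_mat ?S (1\<^sub>m ?q)" and ?B = "tensor_mat (1\<^sub>m ?p) ?T"
  have c: "?A \<in> carrier_mat (?p * ?q) (?p * ?q)" "?B \<in> carrier_mat (?p * ?q) (?p * ?q)"
    using S by (auto intro!: tensor_mat_carrier simp del: mult_Suc mult_Suc_right)
  have "total_op S (real n / 2) (real N / 2) * total_op S (real n / 2) (real N / 2)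
      = ?A * ?A + ?A * ?B + (?B * ?A + ?B * ?B)"
    unfolding total_op_def spin_dim_half using c
    by (subst add_mult_distrib_mat[of _ "?p * ?q" "?p * ?q" _ _ "?p * ?q"])
      (auto simp: mult_add_distrib_mat[of _ "?p * ?q" "?p * ?q" _ "?p * ?q"] simp del: mult_Suc mult_Suc_right)
  also have "\<dots> = tensor_mat (?S * ?S) (1\<^sub>m ?q) + tensor_mat ?S ?T + (tensor_mat ?S ?T + tensor_mat (1\<^sub>m ?p) (?T * ?T))"
    using S by (simp add: tensor_mat_mult[of _ ?p _ ?q])
  finally have eq: "total_op S (real n / 2) (real N / 2) * total_op S (real n / 2) (real N / 2) = \<dots>" .
  have c': "tensor_mat (?S * ?S) (1\<^sub>m ?q) \<in> carrier_mat (?p * ?q) (?p * ?q)"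
    "tensor_mat ?S ?T \<in> carrier_mat (?p * ?q) (?p * ?q)"
    "tensor_mat (1\<^sub>m ?p) (?T * ?T) \<in> carrier_mat (?p * ?q) (?p * ?q)"
    using S by (auto intro!: tensor_mat_carrier simp del: mult_Suc mult_Suc_right)
  have SS: "?S * ?S \<in> carrier_mat ?p ?p" "?T * ?T \<in> carrier_mat ?q ?q" using S by auto
  note less = pair_index_less[OF ij(1,2)] pair_index_less[OF ij(3,4)]
  show ?thesis unfolding eq
    using c' less ij
    by (simp add: tensor_mat_entry[OF SS(1) one_carrier_mat] tensor_mat_entry[OF one_carrier_mat SS(2)]
        tensor_mat_entry[OF S] del: index_mult_mat(1) mult_Suc mult_Suc_right)
qed

text \<open>The diagonal of the total Casimir operator: \<open>J (J + 1) + K (K + 1)\<close> plus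
  twice the product of the magnetic numbers, with \<open>J = n / 2\<close> and
  \<open>K = N / 2\<close>.\<close>

definition casimir_coeff :: "nat \<Rightarrow> nat \<Rightarrow> nat \<Rightarrow> nat \<Rightarrow> real" where
  "casimir_coeff n N i j = real n / 2 * (real n / 2 + 1) + real N / 2 * (real N / 2 + 1)
     + 2 * (real n / 2 - real i) * (real N / 2 - real j)"

lemma total_casimir_carrier:
  "total_casimir (real n / 2) (real N / 2) \<in> carrier_mat (Suc n * Suc N) (Suc n * Suc N)"
proof -
  have "total_op S (real n / 2) (real N / 2) \<in> carrier_mat (Suc n * Suc N) (Suc n * Suc N)"
    if "S (real N / 2) \<in> carrier_mat (Suc N) (Suc N)" for S
    using that unfolding total_op_def spin_dim_half
    by (intro add_carrier_mat tensor_mat_carrier) auto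
  then show ?thesis unfolding total_casimir_def
    by (intro add_carrier_mat mult_carrier_mat[of _ _ "Suc n * Suc N"]) (auto simp: spin_half simp del: mult_Suc mult_Suc_right)
qed

lemma total_casimir_entry:
  assumes ij: "i < Suc n" "j < Suc N" "i' < Suc n" "j' < Suc N"
  shows "total_casimir (real n / 2) (real N / 2) $$ (pair_index (Suc N) i j, pair_index (Suc N) i' j')
    = (if i = i' \<and> j = j' then complex_of_real (casimir_coeff n N i j) else 0)
      + raise_entry n i i' * raise_entry N j' j + raise_entry n i' i * raise_entry N j j'"
proof -
  let ?J = "real n / 2" and ?K = "real N / 2" and ?P = "Suc n * Suc N"
  let ?x = "pair_index (Suc N) i j" and ?y = "pair_index (Suc N) i' j'"
  note less = pair_index_less[OF ij(1,2)] pair_index_less[OF ij(3,4)]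
  have c: "total_op S ?J ?K * total_op S ?J ?K \<in> carrier_mat ?P ?P"
    if "S ?J \<in> carrier_mat (Suc n) (Suc n)" "S ?K \<in> carrier_mat (Suc N) (Suc N)" for S
  proof -
    have "total_op S ?J ?K \<in> carrier_mat ?P ?P"
      using that unfolding total_op_def spin_dim_half by (intro add_carrier_mat tensor_mat_carrier) auto
    then show ?thesis by simp
  qed
  have cas: "(spin_x (real k / 2) * spin_x (real k / 2)) $$ (a, b) + (spin_y (real k / 2) * spin_y (real k / 2)) $$ (a, b)
      + (spin_z (real k / 2) * spin_z (real k / 2)) $$ (a, b)
    = (if a = b then complex_of_real (real k / 2 * (real k / 2 + 1)) else 0)"
    if "a < Suc k" "b < Suc k" for k a b
  proof -
    let ?L = "real k / 2"
    have "is_spin ?L" by (simp add: is_spin_def)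
    have "(spin_x ?L * spin_x ?L) $$ (a, b) + (spin_y ?L * spin_y ?L) $$ (a, b) + (spin_z ?L * spin_z ?L) $$ (a, b)
      = (spin_x ?L * spin_x ?L + spin_y ?L * spin_y ?L + spin_z ?L * spin_z ?L) $$ (a, b)"
      using that by (simp add: spin_dims[OF refl spin_dim_half] del: index_mult_mat(1))
    also have "\<dots> = (complex_of_real (?L * (?L + 1)) \<cdot>\<^sub>m 1\<^sub>m (Suc k)) $$ (a, b)"
      unfolding spin_casimir[OF \<open>is_spin ?L\<close>] spin_dim_half ..
    also have "\<dots> = (if a = b then complex_of_real (?L * (?L + 1)) else 0)"
      using that by (cases "a = b") simp_all
    finally show ?thesis .
  qed
  have entry3: "(A + B + C) $$ (x, y) = A $$ (x, y) + B $$ (x, y) + C $$ (x, y)"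
    if "A \<in> carrier_mat ?P ?P" "B \<in> carrier_mat ?P ?P" "C \<in> carrier_mat ?P ?P" "x < ?P" "y < ?P"
    for A B C :: "complex mat" and x y
    using that by auto
  have "total_casimir ?J ?K $$ (?x, ?y) = (total_op spin_x ?J ?K * total_op spin_x ?J ?K) $$ (?x, ?y)
     + (total_op spin_y ?J ?K * total_op spin_y ?J ?K) $$ (?x, ?y)
     + (total_op spin_z ?J ?K * total_op spin_z ?J ?K) $$ (?x, ?y)"
    unfolding total_casimir_def by (rule entry3) (use c less in \<open>auto simp: spin_half simp del: mult_Suc mult_Suc_right\<close>)
  also have "\<dots> = ((spin_x ?J * spin_x ?J) $$ (i, i') + (spin_y ?J * spin_y ?J) $$ (i, i') + (spin_z ?J * spin_z ?J) $$ (i, i'))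
        * (if j = j' then 1 else 0)
      + (if i = i' then 1 else 0) * ((spin_x ?K * spin_x ?K) $$ (j, j') + (spin_y ?K * spin_y ?K) $$ (j, j') + (spin_z ?K * spin_z ?K) $$ (j, j'))
      + 2 * (spin_x ?J $$ (i, i') * spin_x ?K $$ (j, j') + spin_y ?J $$ (i, i') * spin_y ?K $$ (j, j')
           + spin_z ?J $$ (i, i') * spin_z ?K $$ (j, j'))"
    using ij by (simp add: total_op_square_entry spin_half(1-3) algebra_simps del: index_mult_mat(1))
  also have "\<dots> = (if i = i' \<and> j = j' then complex_of_real (?J * (?J + 1) + ?K * (?K + 1)) else 0)
      + 2 * (spin_x ?J $$ (i, i') * spin_x ?K $$ (j, j') + spin_y ?J $$ (i, i') * spin_y ?K $$ (j, j')
           + spin_z ?J $$ (i, i') * spin_z ?K $$ (j, j'))"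
    unfolding cas[OF ij(1,3)] cas[OF ij(2,4)] by simp
  also have "spin_x ?J $$ (i, i') * spin_x ?K $$ (j, j') + spin_y ?J $$ (i, i') * spin_y ?K $$ (j, j')
      = (raise_entry n i i' * raise_entry N j' j + raise_entry n i' i * raise_entry N j j') / 2"
    using ij by (simp add: spin_half field_simps)
  also have "spin_z ?J $$ (i, i') * spin_z ?K $$ (j, j')
     = (if i = i' \<and> j = j' then complex_of_real ((?J - real i) * (?K - real j)) else 0)"
    using ij by (simp add: spin_half)
  finally show ?thesis unfolding casimir_coeff_def by (simp add: algebra_simps)
qed


lemma sum_double_delta:
  fixes g :: "nat \<Rightarrow> nat \<Rightarrow> 'a :: comm_monoid_add"
  shows "(\<Sum>i<p. \<Sum>j<q. if i = a \<and> j = b then g i j else 0) = (if a < p \<and> b < q then g a b else 0)"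
proof -
  have "(\<Sum>i<p. \<Sum>j<q. if i = a \<and> j = b then g i j else 0)
      = (\<Sum>i<p. if i = a then (\<Sum>j<q. if j = b then g a j else 0) else 0)"
    by (intro sum.cong refl) auto
  then show ?thesis by auto
qed

text \<open>The total magnetic number is conserved, so a component is coupled only to its two
  neighbours on the antidiagonal of constant \<open>i + j\<close>.\<close>

lemma total_casimir_mult_vec:
  assumes v: "v \<in> carrier_vec (Suc n * Suc N)" and ij: "i \<le> n" "j \<le> N"
  shows "(total_casimir (real n / 2) (real N / 2) *\<^sub>v v) $ pair_index (Suc N) i j
    = complex_of_real (casimir_coeff n N i j) * v $ pair_index (Suc N) i j
      + (if i < n \<and> 0 < j then raise_coeff n i * raise_coeff N (j - 1) * v $ pair_index (Suc N) (Suc i) (j - 1) else 0)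
      + (if 0 < i \<and> j < N then raise_coeff n (i - 1) * raise_coeff N j * v $ pair_index (Suc N) (i - 1) (Suc j) else 0)"
proof -
  define f where "f i j = v $ pair_index (Suc N) i j" for i j
  have ij': "i < Suc n" "j < Suc N" using ij by auto
  let ?C = "total_casimir (real n / 2) (real N / 2)"
  have "(?C *\<^sub>v v) $ pair_index (Suc N) i j
      = (\<Sum>x<Suc n * Suc N. ?C $$ (pair_index (Suc N) i j, x) * v $ x)"
    using v total_casimir_carrier[of n N] pair_index_less[OF ij']
    by (subst mult_mat_vec_entry) (auto simp del: mult_Suc mult_Suc_right)
  also have "\<dots> = (\<Sum>i'<Suc n. \<Sum>j'<Suc N.
      (if i' = i \<and> j' = j then complex_of_real (casimir_coeff n N i j) * f i' j' else 0)
      + (if i' = Suc i \<and> j' = j - 1 then if 0 < j then raise_coeff n i * raise_coeff N (j - 1) * f i' j' else 0 else 0)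
      + (if i' = i - 1 \<and> j' = Suc j then if 0 < i then raise_coeff n (i - 1) * raise_coeff N j * f i' j' else 0 else 0))"
    unfolding sum_pair_index
  proof (intro sum.cong refl)
    fix i' j' assume "i' \<in> {..<Suc n}" "j' \<in> {..<Suc N}"
    then have less: "i' < Suc n" "j' < Suc N" by auto
    have "(if i = i' \<and> j = j' then x else 0) * y = (if i' = i \<and> j' = j then x * y else 0)" for x y :: complex
      by auto
    moreover have "raise_entry n i i' * raise_entry N j' j * y
        = (if i' = Suc i \<and> j' = j - 1 then if 0 < j then raise_coeff n i * raise_coeff N (j - 1) * y else 0 else 0)" for y
      by (cases j) (auto simp: raise_entry_def)
    moreover have "raise_entry n i' i * raise_entry N j j' * y
        = (if i' = i - 1 \<and> j' = Suc j then if 0 < i then raise_coeff n (i - 1) * raise_coeff N j * y else 0 else 0)" for y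
      by (cases i) (auto simp: raise_entry_def)
    ultimately show "?C $$ (pair_index (Suc N) i j, pair_index (Suc N) i' j') * v $ pair_index (Suc N) i' j'
      = (if i' = i \<and> j' = j then complex_of_real (casimir_coeff n N i j) * f i' j' else 0)
      + (if i' = Suc i \<and> j' = j - 1 then if 0 < j then raise_coeff n i * raise_coeff N (j - 1) * f i' j' else 0 else 0)
      + (if i' = i - 1 \<and> j' = Suc j then if 0 < i then raise_coeff n (i - 1) * raise_coeff N j * f i' j' else 0 else 0)"
      unfolding total_casimir_entry[OF ij' less] f_def distrib_right by (simp only:)
  qed
  also have "\<dots> = complex_of_real (casimir_coeff n N i j) * f i j
      + (if i < n \<and> 0 < j then raise_coeff n i * raise_coeff N (j - 1) * f (Suc i) (j - 1) else 0)
      + (if 0 < i \<and> j < N then raise_coeff n (i - 1) * raise_coeff N j * f (i - 1) (Suc j) else 0)"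
    unfolding sum.distrib sum_double_delta using ij by auto
  finally show ?thesis by (simp add: f_def)
qed

text \<open>
  The eigenvalue equation of the total Casimir operator for the minimal spin \<open>(N - n) / 2\<close>, after the
  components are divided by those of the antisymmetric invariant
  \<open>(- 1)\<^sup>i sqrt (binomial n i / binomial N j)\<close>. It says that a weighted discrete
  Laplacian vanishes, with Dirichlet conditions where an antidiagonal leaves the rectangle.
\<close>

definition harmonic_eq :: "nat \<Rightarrow> nat \<Rightarrow> (nat \<Rightarrow> nat \<Rightarrow> complex) \<Rightarrow> bool" where
  "harmonic_eq n N h \<longleftrightarrow> (\<forall>i\<le>n. \<forall>j\<le>N.
     of_nat ((n - i) * Suc (N - j)) * (h i j - (if i < n \<and> 0 < j then h (Suc i) (j - 1) else 0))
     + of_nat (i * Suc j) * (h i j - (if 0 < i \<and> j < N then h (i - 1) (Suc j) else 0)) = 0)"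

lemma harmonic_eqD:
  assumes "harmonic_eq n N h" "i \<le> n" "j \<le> N"
  shows "of_nat ((n - i) * Suc (N - j)) * (h i j - (if i < n \<and> 0 < j then h (Suc i) (j - 1) else 0))
     + of_nat (i * Suc j) * (h i j - (if 0 < i \<and> j < N then h (i - 1) (Suc j) else 0)) = 0"
  using assms by (simp add: harmonic_eq_def)

lemma weighted_sum_zero:
  fixes d e :: complex
  assumes "of_nat a * d + of_nat b * e = 0" "0 < a" "b = 0 \<or> e = 0"
  shows "d = 0"
  using assms by auto

text \<open>For \<open>w \<le> N\<close> the antidiagonal starts at \<open>i = 0\<close>, where the
  second weight is zero, so the first difference vanishes. Up to sign it is the second difference of
  the next equation, and the zero difference travels along the antidiagonal.\<close>

lemma harmonic_eq_step:
  assumes h: "harmonic_eq n N h" and "w \<le> N"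
  shows "i < n \<Longrightarrow> i < w \<Longrightarrow> h (Suc i) (w - Suc i) = h i (w - i)"
proof (induction i)
  case 0
  have "h 0 w - (if 0 < n \<and> 0 < w then h (Suc 0) (w - 1) else 0) = 0"
    by (rule weighted_sum_zero[OF harmonic_eqD[OF h, of 0 w]]) (use 0 \<open>w \<le> N\<close> in auto)
  with 0 show ?case by simp
next
  case (Suc i)
  then have i: "Suc (w - Suc i) = w - i" "w - Suc i < N" "0 < w - Suc i" "Suc i < n" "w - Suc i \<le> N"
    using \<open>w \<le> N\<close> by auto
  have "h (Suc i) (w - Suc i) - (if Suc i < n \<and> 0 < w - Suc i then h (Suc (Suc i)) (w - Suc i - 1) else 0) = 0"
    by (rule weighted_sum_zero[OF harmonic_eqD[OF h, of "Suc i" "w - Suc i"]]) (use i Suc in auto)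
  with i show ?case by simp
qed

lemma harmonic_eq_constant:
  assumes "harmonic_eq n N h" "w \<le> N" "i \<le> n" "i \<le> w"
  shows "h i (w - i) = h 0 w"
  using assms(3,4)
proof (induction i)
  case (Suc i)
  with harmonic_eq_step[OF assms(1,2), of i] show ?case by simp
qed simp

text \<open>For \<open>w < n\<close> the antidiagonal ends at \<open>(w, 0)\<close>, where the first
  weight is positive and the neighbour outside counts as zero; this forces the constant value to be
  zero.\<close>

lemma harmonic_eq_zero:
  assumes h: "harmonic_eq n N h" and w: "w \<le> N" "w < n" "i \<le> w"
  shows "h i (w - i) = 0"
proof -
  have const: "h i (w - i) = h w 0" if "i \<le> w" for i
    using harmonic_eq_constant[OF h, of w i] harmonic_eq_constant[OF h, of w w] w that by simp
  have "w = 0 \<or> h w 0 - (if 0 < w \<and> 0 < N then h (w - 1) (Suc 0) else 0) = 0"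
  proof (cases w)
    case (Suc k)
    then have "h k (Suc 0) = h w 0" using const[of k] by simp
    then show ?thesis using Suc w by simp
  qed simp
  then have "h w 0 - (if w < n \<and> 0 < (0::nat) then h (Suc w) (0 - 1) else 0) = 0"
    by (intro weighted_sum_zero[OF harmonic_eqD[OF h, of w 0]]) (use w in auto)
  then show ?thesis using const[OF w(3)] by simp
qed

text \<open>The reflection exchanges the two differences together with their weights. It carries
  antidiagonals with \<open>i + j > N\<close> to those with \<open>i + j < n\<close>.\<close>

lemma harmonic_eq_reflect:
  assumes "harmonic_eq n N h"
  shows "harmonic_eq n N (\<lambda>i j. h (n - i) (N - j))"
  unfolding harmonic_eq_def
proof (intro allI impI)
  fix i j assume ij: "i \<le> n" "j \<le> N"
  have 1: "(if n - i < n \<and> 0 < N - j then h (Suc (n - i)) (N - j - 1) else 0)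
      = (if 0 < i \<and> j < N then h (n - (i - 1)) (N - Suc j) else 0)"
    using ij by (auto simp: Suc_diff_le)
  have 2: "(if 0 < n - i \<and> N - j < N then h (n - i - 1) (Suc (N - j)) else 0)
      = (if i < n \<and> 0 < j then h (n - Suc i) (N - (j - 1)) else 0)"
    using ij by (auto simp: Suc_diff_le)
  have 3: "n - (n - i) = i" "N - (N - j) = j" using ij by auto
  from harmonic_eqD[OF assms, of "n - i" "N - j"]
  show "of_nat ((n - i) * Suc (N - j)) * (h (n - i) (N - j) - (if i < n \<and> 0 < j then h (n - Suc i) (N - (j - 1)) else 0))
     + of_nat (i * Suc j) * (h (n - i) (N - j) - (if 0 < i \<and> j < N then h (n - (i - 1)) (N - Suc j) else 0)) = 0"
    unfolding 1 2 3 by (simp only: diff_le_self simp_thms add.commute)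
qed

text \<open>Only the antidiagonals with \<open>n \<le> i + j \<le> N\<close> both start and end
  where a weight vanishes, and each carries one free constant. This leaves \<open>N - n + 1\<close>
  dimensions, those of spin \<open>(N - n) / 2\<close>.\<close>

lemma harmonic_eq_iff:
  assumes "n \<le> N"
  shows "harmonic_eq n N h \<longleftrightarrow>
    (\<exists>c. \<forall>i\<le>n. \<forall>j\<le>N. h i j = (if n \<le> i + j \<and> i + j \<le> N then c (i + j) else 0))"
proof
  assume h: "harmonic_eq n N h"
  have "h i j = (if n \<le> i + j \<and> i + j \<le> N then h 0 (i + j) else 0)" if "i \<le> n" "j \<le> N" for i j
  proof -
    consider "i + j < n" | "n \<le> i + j" "i + j \<le> N" | "N < i + j" by linarith
    then show ?thesis
    proof cases
      case 1
      with harmonic_eq_zero[OF h, of "i + j" i] assms show ?thesis by simp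
    next
      case 2
      with harmonic_eq_constant[OF h, of "i + j" i] that show ?thesis by simp
    next
      case 3
      define w where "w = (n - i) + (N - j)"
      have w: "w < n" "w \<le> N" "n - i \<le> w" "w - (n - i) = N - j" using 3 that assms by (auto simp: w_def)
      from harmonic_eq_zero[OF harmonic_eq_reflect[OF h] w(2,1,3)] w that 3 show ?thesis by simp
    qed
  qed
  then show "\<exists>c. \<forall>i\<le>n. \<forall>j\<le>N. h i j = (if n \<le> i + j \<and> i + j \<le> N then c (i + j) else 0)"
    by (intro exI[of _ "\<lambda>w. h 0 w"]) auto
next
  assume "\<exists>c. \<forall>i\<le>n. \<forall>j\<le>N. h i j = (if n \<le> i + j \<and> i + j \<le> N then c (i + j) else 0)"
  then obtain c where c: "\<And>i j. i \<le> n \<Longrightarrow> j \<le> N \<Longrightarrow> h i j = (if n \<le> i + j \<and> i + j \<le> N then c (i + j) else 0)"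
    by blast
  show "harmonic_eq n N h" unfolding harmonic_eq_def
  proof (intro allI impI)
    fix i j assume ij: "i \<le> n" "j \<le> N"
    have "i = n \<or> h i j = (if i < n \<and> 0 < j then h (Suc i) (j - 1) else 0)"
    proof (cases "i < n \<and> 0 < j")
      case True
      then have "Suc i + (j - 1) = i + j" "Suc i \<le> n" "j - 1 \<le> N" using ij by auto
      with c[of "Suc i" "j - 1"] c[OF ij] True show ?thesis by simp
    next
      case False
      with c[OF ij] ij show ?thesis by auto
    qed
    moreover have "i = 0 \<or> h i j = (if 0 < i \<and> j < N then h (i - 1) (Suc j) else 0)"
    proof (cases "0 < i \<and> j < N")
      case True
      then have "(i - 1) + Suc j = i + j" "i - 1 \<le> n" "Suc j \<le> N" using ij by auto
      with c[of "i - 1" "Suc j"] c[OF ij] True show ?thesis by simp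
    next
      case False
      with c[OF ij] ij show ?thesis by auto
    qed
    ultimately show "of_nat ((n - i) * Suc (N - j)) * (h i j - (if i < n \<and> 0 < j then h (Suc i) (j - 1) else 0))
     + of_nat (i * Suc j) * (h i j - (if 0 < i \<and> j < N then h (i - 1) (Suc j) else 0)) = 0"
      by auto
  qed
qed

section \<open>From Casimir eigenvectors to the harmonic equation\<close>

definition casimir_eq :: "nat \<Rightarrow> nat \<Rightarrow> complex \<Rightarrow> (nat \<Rightarrow> nat \<Rightarrow> complex) \<Rightarrow> bool" where
  "casimir_eq n N \<mu> f \<longleftrightarrow> (\<forall>i\<le>n. \<forall>j\<le>N.
     complex_of_real (casimir_coeff n N i j) * f i j
      + (if i < n \<and> 0 < j then raise_coeff n i * raise_coeff N (j - 1) * f (Suc i) (j - 1) else 0)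
      + (if 0 < i \<and> j < N then raise_coeff n (i - 1) * raise_coeff N j * f (i - 1) (Suc j) else 0)
     = \<mu> * f i j)"

lemma casimir_eq_swap: "casimir_eq n N \<mu> f \<longleftrightarrow> casimir_eq N n \<mu> (\<lambda>j i. f i j)"
proof -
  have c: "casimir_coeff n N i j = casimir_coeff N n j i" for i j
    by (simp add: casimir_coeff_def algebra_simps)
  have "(complex_of_real (casimir_coeff N n j i) * f i j
      + (if i < n \<and> 0 < j then raise_coeff n i * raise_coeff N (j - 1) * f (Suc i) (j - 1) else 0)
      + (if 0 < i \<and> j < N then raise_coeff n (i - 1) * raise_coeff N j * f (i - 1) (Suc j) else 0)
     = \<mu> * f i j) \<longleftrightarrow> (complex_of_real (casimir_coeff N n j i) * f i j
      + (if j < N \<and> 0 < i then raise_coeff N j * raise_coeff n (i - 1) * f (i - 1) (Suc j) else 0)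
      + (if 0 < j \<and> i < n then raise_coeff N (j - 1) * raise_coeff n i * f (Suc i) (j - 1) else 0)
     = \<mu> * f i j)" for i j
    by (simp only: conj_commute ac_simps)
  then show ?thesis unfolding casimir_eq_def c by blast
qed

text \<open>Binomial absorption under the square roots: in unnormalised monomials the ladder
  operators have integer coefficients.\<close>

lemma raise_coeff_sqrt_binom:
  assumes "i < n"
  shows "raise_coeff n i * complex_of_real (sqrt_binom n (Suc i)) = of_nat (n - i) * complex_of_real (sqrt_binom n i)"
    and "raise_coeff n i * complex_of_real (sqrt_binom n i) = of_nat (Suc i) * complex_of_real (sqrt_binom n (Suc i))"
proof -
  have b: "real (Suc i) * real (n choose Suc i) = real (n - i) * real (n choose i)"
    unfolding of_nat_mult[symmetric] by (simp only: binomial_absorption binomial_absorb_comp)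
  have d: "real n - real i = real (n - i)" using assms by simp
  have "sqrt (real (Suc i) * real (n - i)) * sqrt (real (n choose Suc i))
      = sqrt (real (n - i) * real (n - i) * real (n choose i))"
    unfolding real_sqrt_mult[symmetric] using b by (simp add: ac_simps)
  then have "sqrt (real (Suc i) * (real n - real i)) * sqrt_binom n (Suc i) = real (n - i) * sqrt_binom n i"
    unfolding d by (simp add: real_sqrt_mult sqrt_binom_def)
  then show "raise_coeff n i * complex_of_real (sqrt_binom n (Suc i)) = of_nat (n - i) * complex_of_real (sqrt_binom n i)"
    unfolding raise_coeff_def by (metis of_real_mult of_real_of_nat_eq)
  have "sqrt (real (Suc i) * real (n - i)) * sqrt (real (n choose i))
      = sqrt (real (Suc i) * real (Suc i) * real (n choose Suc i))"
    unfolding real_sqrt_mult[symmetric] using b by (simp add: ac_simps del: of_nat_Suc)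
  then have "sqrt (real (Suc i) * (real n - real i)) * sqrt_binom n i = real (Suc i) * sqrt_binom n (Suc i)"
    unfolding d by (simp add: real_sqrt_mult sqrt_binom_def del: of_nat_Suc)
  then show "raise_coeff n i * complex_of_real (sqrt_binom n i) = of_nat (Suc i) * complex_of_real (sqrt_binom n (Suc i))"
    unfolding raise_coeff_def by (metis of_real_mult of_real_of_nat_eq)
qed

definition singlet_ratio :: "nat \<Rightarrow> nat \<Rightarrow> nat \<Rightarrow> nat \<Rightarrow> complex" where
  "singlet_ratio n N i j = (- 1) ^ i * complex_of_real (sqrt_binom n i) / complex_of_real (sqrt_binom N j)"

lemma singlet_ratio_nonzero: "i \<le> n \<Longrightarrow> j \<le> N \<Longrightarrow> singlet_ratio n N i j \<noteq> 0"
  using sqrt_binom_pos[of i n] sqrt_binom_pos[of j N] by (simp add: singlet_ratio_def)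

text \<open>The alternating sign of the invariant makes the off-diagonal entries negative, as in a
  Laplacian; their sizes are the weights of \<open>harmonic_eq\<close>.\<close>

lemma singlet_ratio_up:
  assumes "i < n" "0 < j" "j \<le> N"
  shows "raise_coeff n i * raise_coeff N (j - 1) * singlet_ratio n N (Suc i) (j - 1)
    = - of_nat ((n - i) * Suc (N - j)) * singlet_ratio n N i j"
proof -
  obtain k where j: "j = Suc k" using assms by (cases j) auto
  have k: "k < N" "N - k = Suc (N - j)" using assms j by auto
  have nz: "complex_of_real (sqrt_binom N k) \<noteq> 0" "complex_of_real (sqrt_binom N (Suc k)) \<noteq> 0"
    using sqrt_binom_pos[of k N] sqrt_binom_pos[of "Suc k" N] k by auto
  have "raise_coeff N k / complex_of_real (sqrt_binom N k) = of_nat (N - k) / complex_of_real (sqrt_binom N (Suc k))"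
    using raise_coeff_sqrt_binom(1)[OF k(1)] nz by (simp add: field_simps)
  moreover have "raise_coeff n i * raise_coeff N (j - 1) * singlet_ratio n N (Suc i) (j - 1)
      = - ((- 1) ^ i * (raise_coeff n i * complex_of_real (sqrt_binom n (Suc i)))
        * (raise_coeff N k / complex_of_real (sqrt_binom N k)))"
    unfolding singlet_ratio_def j by simp
  ultimately have eq: "raise_coeff n i * raise_coeff N (j - 1) * singlet_ratio n N (Suc i) (j - 1)
      = - ((- 1) ^ i * (raise_coeff n i * complex_of_real (sqrt_binom n (Suc i)))
        * (of_nat (N - k) / complex_of_real (sqrt_binom N (Suc k))))" by (simp only:)
  have ring: "- (s * (A * p) * (B / q)) = - (A * B) * (s * p / q)" for s A p B q :: complex by simp
  show ?thesis
    unfolding eq raise_coeff_sqrt_binom(1)[OF assms(1)] k(2)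
    unfolding j singlet_ratio_def of_nat_mult by (rule ring)
qed

lemma singlet_ratio_down:
  assumes "0 < i" "i \<le> n" "j < N"
  shows "raise_coeff n (i - 1) * raise_coeff N j * singlet_ratio n N (i - 1) (Suc j)
    = - of_nat (i * Suc j) * singlet_ratio n N i j"
proof -
  obtain k where i: "i = Suc k" using assms by (cases i) auto
  have k: "k < n" using assms i by auto
  have nz: "complex_of_real (sqrt_binom N j) \<noteq> 0" "complex_of_real (sqrt_binom N (Suc j)) \<noteq> 0"
    using sqrt_binom_pos[of j N] sqrt_binom_pos[of "Suc j" N] assms by auto
  have "raise_coeff N j / complex_of_real (sqrt_binom N (Suc j)) = of_nat (Suc j) / complex_of_real (sqrt_binom N j)"
    using raise_coeff_sqrt_binom(2)[OF assms(3)] nz by (simp add: field_simps)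
  moreover have "raise_coeff n (i - 1) * raise_coeff N j * singlet_ratio n N (i - 1) (Suc j)
      = (- 1) ^ k * (raise_coeff n k * complex_of_real (sqrt_binom n k))
        * (raise_coeff N j / complex_of_real (sqrt_binom N (Suc j)))"
    unfolding singlet_ratio_def i by simp
  ultimately have eq: "raise_coeff n (i - 1) * raise_coeff N j * singlet_ratio n N (i - 1) (Suc j)
      = (- 1) ^ k * (raise_coeff n k * complex_of_real (sqrt_binom n k))
        * (of_nat (Suc j) / complex_of_real (sqrt_binom N j))" by (simp only:)
  have ring: "s * (A * p) * (B / q) = - (A * B) * (- 1 * s * p / q)" for s A p B q :: complex by simp
  show ?thesis
    unfolding eq raise_coeff_sqrt_binom(2)[OF k]
    unfolding i singlet_ratio_def of_nat_mult power_Suc by (rule ring)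
qed

text \<open>The diagonal of the Casimir operator exceeds the eigenvalue of the minimal spin exactly
  by the sum of the two off-diagonal weights, so the rescaled equation contains only
  differences.\<close>

lemma casimir_eq_harmonic:
  assumes "n \<le> N"
  defines "s \<equiv> \<bar>real N / 2 - real n / 2\<bar>"
  shows "casimir_eq n N (complex_of_real (s * (s + 1))) f
    \<longleftrightarrow> harmonic_eq n N (\<lambda>i j. f i j / singlet_ratio n N i j)"
proof -
  define h where "h i j = f i j / singlet_ratio n N i j" for i j
  have f: "f i j = singlet_ratio n N i j * h i j" if "i \<le> n" "j \<le> N" for i j
    using singlet_ratio_nonzero[OF that] by (simp add: h_def)
  have "(complex_of_real (casimir_coeff n N i j) * f i j
      + (if i < n \<and> 0 < j then raise_coeff n i * raise_coeff N (j - 1) * f (Suc i) (j - 1) else 0)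
      + (if 0 < i \<and> j < N then raise_coeff n (i - 1) * raise_coeff N j * f (i - 1) (Suc j) else 0)
     = complex_of_real (s * (s + 1)) * f i j)
    \<longleftrightarrow> of_nat ((n - i) * Suc (N - j)) * (h i j - (if i < n \<and> 0 < j then h (Suc i) (j - 1) else 0))
     + of_nat (i * Suc j) * (h i j - (if 0 < i \<and> j < N then h (i - 1) (Suc j) else 0)) = 0"
    (is "?a + ?b + ?c = ?d \<longleftrightarrow> ?e = 0") if ij: "i \<le> n" "j \<le> N" for i j
  proof -
    let ?r = "singlet_ratio n N i j"
    have "casimir_coeff n N i j - s * (s + 1) = real ((n - i) * Suc (N - j)) + real (i * Suc j)"
    proof -
      have s: "s = real N / 2 - real n / 2" using assms by (simp add: s_def)
      have r: "real ((n - i) * Suc (N - j)) = (real n - real i) * (real N - real j + 1)"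
        using ij unfolding of_nat_mult of_nat_Suc by (simp add: of_nat_diff)
      have "a / 2 * (a / 2 + 1) + b / 2 * (b / 2 + 1) + 2 * (a / 2 - x) * (b / 2 - y)
          - (b / 2 - a / 2) * (b / 2 - a / 2 + 1) = (a - x) * (b - y + 1) + x * (1 + y)" for a b x y :: real
        by (simp add: field_simps)
      then show ?thesis unfolding casimir_coeff_def r unfolding s of_nat_mult of_nat_Suc .
    qed
    from arg_cong[OF this, of complex_of_real]
    have "complex_of_real (casimir_coeff n N i j) - complex_of_real (s * (s + 1))
        = of_nat ((n - i) * Suc (N - j)) + of_nat (i * Suc j)"
      by (simp only: of_real_add of_real_diff of_real_of_nat_eq)
    then have ad: "?a - ?d = ?r * (of_nat ((n - i) * Suc (N - j)) + of_nat (i * Suc j)) * h i j"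
      unfolding f[OF ij] left_diff_distrib[symmetric] by (simp only: ac_simps)
    have b: "?b = - ?r * of_nat ((n - i) * Suc (N - j)) * (if i < n \<and> 0 < j then h (Suc i) (j - 1) else 0)"
    proof (cases "i < n \<and> 0 < j")
      case True
      then have "f (Suc i) (j - 1) = singlet_ratio n N (Suc i) (j - 1) * h (Suc i) (j - 1)"
        using ij by (intro f) auto
      with True have "?b = raise_coeff n i * raise_coeff N (j - 1) * singlet_ratio n N (Suc i) (j - 1) * h (Suc i) (j - 1)"
        by simp
      also have "\<dots> = - ?r * of_nat ((n - i) * Suc (N - j)) * h (Suc i) (j - 1)"
        using True ij singlet_ratio_up[of i n j N] by (simp only: simp_thms mult_minus_left mult_minus_right ac_simps)
      finally show ?thesis using True by simp
    qed auto
    have c: "?c = - ?r * of_nat (i * Suc j) * (if 0 < i \<and> j < N then h (i - 1) (Suc j) else 0)"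
    proof (cases "0 < i \<and> j < N")
      case True
      then have "f (i - 1) (Suc j) = singlet_ratio n N (i - 1) (Suc j) * h (i - 1) (Suc j)"
        using ij by (intro f) auto
      with True have "?c = raise_coeff n (i - 1) * raise_coeff N j * singlet_ratio n N (i - 1) (Suc j) * h (i - 1) (Suc j)"
        by simp
      also have "\<dots> = - ?r * of_nat (i * Suc j) * h (i - 1) (Suc j)"
        using True ij singlet_ratio_down[of i n j N] by (simp only: simp_thms mult_minus_left mult_minus_right ac_simps)
      finally show ?thesis using True by simp
    qed auto
    have ring: "r * (x + y) * h + - r * x * u + - r * y * w = r * (x * (h - u) + y * (h - w))"
      for r x y h u w :: complex by (simp add: algebra_simps)
    have "?a + ?b + ?c - ?d = (?a - ?d) + ?b + ?c" by simp
    also have "\<dots> = ?r * ?e" unfolding ad b c by (rule ring)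
    finally have "?a + ?b + ?c - ?d = ?r * ?e" .
    moreover have "x = y \<longleftrightarrow> e = 0" if "x - y = r * e" "r \<noteq> 0" for x y r e :: complex
      using that by auto
    ultimately show ?thesis using singlet_ratio_nonzero[OF ij] by blast
  qed
  then show ?thesis unfolding casimir_eq_def harmonic_eq_def h_def by auto
qed

lemma total_spin_space_casimir_eq:
  "v \<in> total_spin_space (real n / 2) (real N / 2) s \<longleftrightarrow>
    v \<in> carrier_vec (Suc n * Suc N)
    \<and> casimir_eq n N (complex_of_real (s * (s + 1))) (\<lambda>i j. v $ pair_index (Suc N) i j)"
proof (cases "v \<in> carrier_vec (Suc n * Suc N)")
  case True
  let ?C = "total_casimir (real n / 2) (real N / 2)" and ?\<mu> = "complex_of_real (s * (s + 1))"
  have d: "dim_row ?C = Suc n * Suc N" using total_casimir_carrier[of n N] by auto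
  have "?C *\<^sub>v v = ?\<mu> \<cdot>\<^sub>v v \<longleftrightarrow> (\<forall>i\<le>n. \<forall>j\<le>N.
      (?C *\<^sub>v v) $ pair_index (Suc N) i j = ?\<mu> * v $ pair_index (Suc N) i j)" (is "?l \<longleftrightarrow> ?r")
  proof
    assume l: ?l
    show ?r
    proof (intro allI impI)
      fix i j assume "i \<le> n" "j \<le> N"
      then have "pair_index (Suc N) i j < Suc n * Suc N" by (intro pair_index_less) auto
      then show "(?C *\<^sub>v v) $ pair_index (Suc N) i j = ?\<mu> * v $ pair_index (Suc N) i j"
        unfolding l using True by (simp del: mult_Suc mult_Suc_right)
    qed
  next
    assume r: ?r
    show ?l
    proof (rule eq_vecI)
      fix x assume "x < dim_vec (?\<mu> \<cdot>\<^sub>v v)"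
      then have x: "x < Suc n * Suc N" using True by simp
      from pair_indexE[OF x] obtain i j where ij: "i < Suc n" "j < Suc N" "x = pair_index (Suc N) i j" .
      then have "(?C *\<^sub>v v) $ x = ?\<mu> * v $ x" using r[rule_format, of i j] by (simp only: less_Suc_eq_le)
      also have "\<dots> = (?\<mu> \<cdot>\<^sub>v v) $ x" using x True by (simp del: mult_Suc mult_Suc_right)
      finally show "(?C *\<^sub>v v) $ x = (?\<mu> \<cdot>\<^sub>v v) $ x" .
    qed (use True d in \<open>simp_all del: mult_Suc mult_Suc_right\<close>)
  qed
  also have "\<dots> \<longleftrightarrow> casimir_eq n N ?\<mu> (\<lambda>i j. v $ pair_index (Suc N) i j)"
    unfolding casimir_eq_def
    by (simp only: total_casimir_mult_vec[OF True] cong: imp_cong)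
  finally show ?thesis
    unfolding total_spin_space_def spin_dim_half mem_Collect_eq by (simp only: True simp_thms)
next
  case False
  then show ?thesis unfolding total_spin_space_def spin_dim_half mem_Collect_eq by (simp only: simp_thms)
qed

section \<open>The projection onto the minimal spin\<close>

text \<open>A coefficient of the product of the power series of \<open>(1 - x)^(- p - 1)\<close> and
  \<open>(1 - x)^(- q - 1)\<close>; the proof is Vandermonde's identity for negative upper
  arguments.\<close>

lemma choose_convolution:
  "(\<Sum>i\<le>n. (i + p choose p) * (n - i + q choose q)) = (n + p + q + 1 choose n)"
proof -
  have c: "(of_nat (i + p choose p) :: real) = (- 1) ^ i * ((- of_nat (Suc p)) gchoose i)" for i p
  proof -
    have "i + p choose p = i + p choose i" using binomial_symmetric[of p "i + p"] by simp
    then have "(of_nat (i + p choose p) :: real) = of_nat (i + p) gchoose i"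
      by (simp only: binomial_gbinomial)
    also have "\<dots> = (- 1) ^ i * ((- 1) ^ i * ((of_nat (Suc p) + of_nat i - 1) gchoose i))"
    proof -
      have "(- 1) ^ i * ((- 1) ^ i * x) = x" for x :: real by (cases "even i") auto
      then show ?thesis by (simp add: add.commute)
    qed
    finally show ?thesis unfolding gbinomial_minus .
  qed
  have "real (\<Sum>i\<le>n. (i + p choose p) * (n - i + q choose q))
      = (\<Sum>i\<le>n. (- 1) ^ n * (((- of_nat (Suc p)) gchoose i) * ((- of_nat (Suc q)) gchoose (n - i))))"
    unfolding of_nat_sum of_nat_mult c
  proof (intro sum.cong refl)
    fix i assume "i \<in> {..n}"
    then have sign: "(- 1) ^ i * (- 1) ^ (n - i) = ((- 1) ^ n :: real)" by (simp flip: power_add)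
    have ring: "s * a * (t * b) = (s * t) * (a * b)" for s t a b :: real by simp
    show "(- 1) ^ i * (- real (Suc p) gchoose i) * ((- 1) ^ (n - i) * (- real (Suc q) gchoose (n - i)))
        = (- 1) ^ n * ((- real (Suc p) gchoose i) * (- real (Suc q) gchoose (n - i)))"
      by (subst ring) (simp only: sign)
  qed
  also have "\<dots> = (- 1) ^ n * ((- of_nat (Suc p) + - of_nat (Suc q)) gchoose n)"
    unfolding sum_distrib_left[symmetric] gbinomial_Vandermonde[symmetric] atMost_atLeast0 ..
  also have "- of_nat (Suc p) + - of_nat (Suc q) = (- of_nat (Suc (p + q + 1)) :: real)" by simp
  also have "(- 1) ^ n * (- of_nat (Suc (p + q + 1)) gchoose n) = real (n + (p + q + 1) choose (p + q + 1))"
    by (rule c[symmetric])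
  also have "n + (p + q + 1) choose (p + q + 1) = n + p + q + 1 choose n"
    using binomial_symmetric[of n "n + p + q + 1"] by (simp add: ac_simps)
  finally show ?thesis by (simp only: of_nat_eq_iff)
qed

text \<open>The partial trace of the coupling projection over spin \<open>n / 2\<close> is a
  multiple of the identity by a ratio of dimensions, and the sum is its entry at \<open>l\<close>. A
  four-block splitting turns the terms into those of \<open>choose_convolution\<close>.\<close>

lemma sum_choose_ratio:
  assumes "l \<le> m"
  shows "(\<Sum>i\<le>n. real (n choose i) * real (m choose l) / real (n + m choose (i + l)))
    = (real (n + m) + 1) / (real m + 1)"
proof -
  have "real (n choose i) * real (m choose l) / real (n + m choose (i + l))
      = real ((i + l choose l) * (n - i + (m - l) choose (m - l))) / real (n + m choose m)" if "i \<le> n" for i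
  proof -
    have "(n + m choose (l + i)) * (l + i choose l) * ((m - l) + (n - i) choose (m - l))
        = (n + m choose m) * (m choose l) * (n choose i)"
    proof -
      have e: "l + (m - l) = m" "i + (n - i) = n" "m + i + (n - i) = n + m" using assms that by auto
      show ?thesis using choose_product_exchange[of l "m - l" i "n - i", unfolded e] by simp
    qed
    then have "real (n + m choose (i + l)) * (real (i + l choose l) * real (n - i + (m - l) choose (m - l)))
        = real (n + m choose m) * (real (m choose l) * real (n choose i))"
      unfolding of_nat_mult[symmetric] of_nat_eq_iff by (simp only: ac_simps)
    moreover have "real (n + m choose (i + l)) > 0" "real (n + m choose m) > 0" using assms that by auto
    ultimately show ?thesis by (simp add: field_simps)
  qed
  then have "(\<Sum>i\<le>n. real (n choose i) * real (m choose l) / real (n + m choose (i + l)))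
      = (\<Sum>i\<le>n. real ((i + l choose l) * (n - i + (m - l) choose (m - l))) / real (n + m choose m))"
    by (intro sum.cong) auto
  also have "\<dots> = real (n + l + (m - l) + 1 choose n) / real (n + m choose m)"
    unfolding choose_convolution[symmetric] by (simp add: sum_divide_distrib)
  also have "n + l + (m - l) + 1 = Suc (n + m)" using assms by simp
  also have "Suc (n + m) choose n = Suc (n + m) choose Suc m"
    using binomial_symmetric[of n "Suc (n + m)"] by simp
  also have "real (Suc (n + m) choose Suc m) / real (n + m choose m) = (real (n + m) + 1) / (real m + 1)"
  proof -
    have "real (Suc m) * real (Suc (n + m) choose Suc m) = real (Suc (n + m)) * real (n + m choose m)"
      using Suc_times_binomial[of m "n + m"] by (metis of_nat_mult)
    moreover have "real (n + m choose m) > 0" by simp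
    ultimately show ?thesis by (simp add: field_simps)
  qed
  finally show ?thesis .
qed

text \<open>
  The component at \<open>e\<^sub>i \<otimes> e\<^sub>j\<close> of the \<open>l\<close>-th vector of an orthonormal basis of the minimal spin
  subspace: the coefficients of \<open>(x\<^sub>1 y\<^sub>2 - x\<^sub>2 y\<^sub>1)\<^sup>n y\<^sub>1\<^sup>m\<^sup>-\<^sup>l y\<^sub>2\<^sup>l\<close>, with \<open>m = N - n\<close>, in
  orthonormal monomials.
\<close>

definition min_vec_le :: "nat \<Rightarrow> nat \<Rightarrow> nat \<Rightarrow> nat \<Rightarrow> nat \<Rightarrow> real" where
  "min_vec_le n N l i j = (if i + j = n + l then
     (- 1) ^ i * (sqrt ((real (N - n) + 1) / (real N + 1)) * sqrt_binom (N - n) l) * sqrt_binom n i / sqrt_binom N j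
     else 0)"

definition min_vec :: "nat \<Rightarrow> nat \<Rightarrow> nat \<Rightarrow> nat \<Rightarrow> nat \<Rightarrow> real" where
  "min_vec n N l i j = (if n \<le> N then min_vec_le n N l i j else min_vec_le N n l j i)"

text \<open>Twice the minimal spin, one less than the dimension of its subspace.\<close>

definition min_dim :: "nat \<Rightarrow> nat \<Rightarrow> nat" where
  "min_dim n N = (if n \<le> N then N - n else n - N)"

lemma min_vec_le_sq:
  "min_vec_le n N l i j * min_vec_le n N l' i j = (if i + j = n + l \<and> l' = l then
     (real (N - n) + 1) / (real N + 1) * (real (n choose i) * real (N - n choose l) / real (N choose j)) else 0)"
proof (cases "i + j = n + l \<and> l' = l")
  case True
  have 1: "(- 1) ^ i * (- 1) ^ i = (1 :: real)" by (simp flip: power_add)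
  have 2: "sqrt ((real (N - n) + 1) / (real N + 1)) * sqrt ((real (N - n) + 1) / (real N + 1))
      = (real (N - n) + 1) / (real N + 1)" by simp
  have ring: "(s * (q * b) * a / x) * (s * (q * b) * a / x) = (s * s) * (q * q) * ((a * a) * (b * b) / (x * x))"
    for s q a b x :: real by simp
  have "min_vec_le n N l i j * min_vec_le n N l' i j
      = ((- 1) ^ i * (- 1) ^ i) * (sqrt ((real (N - n) + 1) / (real N + 1)) * sqrt ((real (N - n) + 1) / (real N + 1)))
       * ((sqrt_binom n i * sqrt_binom n i) * (sqrt_binom (N - n) l * sqrt_binom (N - n) l) / (sqrt_binom N j * sqrt_binom N j))"
    using True unfolding min_vec_le_def by (simp only: simp_thms if_True ring)
  with True show ?thesis unfolding 1 2 by simp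
qed (auto simp: min_vec_le_def)

text \<open>Different \<open>l\<close> live on different antidiagonals; the norm is given by
  \<open>sum_choose_ratio\<close> after reversing \<open>i\<close>.\<close>

lemma min_vec_le_orthonormal:
  assumes nN: "n \<le> N" and l: "l \<le> N - n" "l' \<le> N - n"
  shows "(\<Sum>i\<le>n. \<Sum>j\<le>N. min_vec_le n N l i j * min_vec_le n N l' i j) = (if l = l' then 1 else 0)"
proof (cases "l' = l")
  case True
  define c where "c = (real (N - n) + 1) / (real N + 1)"
  have "(\<Sum>i\<le>n. \<Sum>j\<le>N. min_vec_le n N l i j * min_vec_le n N l' i j)
      = (\<Sum>i\<le>n. c * (real (n choose i) * real (N - n choose l) / real (N choose (n - i + l))))"
  proof (intro sum.cong refl)
    fix i assume i: "i \<in> {..n}"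
    have "(\<Sum>j\<le>N. min_vec_le n N l i j * min_vec_le n N l' i j)
      = (\<Sum>j\<le>N. if j = n - i + l then c * (real (n choose i) * real (N - n choose l) / real (N choose (n - i + l))) else 0)"
      using i True unfolding min_vec_le_sq by (intro sum.cong) (auto simp: c_def)
    also have "\<dots> = c * (real (n choose i) * real (N - n choose l) / real (N choose (n - i + l)))"
    proof -
      have "n - i + l \<in> {..N}" using l nN by auto
      then show ?thesis by (subst sum.delta) auto
    qed
    finally show "(\<Sum>j\<le>N. min_vec_le n N l i j * min_vec_le n N l' i j)
      = c * (real (n choose i) * real (N - n choose l) / real (N choose (n - i + l)))" .
  qed
  also have "\<dots> = c * (\<Sum>i\<le>n. real (n choose i) * real (N - n choose l) / real (n + (N - n) choose (n - i + l)))"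
    using nN by (simp add: sum_distrib_left)
  also have "(\<Sum>i\<le>n. real (n choose i) * real (N - n choose l) / real (n + (N - n) choose (n - i + l)))
      = (\<Sum>i\<le>n. real (n choose i) * real (N - n choose l) / real (n + (N - n) choose (i + l)))"
    by (rule sum.reindex_bij_witness[of _ "\<lambda>i. n - i" "\<lambda>i. n - i"]) (auto simp: binomial_symmetric[symmetric])
  also have "\<dots> = (real N + 1) / (real (N - n) + 1)"
    unfolding sum_choose_ratio[OF l(1)] using nN by simp
  also have "c * \<dots> = 1" by (simp add: c_def add_eq_0_iff_both_eq_0)
  finally show ?thesis using True by simp
next
  case False
  then show ?thesis unfolding min_vec_le_sq by simp
qed

lemma min_vec_orthonormal:
  assumes "l \<le> min_dim n N" "l' \<le> min_dim n N"
  shows "(\<Sum>i\<le>n. \<Sum>j\<le>N. min_vec n N l i j * min_vec n N l' i j) = (if l = l' then 1 else 0)"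
proof (cases "n \<le> N")
  case True
  with assms min_vec_le_orthonormal[OF True] show ?thesis by (simp add: min_vec_def min_dim_def)
next
  case False
  have "(\<Sum>i\<le>n. \<Sum>j\<le>N. min_vec n N l i j * min_vec n N l' i j)
      = (\<Sum>j\<le>N. \<Sum>i\<le>n. min_vec_le N n l j i * min_vec_le N n l' j i)"
    using False by (subst sum.swap) (simp add: min_vec_def)
  also have "\<dots> = (if l = l' then 1 else 0)"
    using False assms by (intro min_vec_le_orthonormal) (auto simp: min_dim_def)
  finally show ?thesis .
qed

text \<open>On the antidiagonal \<open>i + j = n + l\<close> only the basis vector with index
  \<open>l\<close> is non-zero, so the free constants of \<open>harmonic_eq_iff\<close> and the
  coefficients differ by the factors \<open>w l\<close>.\<close>

lemma casimir_eq_span_le: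
  fixes n N :: nat
  assumes nN: "n \<le> N"
  defines "s \<equiv> \<bar>real N / 2 - real n / 2\<bar>"
  shows "casimir_eq n N (complex_of_real (s * (s + 1))) f \<longleftrightarrow>
    (\<exists>c. \<forall>i\<le>n. \<forall>j\<le>N. f i j = (\<Sum>l\<le>N - n. c l * complex_of_real (min_vec_le n N l i j)))"
proof -
  define w where "w l = complex_of_real (sqrt ((real (N - n) + 1) / (real N + 1)) * sqrt_binom (N - n) l)" for l
  have w: "w l \<noteq> 0" if "l \<le> N - n" for l
    using sqrt_binom_pos[OF that] by (simp add: w_def add_eq_0_iff_both_eq_0)
  have sum: "(\<Sum>l\<le>N - n. c l * complex_of_real (min_vec_le n N l i j))
      = singlet_ratio n N i j * (if n \<le> i + j \<and> i + j \<le> N then c (i + j - n) * w (i + j - n) else 0)"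
    for c i j
  proof -
    have "(\<Sum>l\<le>N - n. c l * complex_of_real (min_vec_le n N l i j))
      = (\<Sum>l\<le>N - n. if l = i + j - n then (if n \<le> i + j then singlet_ratio n N i j * (c l * w l) else 0) else 0)"
      by (intro sum.cong refl) (auto simp: min_vec_le_def w_def singlet_ratio_def)
    then show ?thesis using nN by (auto simp: not_le)
  qed
  have "casimir_eq n N (complex_of_real (s * (s + 1))) f \<longleftrightarrow>
    (\<exists>c. \<forall>i\<le>n. \<forall>j\<le>N. f i j / singlet_ratio n N i j = (if n \<le> i + j \<and> i + j \<le> N then c (i + j) else 0))"
    unfolding s_def casimir_eq_harmonic[OF nN] harmonic_eq_iff[OF nN] ..
  also have "\<dots> \<longleftrightarrow> (\<exists>c. \<forall>i\<le>n. \<forall>j\<le>N. f i j = (\<Sum>l\<le>N - n. c l * complex_of_real (min_vec_le n N l i j)))"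
    (is "?l \<longleftrightarrow> ?r")
  proof
    assume ?l
    then obtain c where c: "\<And>i j. i \<le> n \<Longrightarrow> j \<le> N \<Longrightarrow>
        f i j / singlet_ratio n N i j = (if n \<le> i + j \<and> i + j \<le> N then c (i + j) else 0)" by blast
    have "f i j = (\<Sum>l\<le>N - n. c (n + l) / w l * complex_of_real (min_vec_le n N l i j))"
      if ij: "i \<le> n" "j \<le> N" for i j
    proof -
      have "f i j = singlet_ratio n N i j * (f i j / singlet_ratio n N i j)"
        using singlet_ratio_nonzero[OF ij] by simp
      also have "\<dots> = (\<Sum>l\<le>N - n. c (n + l) / w l * complex_of_real (min_vec_le n N l i j))"
      proof (cases "n \<le> i + j \<and> i + j \<le> N")
        case True
        then have "w (i + j - n) \<noteq> 0" by (intro w) auto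
        with True show ?thesis unfolding c[OF ij] sum by simp
      next
        case False
        then show ?thesis unfolding c[OF ij] sum by (simp only: if_False)
      qed
      finally show ?thesis .
    qed
    then show ?r by (intro exI[of _ "\<lambda>l. c (n + l) / w l"]) blast
  next
    assume ?r
    then obtain c where c: "\<And>i j. i \<le> n \<Longrightarrow> j \<le> N \<Longrightarrow>
        f i j = (\<Sum>l\<le>N - n. c l * complex_of_real (min_vec_le n N l i j))" by blast
    have "f i j / singlet_ratio n N i j = (if n \<le> i + j \<and> i + j \<le> N then c (i + j - n) * w (i + j - n) else 0)"
      if ij: "i \<le> n" "j \<le> N" for i j
      unfolding c[OF ij] sum using singlet_ratio_nonzero[OF ij] by simp
    then show ?l by (intro exI[of _ "\<lambda>x. c (x - n) * w (x - n)"]) blast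
  qed
  finally show ?thesis .
qed

lemma casimir_eq_span:
  fixes n N :: nat
  defines "s \<equiv> \<bar>real N / 2 - real n / 2\<bar>"
  shows "casimir_eq n N (complex_of_real (s * (s + 1))) f \<longleftrightarrow>
    (\<exists>c. \<forall>i\<le>n. \<forall>j\<le>N. f i j = (\<Sum>l\<le>min_dim n N. c l * complex_of_real (min_vec n N l i j)))"
proof (cases "n \<le> N")
  case True
  then show ?thesis unfolding s_def casimir_eq_span_le[OF True] by (simp add: min_dim_def min_vec_def)
next
  case False
  then have "N \<le> n" by simp
  have s: "s = \<bar>real n / 2 - real N / 2\<bar>" by (simp add: s_def)
  have swap: "(\<forall>j\<le>N. \<forall>i\<le>n. Q i j) \<longleftrightarrow> (\<forall>i\<le>n. \<forall>j\<le>N. Q i j)" for Q :: "nat \<Rightarrow> nat \<Rightarrow> bool"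
    by blast
  show ?thesis
    unfolding casimir_eq_swap[of n N] s casimir_eq_span_le[OF \<open>N \<le> n\<close>] using False
    by (simp only: min_dim_def min_vec_def if_False swap)
qed

section \<open>Orthogonal projections and the explicit form of \<open>P_minus\<close>\<close>

lemma mat_unit_vec_col:
  fixes A :: "complex mat"
  assumes "A \<in> carrier_mat n m" "j < m"
  shows "A *\<^sub>v unit_vec m j = col A j"
proof (rule eq_vecI)
  fix i assume "i < dim_vec (col A j)"
  then have i: "i < n" "i < dim_row A" using assms by auto
  have "row A i \<in> carrier_vec m" using assms by auto
  then show "(A *\<^sub>v unit_vec m j) $ i = col A j $ i"
    using assms i by simp
qed simp

text \<open>Equal ranges give \<open>Q * P = P\<close> and \<open>P * Q = Q\<close>; taking the
  adjoint of the first yields \<open>P = P * Q = Q\<close>.\<close>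

lemma orth_proj_unique:
  assumes "is_orth_proj d S P" "is_orth_proj d S Q"
  shows "P = Q"
proof -
  have le: "Q * P = P" if "is_orth_proj d S P" "is_orth_proj d S Q" for P Q
  proof -
    from that have P: "P \<in> carrier_mat d d" "(\<lambda>v. P *\<^sub>v v) ` carrier_vec d = S"
      and Q: "Q \<in> carrier_mat d d" "Q * Q = Q" "(\<lambda>v. Q *\<^sub>v v) ` carrier_vec d = S"
      by (auto simp: is_orth_proj_def)
    have "col (Q * P) j = col P j" if j: "j < d" for j
    proof -
      have "col P j = P *\<^sub>v unit_vec d j" by (rule mat_unit_vec_col[OF P(1) j, symmetric])
      also have "\<dots> \<in> S" unfolding P(2)[symmetric] by (rule imageI) simp
      finally obtain u where u: "u \<in> carrier_vec d" "col P j = Q *\<^sub>v u" unfolding Q(3)[symmetric] by auto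
      have "col (Q * P) j = Q *\<^sub>v (Q *\<^sub>v u)" unfolding u(2)[symmetric] by (rule col_mult2[OF Q(1) P(1) j])
      also have "\<dots> = (Q * Q) *\<^sub>v u" using Q(1) u(1) by simp
      finally show ?thesis using Q(2) u by simp
    qed
    then show ?thesis using P(1) Q(1) by (intro mat_col_eqI) auto
  qed
  from assms have adj: "mat_adjoint P = P" "mat_adjoint Q = Q" and c: "P \<in> carrier_mat d d" "Q \<in> carrier_mat d d"
    by (auto simp: is_orth_proj_def)
  have "P = mat_adjoint (Q * P)" by (simp only: le[OF assms] adj)
  also have "\<dots> = mat_adjoint P * mat_adjoint Q" by (rule mat_adjoint_mult) (use c in auto)
  also have "\<dots> = Q" unfolding adj by (rule le[OF assms(2,1)])
  finally show ?thesis .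
qed

lemma frame_orth_proj:
  assumes fr: "frame d r V"
    and S: "\<And>v. v \<in> S \<longleftrightarrow> v \<in> carrier_vec d \<and> (\<exists>c. \<forall>x<d. v $ x = (\<Sum>l<r. c l * V l x))"
  shows "is_orth_proj d S (mat d d (\<lambda>(x, y). \<Sum>l<r. V l x * cnj (V l y)))" (is "is_orth_proj d S ?P")
proof -
  have proj: "(?P *\<^sub>v v) $ x = (\<Sum>l<r. inner_sum d (\<lambda>y. v $ y) (V l) * V l x)"
    if "v \<in> carrier_vec d" "x < d" for v x
  proof -
    have "(?P *\<^sub>v v) $ x = (\<Sum>y<d. \<Sum>l<r. V l x * cnj (V l y) * v $ y)"
      using that by (simp add: mult_mat_vec_entry sum_distrib_right del: index_mult_mat_vec)
    also have "\<dots> = (\<Sum>l<r. \<Sum>y<d. V l x * cnj (V l y) * v $ y)" by (rule sum.swap)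
    finally show ?thesis by (simp add: inner_sum_def sum_distrib_left sum_distrib_right ac_simps)
  qed
  have id: "?P *\<^sub>v v = v" if "v \<in> S" for v
  proof -
    from that S obtain c where v: "v \<in> carrier_vec d" and c: "\<And>x. x < d \<Longrightarrow> v $ x = (\<Sum>l<r. c l * V l x)"
      by blast
    have "inner_sum d (\<lambda>y. v $ y) (V l) = c l" if "l < r" for l
    proof -
      have "inner_sum d (\<lambda>y. v $ y) (V l) = inner_sum d (\<lambda>x. \<Sum>l<r. c l * V l x) (V l)"
        by (rule inner_sum_cong) (simp_all add: c)
      then show ?thesis using inner_sum_frame_expansion[OF fr that] by simp
    qed
    then show ?thesis using v by (intro eq_vecI) (simp_all add: proj c del: index_mult_mat_vec)
  qed
  have in_S: "?P *\<^sub>v v \<in> S" if "v \<in> carrier_vec d" for v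
    unfolding S using proj[OF that]
    by (intro conjI exI allI impI mult_mat_vec_carrier[OF _ that]) simp_all
  have "?P * ?P = ?P"
  proof (rule mat_col_eqI)
    fix j assume "j < dim_col ?P"
    then have j: "j < d" by simp
    have "?P *\<^sub>v unit_vec d j = col ?P j" by (rule mat_unit_vec_col[OF mat_carrier j])
    then have "col ?P j \<in> S" using in_S[of "unit_vec d j"] by (simp only: unit_vec_carrier)
    then show "col (?P * ?P) j = col ?P j"
      unfolding col_mult2[OF mat_carrier mat_carrier j] by (rule id)
  qed auto
  moreover have "mat_adjoint ?P = ?P" by (rule eq_matI) (auto simp: mult.commute)
  moreover have "(\<lambda>v. ?P *\<^sub>v v) ` carrier_vec d = S"
  proof (intro equalityI subsetI)
    fix v assume "v \<in> S"
    then have "v \<in> carrier_vec d" using S by blast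
    then show "v \<in> (\<lambda>v. ?P *\<^sub>v v) ` carrier_vec d"
      by (intro image_eqI[where x = v]) (simp_all only: id[OF \<open>v \<in> S\<close>])
  qed (use in_S in auto)
  ultimately show ?thesis by (simp add: is_orth_proj_def)
qed

text \<open>Resolves the definite description in \<open>P_minus\<close>: the projection built from
  the vectors \<open>min_vec\<close> satisfies it, and \<open>orth_proj_unique\<close> excludes any
  other.\<close>

lemma P_minus_orth_proj:
  shows "is_orth_proj (Suc n * Suc N) (total_spin_space (real n / 2) (real N / 2) \<bar>real N / 2 - real n / 2\<bar>)
      (P_minus (real n / 2) (real N / 2))" (is ?A)
    and "i \<le> n \<Longrightarrow> j \<le> N \<Longrightarrow> i' \<le> n \<Longrightarrow> j' \<le> N \<Longrightarrow>
      P_minus (real n / 2) (real N / 2) $$ (pair_index (Suc N) i j, pair_index (Suc N) i' j')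
        = complex_of_real (\<Sum>l\<le>min_dim n N. min_vec n N l i j * min_vec n N l i' j')"
proof -
  let ?D = "Suc n * Suc N" and ?S = "total_spin_space (real n / 2) (real N / 2) \<bar>real N / 2 - real n / 2\<bar>"
  define V where "V l x = complex_of_real (min_vec n N l (x div Suc N) (x mod Suc N))" for l x
  have V: "V l (pair_index (Suc N) i j) = complex_of_real (min_vec n N l i j)" if "j \<le> N" for l i j
    using that unfolding V_def by (simp only: pair_index_div pair_index_mod less_Suc_eq_le)
  have fr: "frame ?D (Suc (min_dim n N)) V"
    unfolding frame_def sum_pair_index
  proof (intro allI impI)
    fix l l' assume "l < Suc (min_dim n N)" "l' < Suc (min_dim n N)"
    then have l: "l \<le> min_dim n N" "l' \<le> min_dim n N" by auto
    have "(\<Sum>i<Suc n. \<Sum>j<Suc N. V l (pair_index (Suc N) i j) * cnj (V l' (pair_index (Suc N) i j)))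
      = complex_of_real (\<Sum>i\<le>n. \<Sum>j\<le>N. min_vec n N l i j * min_vec n N l' i j)"
      unfolding lessThan_Suc_atMost by (simp add: V)
    then show "(\<Sum>i<Suc n. \<Sum>j<Suc N. V l (pair_index (Suc N) i j) * cnj (V l' (pair_index (Suc N) i j)))
      = (if l = l' then 1 else 0)" unfolding min_vec_orthonormal[OF l] by simp
  qed
  have S: "v \<in> ?S \<longleftrightarrow> v \<in> carrier_vec ?D \<and> (\<exists>c. \<forall>x<?D. v $ x = (\<Sum>l<Suc (min_dim n N). c l * V l x))" for v
  proof -
    have "(\<forall>x<?D. v $ x = (\<Sum>l<Suc (min_dim n N). c l * V l x))
      \<longleftrightarrow> (\<forall>i\<le>n. \<forall>j\<le>N. v $ pair_index (Suc N) i j = (\<Sum>l\<le>min_dim n N. c l * complex_of_real (min_vec n N l i j)))" for c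
    proof (intro iffI allI impI)
      fix i j assume *: "\<forall>x<?D. v $ x = (\<Sum>l<Suc (min_dim n N). c l * V l x)" and ij: "i \<le> n" "j \<le> N"
      have "pair_index (Suc N) i j < ?D" using ij by (intro pair_index_less) auto
      with * have "v $ pair_index (Suc N) i j = (\<Sum>l<Suc (min_dim n N). c l * V l (pair_index (Suc N) i j))" by blast
      then show "v $ pair_index (Suc N) i j = (\<Sum>l\<le>min_dim n N. c l * complex_of_real (min_vec n N l i j))"
        unfolding V[OF ij(2)] lessThan_Suc_atMost .
    next
      fix x assume *: "\<forall>i\<le>n. \<forall>j\<le>N. v $ pair_index (Suc N) i j = (\<Sum>l\<le>min_dim n N. c l * complex_of_real (min_vec n N l i j))"
        and x: "x < ?D"
      from pair_indexE[OF x] obtain i j where ij: "i < Suc n" "j < Suc N" "x = pair_index (Suc N) i j" .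
      then show "v $ x = (\<Sum>l<Suc (min_dim n N). c l * V l x)"
        using * V[of j] unfolding ij(3) lessThan_Suc_atMost less_Suc_eq_le by simp
    qed
    then show ?thesis unfolding total_spin_space_casimir_eq casimir_eq_span by simp
  qed
  note P = frame_orth_proj[OF fr S]
  have eq: "P_minus (real n / 2) (real N / 2)
      = mat ?D ?D (\<lambda>(x, y). \<Sum>l<Suc (min_dim n N). V l x * cnj (V l y))"
    unfolding P_minus_def spin_dim_half
  proof (rule the_equality)
    show "is_orth_proj ?D ?S (mat ?D ?D (\<lambda>(x, y). \<Sum>l<Suc (min_dim n N). V l x * cnj (V l y)))" by (rule P)
    then show "Q = mat ?D ?D (\<lambda>(x, y). \<Sum>l<Suc (min_dim n N). V l x * cnj (V l y))" if "is_orth_proj ?D ?S Q" for Q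
      by (rule orth_proj_unique[OF that])
  qed
  show ?A unfolding eq by (rule P)
  assume ij: "i \<le> n" "j \<le> N" "i' \<le> n" "j' \<le> N"
  then have "pair_index (Suc N) i j < ?D" "pair_index (Suc N) i' j' < ?D" by (intro pair_index_less; simp)+
  then show "P_minus (real n / 2) (real N / 2) $$ (pair_index (Suc N) i j, pair_index (Suc N) i' j')
        = complex_of_real (\<Sum>l\<le>min_dim n N. min_vec n N l i j * min_vec n N l i' j')"
    unfolding eq using ij by (simp add: V lessThan_Suc_atMost del: mult_Suc mult_Suc_right sum.lessThan_Suc)
qed

section \<open>Rotations on boson Fock space\<close>

lemma add_mult_distrib_mat_dim:
  fixes A :: "'a :: semiring_0 mat"
  shows "dim_row A = dim_row B \<Longrightarrow> dim_col A = dim_col B \<Longrightarrow> dim_col B = dim_row C \<Longrightarrow> (A + B) * C = A * C + B * C"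
  by (rule add_mult_distrib_mat[of _ "dim_row B" "dim_col B" _ _ "dim_col C"]) auto

lemma mult_add_distrib_mat_dim:
  fixes A :: "'a :: semiring_0 mat"
  shows "dim_row B = dim_row C \<Longrightarrow> dim_col B = dim_col C \<Longrightarrow> dim_col A = dim_row C \<Longrightarrow> A * (B + C) = A * B + A * C"
  by (rule mult_add_distrib_mat[of _ "dim_row A" "dim_col A" _ "dim_col C"]) auto

lemma smult_mult_mat_dim:
  fixes A :: "'a :: comm_semiring_0 mat"
  shows "dim_col A = dim_row B \<Longrightarrow> (k \<cdot>\<^sub>m A) * B = k \<cdot>\<^sub>m (A * B)"
    and "dim_col A = dim_row B \<Longrightarrow> A * (k \<cdot>\<^sub>m B) = k \<cdot>\<^sub>m (A * B)"
  by (rule mult_smult_assoc_mat[of _ "dim_row A" "dim_col A" _ "dim_col B"]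
      mult_smult_distrib[of _ "dim_row A" "dim_col A" _ "dim_col B"]; auto)+

lemma mat_adjoint_add:
  fixes A B :: "complex mat"
  shows "dim_row A = dim_row B \<Longrightarrow> dim_col A = dim_col B \<Longrightarrow> mat_adjoint (A + B) = mat_adjoint A + mat_adjoint B"
  by (rule eq_matI) auto

lemma mat_adjoint_smult: "mat_adjoint (k \<cdot>\<^sub>m A) = cnj k \<cdot>\<^sub>m mat_adjoint (A :: complex mat)"
  by (rule eq_matI) auto

lemmas mat_dim_simps = mult_mat_assoc_dim add_mult_distrib_mat_dim mult_add_distrib_mat_dim
  smult_mult_mat_dim mat_adjoint_add mat_adjoint_smult mat_adjoint_mult

text \<open>
  Two boson modes \<open>p = 0, 1\<close>; the basis vector with index \<open>j\<close> of the \<open>n\<close> particle space has \<open>n - j\<close>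
  particles in mode \<open>0\<close> and \<open>j\<close> in mode \<open>1\<close>. The matrix \<open>create p n\<close> maps \<open>n\<close> to \<open>n + 1\<close> particles,
  and \<open>number_op p q n\<close> is \<open>a\<^sub>p\<^sup>* a\<^sub>q\<close>.
\<close>

definition occupation :: "nat \<Rightarrow> nat \<Rightarrow> nat \<Rightarrow> nat" where
  "occupation p n j = (if p = 0 then n - j else j)"

definition create :: "nat \<Rightarrow> nat \<Rightarrow> complex mat" where
  "create p n = mat (Suc (Suc n)) (Suc n) (\<lambda>(i, j).
     if i = j + p then complex_of_real (sqrt (real (occupation p (Suc n) i))) else 0)"

definition number_op :: "nat \<Rightarrow> nat \<Rightarrow> nat \<Rightarrow> complex mat" where
  "number_op p q n = mat (Suc n) (Suc n) (\<lambda>(i, j).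
     if i + q = j + p then complex_of_real (sqrt (real (occupation p n i)) * sqrt (real (occupation q n j))) else 0)"

lemma create_dim [simp]: "dim_row (create p n) = Suc (Suc n)" "dim_col (create p n) = Suc n"
  by (simp_all add: create_def)

lemma number_op_dim [simp]: "dim_row (number_op p q n) = Suc n" "dim_col (number_op p q n) = Suc n"
  by (simp_all add: number_op_def)

section \<open>Canonical commutation relations\<close>

lemma mode_cases: "p < 2 \<Longrightarrow> p = 0 \<or> p = (1 :: nat)" by auto

lemma create_mult_adjoint:
  assumes "p < 2" "q < 2"
  shows "create p n * mat_adjoint (create q n) = number_op p q (Suc n)"
proof (rule eq_matI)
  fix i j assume "i < dim_row (number_op p q (Suc n))" "j < dim_col (number_op p q (Suc n))"
  then have ij: "i < Suc (Suc n)" "j < Suc (Suc n)" by auto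
  define c where "c p i = complex_of_real (sqrt (real (occupation p (Suc n) i)))" for p i
  have "(create p n * mat_adjoint (create q n)) $$ (i, j)
      = (\<Sum>k<Suc n. (if i = k + p then c p i else 0) * cnj (if j = k + q then c q j else 0))"
    unfolding c_def using ij by (simp add: mult_mat_entry create_def del: index_mult_mat(1) sum.lessThan_Suc cong: sum.cong_simp)
  also have "\<dots> = (\<Sum>k\<le>n. if i = k + p then if j = k + q then c p i * c q j else 0 else 0)"
    unfolding lessThan_Suc_atMost by (intro sum.cong) (auto simp: c_def)
  also have "\<dots> = (if i + q = j + p then c p i * c q j else 0)"
  proof (cases "p \<le> i \<and> i - p \<le> n")
    case True
    then have "j = i - p + q \<longleftrightarrow> i + q = j + p" by arith
    with True show ?thesis unfolding sum_shift_delta by simp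
  next
    \<comment> \<open>The index \<open>i - p\<close> leaves the range only where mode
      \<open>p\<close> is empty, and there the coefficient vanishes.\<close>
    case False
    with assms(1) ij have "p = 0 \<and> i = Suc n \<or> p = 1 \<and> i = 0" by arith
    then have "c p i = 0" by (auto simp: c_def occupation_def)
    with False show ?thesis unfolding sum_shift_delta by simp
  qed
  also have "\<dots> = number_op p q (Suc n) $$ (i, j)"
    using ij by (simp add: number_op_def c_def)
  finally show "(create p n * mat_adjoint (create q n)) $$ (i, j) = number_op p q (Suc n) $$ (i, j)" .
qed auto

text \<open>The canonical commutation relation, with \<open>mat_adjoint (create p n)\<close> as the
  annihilation operator.\<close>

lemma adjoint_mult_create:
  assumes "p < 2" "q < 2"
  shows "mat_adjoint (create p n) * create q n
    = (if p = q then 1\<^sub>m (Suc n) else 0\<^sub>m (Suc n) (Suc n)) + number_op q p n"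
proof (rule eq_matI)
  fix i j
  assume "i < dim_row ((if p = q then 1\<^sub>m (Suc n) else 0\<^sub>m (Suc n) (Suc n)) + number_op q p n)"
    "j < dim_col ((if p = q then 1\<^sub>m (Suc n) else 0\<^sub>m (Suc n) (Suc n)) + number_op q p n)"
  then have ij: "i < Suc n" "j < Suc n" by auto
  define c where "c p i = complex_of_real (sqrt (real (occupation p (Suc n) i)))" for p i
  have "(mat_adjoint (create p n) * create q n) $$ (i, j)
      = (\<Sum>k<Suc (Suc n). cnj (if k = i + p then c p k else 0) * (if k = j + q then c q k else 0))"
    unfolding c_def using ij by (simp add: mult_mat_entry create_def del: index_mult_mat(1) sum.lessThan_Suc cong: sum.cong_simp)
  also have "\<dots> = (\<Sum>k<Suc (Suc n). if k = i + p then if i + p = j + q then c p (i + p) * c q (i + p) else 0 else 0)"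
    by (intro sum.cong) (auto simp: c_def)
  also have "\<dots> = (if i + p = j + q then c p (i + p) * c q (i + p) else 0)"
    using ij assms by (subst sum.delta) auto
  also have "\<dots> = (if p = q \<and> i = j then 1 else 0) + number_op q p n $$ (i, j)"
  proof (cases "i + p = j + q")
    case True
    from assms[THEN mode_cases] show ?thesis
    proof (elim disjE)
      assume pq: "p = 0" "q = 0"
      have "c 0 i * c 0 i = complex_of_real (real (Suc n - i))"
        unfolding c_def occupation_def of_real_mult[symmetric] by simp
      moreover have "number_op 0 0 n $$ (i, i) = complex_of_real (real (n - i))"
        using ij by (simp add: number_op_def occupation_def)
      ultimately show ?thesis using True pq ij by (simp add: of_nat_diff)
    next
      assume pq: "p = 1" "q = 1"
      have "c 1 (Suc i) * c 1 (Suc i) = complex_of_real (real (Suc i))"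
        unfolding c_def occupation_def of_real_mult[symmetric] by simp
      moreover have "number_op 1 1 n $$ (i, i) = complex_of_real (real i)"
        using ij unfolding number_op_def occupation_def by (simp flip: of_real_mult)
      ultimately show ?thesis using True pq ij by simp
    qed (use True ij in \<open>auto simp: number_op_def c_def occupation_def\<close>)
  next
    case False
    then show ?thesis using ij by (auto simp: number_op_def)
  qed
  also have "\<dots> = ((if p = q then 1\<^sub>m (Suc n) else 0\<^sub>m (Suc n) (Suc n)) + number_op q p n) $$ (i, j)"
    using ij by auto
  finally show "(mat_adjoint (create p n) * create q n) $$ (i, j)
    = ((if p = q then 1\<^sub>m (Suc n) else 0\<^sub>m (Suc n) (Suc n)) + number_op q p n) $$ (i, j)" .
qed auto

lemma create_commute:
  assumes "p < 2" "q < 2"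
  shows "create p (Suc n) * create q n = create q (Suc n) * create p n"
proof -
  have "create 0 (Suc n) * create 1 n = create 1 (Suc n) * create 0 n"
  proof (rule eq_matI)
    fix i j assume "i < dim_row (create 1 (Suc n) * create 0 n)" "j < dim_col (create 1 (Suc n) * create 0 n)"
    then have ij: "i < Suc (Suc (Suc n))" "j < Suc n" by auto
    define c where "c p m i = complex_of_real (sqrt (real (occupation p m i)))" for p m i
    have entry: "(create p (Suc n) * create q n) $$ (i, j)
        = (if i = j + q + p then c p (Suc (Suc n)) i * c q (Suc n) (j + q) else 0)" if "q \<le> 1" for p q
    proof -
      have "(create p (Suc n) * create q n) $$ (i, j)
          = (\<Sum>k<Suc (Suc n). (if i = k + p then c p (Suc (Suc n)) i else 0) * (if k = j + q then c q (Suc n) k else 0))"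
        unfolding c_def using ij by (simp add: mult_mat_entry create_def del: index_mult_mat(1) sum.lessThan_Suc cong: sum.cong_simp)
      also have "\<dots> = (\<Sum>k<Suc (Suc n). if k = j + q then if i = j + q + p then c p (Suc (Suc n)) i * c q (Suc n) (j + q) else 0 else 0)"
        by (intro sum.cong) auto
      also have "\<dots> = (if i = j + q + p then c p (Suc (Suc n)) i * c q (Suc n) (j + q) else 0)"
        using that ij by (subst sum.delta) auto
      finally show ?thesis .
    qed
    show "(create 0 (Suc n) * create 1 n) $$ (i, j) = (create 1 (Suc n) * create 0 n) $$ (i, j)"
      by (simp add: entry c_def occupation_def del: index_mult_mat(1))
  qed auto
  with assms[THEN mode_cases] show ?thesis by auto
qed

lemma number_op_sum: "number_op 0 0 n + number_op 1 1 n = of_nat n \<cdot>\<^sub>m 1\<^sub>m (Suc n)"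
proof (rule eq_matI)
  fix i j assume "i < dim_row (of_nat n \<cdot>\<^sub>m 1\<^sub>m (Suc n) :: complex mat)" "j < dim_col (of_nat n \<cdot>\<^sub>m 1\<^sub>m (Suc n) :: complex mat)"
  then show "(number_op 0 0 n + number_op 1 1 n) $$ (i, j) = (of_nat n \<cdot>\<^sub>m 1\<^sub>m (Suc n)) $$ (i, j)"
    by (auto simp: number_op_def occupation_def of_nat_diff simp flip: of_real_mult of_real_add)
qed auto

lemma number_op_vacuum: "p < 2 \<Longrightarrow> q < 2 \<Longrightarrow> number_op p q 0 = 0\<^sub>m 1 1"
  by (rule eq_matI) (auto simp: number_op_def occupation_def)

section \<open>Second quantisation of SU(2)\<close>

text \<open>Row \<open>r\<close> and column \<open>p\<close> of the SU(2) matrix whose first column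
  is the spinor \<open>(\<alpha>, \<beta>)\<close>.\<close>

definition rot :: "complex \<Rightarrow> complex \<Rightarrow> nat \<Rightarrow> nat \<Rightarrow> complex" where
  "rot \<alpha> \<beta> r p = (if p = 0 then if r = 0 then \<alpha> else \<beta> else if r = 0 then - cnj \<beta> else cnj \<alpha>)"

definition create_rot :: "complex \<Rightarrow> complex \<Rightarrow> nat \<Rightarrow> nat \<Rightarrow> complex mat" where
  "create_rot \<alpha> \<beta> p n = rot \<alpha> \<beta> 0 p \<cdot>\<^sub>m create 0 n + rot \<alpha> \<beta> 1 p \<cdot>\<^sub>m create 1 n"

lemma create_rot_dim [simp]:
  "dim_row (create_rot \<alpha> \<beta> p n) = Suc (Suc n)" "dim_col (create_rot \<alpha> \<beta> p n) = Suc n"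
  by (simp_all add: create_rot_def)

text \<open>The lift \<open>U\<close> of the rotation to many particles has to satisfy
  \<open>U a\<^sub>p\<^sup>* = b\<^sub>p\<^sup>* U\<close> with the rotated creation operators
  \<open>b\<^sub>p\<^sup>*\<close>. As the sum of the \<open>a\<^sub>p\<^sup>* a\<^sub>p\<close> is
  \<open>n + 1\<close> on \<open>n + 1\<close> particles, this forces the recursion.\<close>

fun rot_op :: "complex \<Rightarrow> complex \<Rightarrow> nat \<Rightarrow> complex mat" where
  "rot_op \<alpha> \<beta> 0 = 1\<^sub>m 1"
| "rot_op \<alpha> \<beta> (Suc n) = (1 / of_nat (Suc n)) \<cdot>\<^sub>m
     (create_rot \<alpha> \<beta> 0 n * rot_op \<alpha> \<beta> n * mat_adjoint (create 0 n)
      + create_rot \<alpha> \<beta> 1 n * rot_op \<alpha> \<beta> n * mat_adjoint (create 1 n))"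

lemma rot_op_dim [simp]: "dim_row (rot_op \<alpha> \<beta> n) = Suc n" "dim_col (rot_op \<alpha> \<beta> n) = Suc n"
  by (cases n; simp)+

declare rot_op.simps(2) [simp del]

lemma sum_two: "(\<Sum>p<2::nat. f p) = f 0 + (f 1 :: 'a :: comm_monoid_add)"
  by (simp add: numeral_2_eq_2)

lemma rot_orthonormal:
  assumes "\<alpha> * cnj \<alpha> + \<beta> * cnj \<beta> = 1" "r < 2" "s < 2"
  shows "(\<Sum>p<2. rot \<alpha> \<beta> r p * cnj (rot \<alpha> \<beta> s p)) = (if r = s then 1 else 0)"
  using assms(1) assms(2,3)[THEN mode_cases] unfolding sum_two
  by (auto simp: rot_def algebra_simps)

definition number_rot :: "complex \<Rightarrow> complex \<Rightarrow> nat \<Rightarrow> nat \<Rightarrow> nat \<Rightarrow> complex mat" where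
  "number_rot \<alpha> \<beta> p q n = mat (Suc n) (Suc n) (\<lambda>(i, j).
     \<Sum>r<2. \<Sum>s<2. rot \<alpha> \<beta> r p * cnj (rot \<alpha> \<beta> s q) * number_op r s n $$ (i, j))"

lemma number_rot_dim [simp]:
  "dim_row (number_rot \<alpha> \<beta> p q n) = Suc n" "dim_col (number_rot \<alpha> \<beta> p q n) = Suc n"
  by (simp_all add: number_rot_def)

lemma create_rot_mult_adjoint:
  "create_rot \<alpha> \<beta> p n * mat_adjoint (create_rot \<alpha> \<beta> q n) = number_rot \<alpha> \<beta> p q (Suc n)"
proof -
  have "create_rot \<alpha> \<beta> p n * mat_adjoint (create_rot \<alpha> \<beta> q n)
    = cnj (rot \<alpha> \<beta> 0 q) \<cdot>\<^sub>m (rot \<alpha> \<beta> 0 p \<cdot>\<^sub>m number_op 0 0 (Suc n) + rot \<alpha> \<beta> 1 p \<cdot>\<^sub>m number_op 1 0 (Suc n))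
      + cnj (rot \<alpha> \<beta> 1 q) \<cdot>\<^sub>m (rot \<alpha> \<beta> 0 p \<cdot>\<^sub>m number_op 0 1 (Suc n) + rot \<alpha> \<beta> 1 p \<cdot>\<^sub>m number_op 1 1 (Suc n))"
    unfolding create_rot_def by (simp add: mat_dim_simps create_mult_adjoint)
  also have "\<dots> = number_rot \<alpha> \<beta> p q (Suc n)"
    by (rule eq_matI) (auto simp: number_rot_def sum_two algebra_simps)
  finally show ?thesis .
qed

lemma create_rot_commute:
  "create_rot \<alpha> \<beta> p (Suc n) * create_rot \<alpha> \<beta> q n = create_rot \<alpha> \<beta> q (Suc n) * create_rot \<alpha> \<beta> p n"
proof -
  have "create_rot \<alpha> \<beta> p (Suc n) * create_rot \<alpha> \<beta> q n
    = rot \<alpha> \<beta> 0 q \<cdot>\<^sub>m (rot \<alpha> \<beta> 0 p \<cdot>\<^sub>m (create 0 (Suc n) * create 0 n) + rot \<alpha> \<beta> 1 p \<cdot>\<^sub>m (create 1 (Suc n) * create 0 n))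
     + rot \<alpha> \<beta> 1 q \<cdot>\<^sub>m (rot \<alpha> \<beta> 0 p \<cdot>\<^sub>m (create 1 (Suc n) * create 0 n) + rot \<alpha> \<beta> 1 p \<cdot>\<^sub>m (create 1 (Suc n) * create 1 n))"
    for p q
    unfolding create_rot_def using create_commute[of 0 1 n] by (simp add: mat_dim_simps)
  then show ?thesis
    by (intro eq_matI) (auto simp: algebra_simps simp del: index_mult_mat(1))
qed

lemma smult_smult_mat: "a \<cdot>\<^sub>m (b \<cdot>\<^sub>m A) = (a * b :: complex) \<cdot>\<^sub>m A"
  by (rule eq_matI) auto

lemma smult_inverse_Suc: "of_nat (Suc n) \<cdot>\<^sub>m ((1 / of_nat (Suc n)) \<cdot>\<^sub>m A) = (A :: complex mat)"
proof -
  have "of_nat (Suc n) * (1 / of_nat (Suc n)) = (1 :: complex)" by (simp del: of_nat_Suc)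
  then show ?thesis unfolding smult_smult_mat by (simp only:) (rule eq_matI, auto)
qed

lemma rot_op_Suc:
  "of_nat (Suc n) \<cdot>\<^sub>m rot_op \<alpha> \<beta> (Suc n) =
     create_rot \<alpha> \<beta> 0 n * rot_op \<alpha> \<beta> n * mat_adjoint (create 0 n)
      + create_rot \<alpha> \<beta> 1 n * rot_op \<alpha> \<beta> n * mat_adjoint (create 1 n)"
  unfolding rot_op.simps(2) smult_inverse_Suc ..

lemma smult_cancel_Suc:
  fixes X Y :: "complex mat"
  assumes "of_nat (Suc n) \<cdot>\<^sub>m X = of_nat (Suc n) \<cdot>\<^sub>m Y"
  shows "X = Y"
proof -
  have "(1 / of_nat (Suc n)) \<cdot>\<^sub>m (of_nat (Suc n) \<cdot>\<^sub>m Z) = Z" for Z :: "complex mat"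
    using smult_inverse_Suc[of n Z] by (simp only: smult_smult_mat mult.commute)
  then show ?thesis using assms by metis
qed

text \<open>In the recursion for \<open>rot_op\<close> the annihilator is moved past
  \<open>create i n\<close>: the commutator gives one copy of \<open>b\<^sub>i\<^sup>* U\<close>,
  and the rest is the sum in hypothesis \<open>2\<close>, worth \<open>n\<close> further
  copies.\<close>

lemma rot_op_create_step:
  assumes i: "i < 2"
    and 2: "create_rot \<alpha> \<beta> 0 n * (rot_op \<alpha> \<beta> n * number_op i 0 n)
        + create_rot \<alpha> \<beta> 1 n * (rot_op \<alpha> \<beta> n * number_op i 1 n)
      = of_nat n \<cdot>\<^sub>m (create_rot \<alpha> \<beta> i n * rot_op \<alpha> \<beta> n)"
  shows "rot_op \<alpha> \<beta> (Suc n) * create i n = create_rot \<alpha> \<beta> i n * rot_op \<alpha> \<beta> n"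
proof (rule smult_cancel_Suc[of n])
  let ?B = "\<lambda>p. create_rot \<alpha> \<beta> p n" and ?U = "rot_op \<alpha> \<beta> n"
  have 3: "?B p * (?U * (mat_adjoint (create p n) * create i n))
      = (if p = i then ?B i * ?U else 0\<^sub>m (Suc (Suc n)) (Suc n)) + ?B p * (?U * number_op i p n)" if "p < 2" for p
  proof (cases "p = i")
    case True
    have "?U * 1\<^sub>m (Suc n) = ?U" by (rule right_mult_one_mat[of _ "Suc n"]) (auto intro!: carrier_matI)
    then show ?thesis
      unfolding adjoint_mult_create[OF that i] using True by (simp add: mult_add_distrib_mat_dim)
  next
    case False
    have "0\<^sub>m (Suc n) (Suc n) + number_op i p n = number_op i p n"
      "0\<^sub>m (Suc (Suc n)) (Suc n) + ?B p * (?U * number_op i p n) = ?B p * (?U * number_op i p n)"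
      by (rule left_add_zero_mat; auto intro!: carrier_matI)+
    then show ?thesis unfolding adjoint_mult_create[OF that i] using False by (simp only: if_False)
  qed
  have aux: "(X + Y) + (0\<^sub>m r c + Z) = X + (Y + Z)" "(0\<^sub>m r c + Y) + (X + Z) = X + (Y + Z)"
    if "X \<in> carrier_mat r c" "Y \<in> carrier_mat r c" "Z \<in> carrier_mat r c" for X Y Z :: "complex mat" and r c
    using that by (auto intro!: eq_matI)
  have "of_nat (Suc n) \<cdot>\<^sub>m (rot_op \<alpha> \<beta> (Suc n) * create i n)
    = (of_nat (Suc n) \<cdot>\<^sub>m rot_op \<alpha> \<beta> (Suc n)) * create i n"
    by (simp only: smult_mult_mat_dim rot_op_dim create_dim)
  also have "\<dots> = ?B 0 * (?U * (mat_adjoint (create 0 n) * create i n))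
      + ?B 1 * (?U * (mat_adjoint (create 1 n) * create i n))"
    unfolding rot_op_Suc by (simp add: mult_mat_assoc_dim add_mult_distrib_mat_dim)
  also have "\<dots> = ((if 0 = i then ?B i * ?U else 0\<^sub>m (Suc (Suc n)) (Suc n)) + ?B 0 * (?U * number_op i 0 n))
      + ((if 1 = i then ?B i * ?U else 0\<^sub>m (Suc (Suc n)) (Suc n)) + ?B 1 * (?U * number_op i 1 n))"
    by (subst 3, simp, subst 3, simp) (rule refl)
  also have "\<dots> = ?B i * ?U + (?B 0 * (?U * number_op i 0 n) + ?B 1 * (?U * number_op i 1 n))"
  proof -
    have c: "?B i * ?U \<in> carrier_mat (Suc (Suc n)) (Suc n)"
      "?B p * (?U * number_op i p n) \<in> carrier_mat (Suc (Suc n)) (Suc n)" for p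
      by (auto intro!: carrier_matI)
    show ?thesis using mode_cases[OF i] aux[OF c(1) c(2) c(2)] by auto
  qed
  also have "\<dots> = of_nat (Suc n) \<cdot>\<^sub>m (?B i * ?U)"
    unfolding 2 by (rule eq_matI) (auto simp: algebra_simps simp del: index_mult_mat(1))
  finally show "of_nat (Suc n) \<cdot>\<^sub>m (rot_op \<alpha> \<beta> (Suc n) * create i n) = of_nat (Suc n) \<cdot>\<^sub>m (?B i * ?U)" .
qed

text \<open>In the sum left over by \<open>rot_op_create_step\<close>, the induction hypothesis
  turns \<open>U a\<^sub>i\<^sup>*\<close> into \<open>b\<^sub>i\<^sup>* U\<close>. Rotated creation
  operators commute, so \<open>b\<^sub>i\<^sup>*\<close> factors out on the left and the recursion
  reassembles \<open>U\<close>.\<close>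

lemma rot_op_create:
  "i < 2 \<Longrightarrow> rot_op \<alpha> \<beta> (Suc n) * create i n = create_rot \<alpha> \<beta> i n * rot_op \<alpha> \<beta> n"
proof (induction n)
  case 0
  have "create_rot \<alpha> \<beta> p 0 * (rot_op \<alpha> \<beta> 0 * number_op i p 0) = 0\<^sub>m 2 1" if "p < 2" for p
    unfolding number_op_vacuum[OF 0 that] by (rule eq_matI) auto
  then show ?case
    by (intro rot_op_create_step[OF 0], simp only: pos2 one_less_numeral_iff semiring_norm)
      (rule eq_matI, auto)
next
  case (Suc k)
  let ?n = "Suc k"
  let ?B = "\<lambda>p. create_rot \<alpha> \<beta> p ?n" and ?U = "rot_op \<alpha> \<beta> ?n"
  have 1: "?B p * (?U * number_op i p ?n)
      = ?B i * (create_rot \<alpha> \<beta> p k * rot_op \<alpha> \<beta> k * mat_adjoint (create p k))" if "p < 2" for p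
  proof -
    have "?B p * (?U * number_op i p ?n) = ?B p * ((?U * create i k) * mat_adjoint (create p k))"
      unfolding create_mult_adjoint[OF Suc.prems that, symmetric] by (simp add: mult_mat_assoc_dim)
    also have "\<dots> = (?B p * create_rot \<alpha> \<beta> i k) * (rot_op \<alpha> \<beta> k * mat_adjoint (create p k))"
      unfolding Suc.IH[OF Suc.prems] by (simp add: mult_mat_assoc_dim)
    also have "\<dots> = ?B i * (create_rot \<alpha> \<beta> p k * rot_op \<alpha> \<beta> k * mat_adjoint (create p k))"
      unfolding create_rot_commute[of _ _ p k i] by (simp add: mult_mat_assoc_dim)
    finally show ?thesis .
  qed
  have "?B 0 * (?U * number_op i 0 ?n) + ?B 1 * (?U * number_op i 1 ?n) = ?B i * (of_nat ?n \<cdot>\<^sub>m ?U)"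
    unfolding rot_op_Suc by (subst 1, simp, subst 1, simp) (simp add: mult_add_distrib_mat_dim)
  also have "\<dots> = of_nat ?n \<cdot>\<^sub>m (?B i * ?U)" by (simp only: smult_mult_mat_dim rot_op_dim create_rot_dim)
  finally show ?case by (rule rot_op_create_step[OF Suc.prems])
qed

lemma unitaryI:
  assumes "U \<in> carrier_mat n n" "U * mat_adjoint U = 1\<^sub>m n"
  shows "unitary n U"
  unfolding unitary_def using assms mat_mult_left_right_inverse[of U n "mat_adjoint U"] by auto

lemma number_rot_sum:
  assumes "\<alpha> * cnj \<alpha> + \<beta> * cnj \<beta> = 1"
  shows "number_rot \<alpha> \<beta> 0 0 n + number_rot \<alpha> \<beta> 1 1 n = of_nat n \<cdot>\<^sub>m 1\<^sub>m (Suc n)"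
proof -
  have "number_rot \<alpha> \<beta> 0 0 n + number_rot \<alpha> \<beta> 1 1 n = number_op 0 0 n + number_op 1 1 n"
  proof (rule eq_matI)
    fix i j assume "i < dim_row (number_op 0 0 n + number_op 1 1 n)" "j < dim_col (number_op 0 0 n + number_op 1 1 n)"
    then have ij: "i < Suc n" "j < Suc n" by auto
    define e where "e r s = number_op r s n $$ (i, j)" for r s
    have "(number_rot \<alpha> \<beta> 0 0 n + number_rot \<alpha> \<beta> 1 1 n) $$ (i, j)
        = (\<Sum>p<2. \<Sum>r<2. \<Sum>s<2. rot \<alpha> \<beta> r p * cnj (rot \<alpha> \<beta> s p) * e r s)"
      unfolding sum_two[of "\<lambda>p. \<Sum>r<2. \<Sum>s<2. rot \<alpha> \<beta> r p * cnj (rot \<alpha> \<beta> s p) * e r s"]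
      using ij by (simp add: number_rot_def e_def)
    also have "\<dots> = (\<Sum>r<2. \<Sum>s<2. (\<Sum>p<2. rot \<alpha> \<beta> r p * cnj (rot \<alpha> \<beta> s p)) * e r s)"
      unfolding sum_two by (simp add: algebra_simps)
    also have "\<dots> = (\<Sum>r<2. \<Sum>s<2. (if r = s then 1 else 0) * e r s)"
      by (intro sum.cong refl) (simp add: rot_orthonormal[OF assms])
    also have "\<dots> = (number_op 0 0 n + number_op 1 1 n) $$ (i, j)"
      unfolding sum_two using ij by (simp add: e_def)
    finally show "(number_rot \<alpha> \<beta> 0 0 n + number_rot \<alpha> \<beta> 1 1 n) $$ (i, j)
      = (number_op 0 0 n + number_op 1 1 n) $$ (i, j)" .
  qed auto
  then show ?thesis by (simp only: number_op_sum)
qed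

text \<open>By the intertwining relation and the induction hypothesis, \<open>n + 1\<close> times
  \<open>U U\<^sup>*\<close> on \<open>n + 1\<close> particles is the sum of the rotated
  \<open>b\<^sub>p\<^sup>* b\<^sub>p\<close>, and the total particle number is rotation
  invariant.\<close>

lemma rot_op_unitary:
  assumes "\<alpha> * cnj \<alpha> + \<beta> * cnj \<beta> = 1"
  shows "unitary (Suc n) (rot_op \<alpha> \<beta> n)"
proof (induction n)
  case 0
  show ?case by (simp add: unitary_def)
next
  case (Suc n)
  let ?V = "rot_op \<alpha> \<beta> (Suc n)" and ?U = "rot_op \<alpha> \<beta> n" and ?B = "\<lambda>p. create_rot \<alpha> \<beta> p n"
  have UU: "?U * (mat_adjoint ?U * X) = X" if "dim_row X = Suc n" for X
  proof -
    have "?U * (mat_adjoint ?U * X) = (?U * mat_adjoint ?U) * X" using that by (simp add: mult_mat_assoc_dim)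
    also have "\<dots> = X" using Suc that by (simp add: unitary_def)
    finally show ?thesis .
  qed
  have p: "?B p * (?U * (mat_adjoint (create p n) * mat_adjoint ?V)) = number_rot \<alpha> \<beta> p p (Suc n)" if "p < 2" for p
  proof -
    have "mat_adjoint (create p n) * mat_adjoint ?V = mat_adjoint ?U * mat_adjoint (?B p)"
      using arg_cong[OF rot_op_create[OF that, of \<alpha> \<beta> n], of mat_adjoint] by (simp add: mat_adjoint_mult)
    then show ?thesis by (simp add: UU create_rot_mult_adjoint)
  qed
  have "?V * mat_adjoint ?V = 1\<^sub>m (Suc (Suc n))"
  proof (rule smult_cancel_Suc[of n])
    have "of_nat (Suc n) \<cdot>\<^sub>m (?V * mat_adjoint ?V) = (of_nat (Suc n) \<cdot>\<^sub>m ?V) * mat_adjoint ?V"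
      by (simp only: smult_mult_mat_dim rot_op_dim mat_adjoint_dim)
    also have "\<dots> = ?B 0 * (?U * (mat_adjoint (create 0 n) * mat_adjoint ?V))
      + ?B 1 * (?U * (mat_adjoint (create 1 n) * mat_adjoint ?V))"
      unfolding rot_op_Suc by (simp add: mult_mat_assoc_dim add_mult_distrib_mat_dim)
    also have "\<dots> = of_nat (Suc n) \<cdot>\<^sub>m 1\<^sub>m (Suc (Suc n))"
      using number_rot_sum[OF assms, of "Suc n"] by (subst p, simp, subst p, simp, simp)
    finally show "of_nat (Suc n) \<cdot>\<^sub>m (?V * mat_adjoint ?V) = of_nat (Suc n) \<cdot>\<^sub>m 1\<^sub>m (Suc (Suc n))" .
  qed
  then show ?case by (intro unitaryI) auto
qed

lemma rot_op_conj:
  assumes "\<alpha> * cnj \<alpha> + \<beta> * cnj \<beta> = 1" "p < 2" "q < 2"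
  shows "rot_op \<alpha> \<beta> n * number_op p q n * mat_adjoint (rot_op \<alpha> \<beta> n) = number_rot \<alpha> \<beta> p q n"
proof (cases n)
  case 0
  have "number_rot \<alpha> \<beta> p q 0 = 0\<^sub>m 1 1"
    by (rule eq_matI) (auto simp: number_rot_def number_op_vacuum sum_two)
  with 0 assms show ?thesis by (simp add: number_op_vacuum)
next
  case (Suc k)
  let ?V = "rot_op \<alpha> \<beta> (Suc k)" and ?U = "rot_op \<alpha> \<beta> k" and ?B = "\<lambda>p. create_rot \<alpha> \<beta> p k"
  have "?V * number_op p q (Suc k) * mat_adjoint ?V = (?V * create p k) * mat_adjoint (?V * create q k)"
    unfolding create_mult_adjoint[OF assms(2,3), symmetric] by (simp add: mult_mat_assoc_dim mat_adjoint_mult)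
  also have "\<dots> = ?B p * ((?U * mat_adjoint ?U) * mat_adjoint (?B q))"
    unfolding rot_op_create[OF assms(2)] rot_op_create[OF assms(3)]
    by (simp add: mult_mat_assoc_dim mat_adjoint_mult)
  also have "?U * mat_adjoint ?U = 1\<^sub>m (Suc k)" using rot_op_unitary[OF assms(1), of k] by (simp add: unitary_def)
  also have "?B p * (1\<^sub>m (Suc k) * mat_adjoint (?B q)) = number_rot \<alpha> \<beta> p q (Suc k)"
    using create_rot_mult_adjoint[of \<alpha> \<beta> p k q]
    by (subst left_mult_one_mat[of _ _ "Suc (Suc k)"]) (auto intro!: carrier_matI)
  finally show ?thesis using Suc by simp
qed

section \<open>Covariance\<close>

text \<open>Each of \<open>p\<close> and \<open>q\<close> occurs once in \<open>g\<close> and once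
  in a conjugate of \<open>g\<close>, so summing over them removes all rotations by
  unitarity.\<close>

lemma rot_exchange:
  fixes e e' :: "nat \<Rightarrow> nat \<Rightarrow> complex"
  assumes norm: "\<alpha> * cnj \<alpha> + \<beta> * cnj \<beta> = 1"
  defines "g \<equiv> rot \<alpha> \<beta>"
  shows "(\<Sum>p<2. \<Sum>q<2. (\<Sum>r<2. \<Sum>s<2. g r p * cnj (g s q) * e r s) * (\<Sum>t<2. \<Sum>u<2. g t q * cnj (g u p) * e' t u))
    = (\<Sum>r<2. \<Sum>t<2. e r t * e' t r)"
proof -
  define X where "X r q = (\<Sum>s<2. e r s * cnj (g s q))" for r q
  define Y where "Y t p = (\<Sum>u<2. e' t u * cnj (g u p))" for t p
  have orth: "(\<Sum>p<2. g r p * cnj (g s p)) = (if r = s then 1 else 0)" if "r < 2" "s < 2" for r s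
    using rot_orthonormal[OF norm that] by (simp add: g_def)
  have contract: "(\<Sum>q<2. (\<Sum>s<2. f s * cnj (g s q)) * g t q) = f t" if "t < 2" for f t
  proof -
    have "(\<Sum>q<2. (\<Sum>s<2. f s * cnj (g s q)) * g t q) = (\<Sum>s<2. f s * (\<Sum>q<2. g t q * cnj (g s q)))"
      unfolding sum_two by (simp add: algebra_simps)
    also have "\<dots> = (\<Sum>s<2. if s = t then f s else 0)"
      using that by (intro sum.cong refl) (auto simp: orth)
    finally show ?thesis using that by simp
  qed
  have "(\<Sum>p<2. \<Sum>q<2. (\<Sum>r<2. \<Sum>s<2. g r p * cnj (g s q) * e r s) * (\<Sum>t<2. \<Sum>u<2. g t q * cnj (g u p) * e' t u))
      = (\<Sum>p<2. \<Sum>q<2. (\<Sum>r<2. g r p * X r q) * (\<Sum>t<2. g t q * Y t p))"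
    unfolding X_def Y_def by (simp add: sum_distrib_left ac_simps)
  also have "\<dots> = (\<Sum>r<2. \<Sum>t<2. (\<Sum>q<2. X r q * g t q) * (\<Sum>p<2. Y t p * g r p))"
    unfolding sum_two by (simp add: algebra_simps)
  also have "\<dots> = (\<Sum>r<2. \<Sum>t<2. e r t * e' t r)"
    unfolding X_def Y_def by (intro sum.cong refl) (simp add: contract)
  finally show ?thesis .
qed

lemma number_op_entry:
  assumes "i < Suc n" "j < Suc n"
  shows "number_op 0 0 n $$ (i, j) = (if i = j then of_nat (n - i) else 0)"
    and "number_op 1 1 n $$ (i, j) = (if i = j then of_nat i else 0)"
    and "number_op 0 1 n $$ (i, j) = raise_entry n i j"
    and "number_op 1 0 n $$ (i, j) = raise_entry n j i"
proof -
  have sq: "complex_of_real (sqrt (real k)) * complex_of_real (sqrt (real k)) = of_nat k" for k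
    by (simp flip: of_real_mult)
  show "number_op 0 0 n $$ (i, j) = (if i = j then of_nat (n - i) else 0)"
    "number_op 1 1 n $$ (i, j) = (if i = j then of_nat i else 0)"
    using assms by (auto simp: number_op_def occupation_def sq)
  have raise: "raise_coeff n i = complex_of_real (sqrt (real (n - i)) * sqrt (real (Suc i)))" if "i \<le> n" for i
    using that unfolding raise_coeff_def real_sqrt_mult by (simp add: of_nat_diff del: of_nat_Suc)
  show "number_op 0 1 n $$ (i, j) = raise_entry n i j" "number_op 1 0 n $$ (i, j) = raise_entry n j i"
    using assms by (auto simp: number_op_def occupation_def raise_entry_def raise mult.commute)
qed

text \<open>For number operators this is \<open>2 S \<cdot> S + n N / 2\<close> in Schwinger's boson
  picture, a form of the coupling term whose rotation invariance is visible.\<close>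

definition exchange_op :: "(nat \<Rightarrow> nat \<Rightarrow> complex mat) \<Rightarrow> (nat \<Rightarrow> nat \<Rightarrow> complex mat) \<Rightarrow> complex mat" where
  "exchange_op A B = (tensor_mat (A 0 0) (B 0 0) + tensor_mat (A 0 1) (B 1 0))
     + (tensor_mat (A 1 0) (B 0 1) + tensor_mat (A 1 1) (B 1 1))"

lemma exchange_op_carrier:
  assumes "\<And>r s. A r s \<in> carrier_mat p p" "\<And>r s. B r s \<in> carrier_mat q q"
  shows "exchange_op A B \<in> carrier_mat (p * q) (p * q)"
  unfolding exchange_op_def using assms by (intro add_carrier_mat tensor_mat_carrier)

lemma exchange_op_entry:
  assumes c: "\<And>r s. A r s \<in> carrier_mat p p" "\<And>r s. B r s \<in> carrier_mat q q"
    and ij: "i < p" "j < q" "i' < p" "j' < q"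
  shows "exchange_op A B $$ (pair_index q i j, pair_index q i' j')
    = (\<Sum>r<2. \<Sum>s<2. A r s $$ (i, i') * B s r $$ (j, j'))"
proof -
  have t: "tensor_mat (A r s) (B s r) \<in> carrier_mat (p * q) (p * q)" for r s
    by (intro tensor_mat_carrier c)
  note less = pair_index_less[OF ij(1,2)] pair_index_less[OF ij(3,4)]
  have add: "((X + Y) + (Z + W)) $$ (x, y) = (X $$ (x, y) + Y $$ (x, y)) + (Z $$ (x, y) + W $$ (x, y))"
    if "X \<in> carrier_mat d d" "Y \<in> carrier_mat d d" "Z \<in> carrier_mat d d" "W \<in> carrier_mat d d" "x < d" "y < d"
    for X Y Z W :: "complex mat" and d x y using that by auto
  show ?thesis
    unfolding exchange_op_def sum_two add[OF t t t t less] tensor_mat_entry[OF c(1) c(2) ij] ..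
qed

lemma total_casimir_exchange:
  defines "c n N \<equiv> complex_of_real (real n / 2 * (real n / 2 + 1) + real N / 2 * (real N / 2 + 1) - real n * real N / 2)"
  shows "total_casimir (real n / 2) (real N / 2) = c n N \<cdot>\<^sub>m 1\<^sub>m (Suc n * Suc N)
      + exchange_op (\<lambda>r s. number_op r s n) (\<lambda>r s. number_op r s N)"
proof (rule eq_mat_pairI[OF total_casimir_carrier])
  have N: "number_op r s m \<in> carrier_mat (Suc m) (Suc m)" for r s m by (auto intro!: carrier_matI)
  note ex = exchange_op_carrier[of "\<lambda>r s. number_op r s n" "Suc n" "\<lambda>r s. number_op r s N" "Suc N", OF N N]
  then show "c n N \<cdot>\<^sub>m 1\<^sub>m (Suc n * Suc N) + exchange_op (\<lambda>r s. number_op r s n) (\<lambda>r s. number_op r s N)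
      \<in> carrier_mat (Suc n * Suc N) (Suc n * Suc N)" by (rule add_carrier_mat)
  fix i j i' j' assume ij: "i < Suc n" "j < Suc N" "i' < Suc n" "j' < Suc N"
  note less = pair_index_less[OF ij(1,2)] pair_index_less[OF ij(3,4)]
  have coeff: "complex_of_real (casimir_coeff n N i j) = c n N + of_nat (n - i) * of_nat (N - j) + of_nat i * of_nat j"
  proof -
    have "a / 2 * (a / 2 + 1) + b / 2 * (b / 2 + 1) + 2 * (a / 2 - x) * (b / 2 - y)
      = a / 2 * (a / 2 + 1) + b / 2 * (b / 2 + 1) - a * b / 2 + (a - x) * (b - y) + x * y" for a b x y :: real
      by (simp add: field_simps)
    then have "casimir_coeff n N i j = real n / 2 * (real n / 2 + 1) + real N / 2 * (real N / 2 + 1) - real n * real N / 2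
        + real (n - i) * real (N - j) + real i * real j"
      unfolding casimir_coeff_def using ij by (simp add: of_nat_diff)
    then show ?thesis unfolding c_def by (simp only: of_real_add of_real_mult of_real_of_nat_eq)
  qed
  have "(c n N \<cdot>\<^sub>m 1\<^sub>m (Suc n * Suc N) + exchange_op (\<lambda>r s. number_op r s n) (\<lambda>r s. number_op r s N))
      $$ (pair_index (Suc N) i j, pair_index (Suc N) i' j')
    = (if i = i' \<and> j = j' then c n N else 0)
      + exchange_op (\<lambda>r s. number_op r s n) (\<lambda>r s. number_op r s N) $$ (pair_index (Suc N) i j, pair_index (Suc N) i' j')"
    using ex less ij by (auto simp: pair_index_eq_iff simp del: mult_Suc mult_Suc_right)
  also have "\<dots> = (if i = i' \<and> j = j' then complex_of_real (casimir_coeff n N i j) else 0)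
      + raise_entry n i i' * raise_entry N j' j + raise_entry n i' i * raise_entry N j j'"
    unfolding exchange_op_entry[of "\<lambda>r s. number_op r s n" "Suc n" "\<lambda>r s. number_op r s N" "Suc N", OF N N ij]
      sum_two number_op_entry[OF ij(1,3)] number_op_entry[OF ij(2,4)] coeff by auto
  also have "\<dots> = total_casimir (real n / 2) (real N / 2) $$ (pair_index (Suc N) i j, pair_index (Suc N) i' j')"
    by (rule total_casimir_entry[OF ij, symmetric])
  finally show "total_casimir (real n / 2) (real N / 2) $$ (pair_index (Suc N) i j, pair_index (Suc N) i' j')
    = (c n N \<cdot>\<^sub>m 1\<^sub>m (Suc n * Suc N) + exchange_op (\<lambda>r s. number_op r s n) (\<lambda>r s. number_op r s N))
      $$ (pair_index (Suc N) i j, pair_index (Suc N) i' j')" ..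
qed

lemma exchange_op_rot:
  assumes norm: "\<alpha> * cnj \<alpha> + \<beta> * cnj \<beta> = 1"
  shows "exchange_op (\<lambda>r s. number_rot \<alpha> \<beta> r s n) (\<lambda>r s. number_rot \<alpha> \<beta> r s N)
    = exchange_op (\<lambda>r s. number_op r s n) (\<lambda>r s. number_op r s N)"
proof -
  have N: "number_op r s m \<in> carrier_mat (Suc m) (Suc m)"
    and R: "number_rot \<alpha> \<beta> r s m \<in> carrier_mat (Suc m) (Suc m)" for r s m by (auto intro!: carrier_matI)
  show ?thesis
  proof (rule eq_mat_pairI[of _ "Suc n" "Suc N"])
    show "exchange_op (\<lambda>r s. number_rot \<alpha> \<beta> r s n) (\<lambda>r s. number_rot \<alpha> \<beta> r s N) \<in> carrier_mat (Suc n * Suc N) (Suc n * Suc N)"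
      "exchange_op (\<lambda>r s. number_op r s n) (\<lambda>r s. number_op r s N) \<in> carrier_mat (Suc n * Suc N) (Suc n * Suc N)"
      by (rule exchange_op_carrier; rule N R)+
    fix i j i' j' assume ij: "i < Suc n" "j < Suc N" "i' < Suc n" "j' < Suc N"
    have r: "number_rot \<alpha> \<beta> p q m $$ (x, y) = (\<Sum>r<2. \<Sum>s<2. rot \<alpha> \<beta> r p * cnj (rot \<alpha> \<beta> s q) * number_op r s m $$ (x, y))"
      if "x < Suc m" "y < Suc m" for p q m x y using that by (simp add: number_rot_def)
    show "exchange_op (\<lambda>r s. number_rot \<alpha> \<beta> r s n) (\<lambda>r s. number_rot \<alpha> \<beta> r s N) $$ (pair_index (Suc N) i j, pair_index (Suc N) i' j')
      = exchange_op (\<lambda>r s. number_op r s n) (\<lambda>r s. number_op r s N) $$ (pair_index (Suc N) i j, pair_index (Suc N) i' j')"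
      unfolding exchange_op_entry[of "\<lambda>r s. number_op r s n" "Suc n" "\<lambda>r s. number_op r s N" "Suc N", OF N N ij]
        exchange_op_entry[of "\<lambda>r s. number_rot \<alpha> \<beta> r s n" "Suc n" "\<lambda>r s. number_rot \<alpha> \<beta> r s N" "Suc N", OF R R ij]
        r[OF ij(1,3)] r[OF ij(2,4)] rot_exchange[OF norm] ..
  qed
qed

lemma tensor_mat_unitary:
  assumes "unitary p U" "unitary q V"
  shows "unitary (p * q) (tensor_mat U V)"
proof (rule unitaryI)
  have c: "U \<in> carrier_mat p p" "V \<in> carrier_mat q q" using assms by (auto simp: unitary_def)
  then show "tensor_mat U V \<in> carrier_mat (p * q) (p * q)" by (rule tensor_mat_carrier)
  show "tensor_mat U V * mat_adjoint (tensor_mat U V) = 1\<^sub>m (p * q)"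
    unfolding tensor_mat_adjoint
    using tensor_mat_mult[OF c mat_adjoint_carrier[OF c(1)] mat_adjoint_carrier[OF c(2)]] assms
    by (simp add: unitary_def tensor_mat_one)
qed

definition rot_tensor :: "complex \<Rightarrow> complex \<Rightarrow> nat \<Rightarrow> nat \<Rightarrow> complex mat" where
  "rot_tensor \<alpha> \<beta> n N = tensor_mat (rot_op \<alpha> \<beta> n) (rot_op \<alpha> \<beta> N)"

lemma rot_op_carrier: "rot_op \<alpha> \<beta> n \<in> carrier_mat (Suc n) (Suc n)"
  by (auto intro!: carrier_matI)

lemma rot_tensor_carrier: "rot_tensor \<alpha> \<beta> n N \<in> carrier_mat (Suc n * Suc N) (Suc n * Suc N)"
  unfolding rot_tensor_def by (intro tensor_mat_carrier rot_op_carrier)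

lemma rot_tensor_unitary:
  "\<alpha> * cnj \<alpha> + \<beta> * cnj \<beta> = 1 \<Longrightarrow> unitary (Suc n * Suc N) (rot_tensor \<alpha> \<beta> n N)"
  unfolding rot_tensor_def by (intro tensor_mat_unitary rot_op_unitary)

lemma rot_tensor_casimir:
  assumes norm: "\<alpha> * cnj \<alpha> + \<beta> * cnj \<beta> = 1"
  shows "rot_tensor \<alpha> \<beta> n N * total_casimir (real n / 2) (real N / 2)
    = total_casimir (real n / 2) (real N / 2) * rot_tensor \<alpha> \<beta> n N"
proof -
  let ?d = "Suc n * Suc N" and ?R = "rot_tensor \<alpha> \<beta> n N"
  have N: "number_op r s m \<in> carrier_mat (Suc m) (Suc m)"
    and R: "number_rot \<alpha> \<beta> r s m \<in> carrier_mat (Suc m) (Suc m)" for r s m by (auto intro!: carrier_matI)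
  have move: "rot_op \<alpha> \<beta> m * number_op r s m = number_rot \<alpha> \<beta> r s m * rot_op \<alpha> \<beta> m" if "r < 2" "s < 2" for r s m
  proof -
    have "number_rot \<alpha> \<beta> r s m * rot_op \<alpha> \<beta> m
        = rot_op \<alpha> \<beta> m * (number_op r s m * (mat_adjoint (rot_op \<alpha> \<beta> m) * rot_op \<alpha> \<beta> m))"
      unfolding rot_op_conj[OF norm that, symmetric] by (simp add: mult_mat_assoc_dim)
    also have "mat_adjoint (rot_op \<alpha> \<beta> m) * rot_op \<alpha> \<beta> m = 1\<^sub>m (Suc m)"
      using rot_op_unitary[OF norm, of m] by (simp add: unitary_def)
    also have "number_op r s m * 1\<^sub>m (Suc m) = number_op r s m" by (rule right_mult_one_mat[OF N])
    finally show ?thesis ..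
  qed
  have t: "?R * tensor_mat (number_op r s n) (number_op s r N)
      = tensor_mat (number_rot \<alpha> \<beta> r s n) (number_rot \<alpha> \<beta> s r N) * ?R" if "r < 2" "s < 2" for r s
    unfolding rot_tensor_def
      tensor_mat_mult[OF rot_op_carrier rot_op_carrier N N] tensor_mat_mult[OF R R rot_op_carrier rot_op_carrier]
      move[OF that] move[OF that(2,1)] ..
  have dist: "X * ((A + B) + (C + D)) = (X * A + X * B) + (X * C + X * D)"
    "((A + B) + (C + D)) * X = (A * X + B * X) + (C * X + D * X)"
    if "X \<in> carrier_mat d d" "A \<in> carrier_mat d d" "B \<in> carrier_mat d d" "C \<in> carrier_mat d d" "D \<in> carrier_mat d d"
    for X A B C D :: "complex mat" and d
    using that by (auto simp: mult_add_distrib_mat_dim add_mult_distrib_mat_dim)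
  have tc: "tensor_mat (number_op r s n) (number_op s r N) \<in> carrier_mat ?d ?d"
    "tensor_mat (number_rot \<alpha> \<beta> r s n) (number_rot \<alpha> \<beta> s r N) \<in> carrier_mat ?d ?d" for r s
    by (intro tensor_mat_carrier N R)+
  have lt: "(0 :: nat) < 2" "(1 :: nat) < 2" by auto
  have ex: "?R * exchange_op (\<lambda>r s. number_op r s n) (\<lambda>r s. number_op r s N)
      = exchange_op (\<lambda>r s. number_op r s n) (\<lambda>r s. number_op r s N) * ?R"
    unfolding exchange_op_rot[OF norm, of n N, symmetric]
    unfolding exchange_op_rot[OF norm, of n N] unfolding exchange_op_def
    unfolding dist(1)[OF rot_tensor_carrier tc(1) tc(1) tc(1) tc(1)]
      t[OF lt(1) lt(1)] t[OF lt(1) lt(2)] t[OF lt(2) lt(1)] t[OF lt(2) lt(2)]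
      dist(2)[OF rot_tensor_carrier tc(2) tc(2) tc(2) tc(2), symmetric]
    using exchange_op_rot[OF norm, of n N] unfolding exchange_op_def by (simp only:)
  have E: "exchange_op (\<lambda>r s. number_op r s n) (\<lambda>r s. number_op r s N) \<in> carrier_mat ?d ?d"
    by (rule exchange_op_carrier; rule N)
  have id: "?R * (k \<cdot>\<^sub>m 1\<^sub>m ?d) = (k \<cdot>\<^sub>m 1\<^sub>m ?d) * ?R" for k
    using rot_tensor_carrier[of \<alpha> \<beta> n N] by (simp add: mult_smult_distrib[of _ ?d ?d _ ?d] mult_smult_assoc_mat[of _ ?d ?d _ ?d]
      del: mult_Suc mult_Suc_right)
  show ?thesis
    unfolding total_casimir_exchange
      mult_add_distrib_mat[OF rot_tensor_carrier smult_carrier_mat[OF one_carrier_mat] E]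
      add_mult_distrib_mat[OF smult_carrier_mat[OF one_carrier_mat] E rot_tensor_carrier] id ex ..
qed

section \<open>Invariance of the projection and covariance of the map\<close>

text \<open>The conjugate is the projection onto the image of \<open>S\<close> under
  \<open>R\<close>. Invariance under the adjoint shows that this image is all of
  \<open>S\<close>.\<close>

lemma orth_proj_conj:
  assumes P: "is_orth_proj d S P" and R: "unitary d R"
    and S: "\<And>v. v \<in> S \<Longrightarrow> v \<in> carrier_vec d"
    and inv: "\<And>v. v \<in> S \<Longrightarrow> R *\<^sub>v v \<in> S" "\<And>v. v \<in> S \<Longrightarrow> mat_adjoint R *\<^sub>v v \<in> S"
  shows "R * P * mat_adjoint R = P"
proof (rule orth_proj_unique[OF _ P])
  from P have c: "P \<in> carrier_mat d d" and PP: "P * P = P" and adj: "mat_adjoint P = P"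
    and range: "(\<lambda>v. P *\<^sub>v v) ` carrier_vec d = S" by (auto simp: is_orth_proj_def)
  from R have Rc: "R \<in> carrier_mat d d" and RR: "mat_adjoint R * R = 1\<^sub>m d" "R * mat_adjoint R = 1\<^sub>m d"
    by (auto simp: unitary_def)
  have Ra: "mat_adjoint R \<in> carrier_mat d d" using Rc by simp
  let ?Q = "R * P * mat_adjoint R"
  have Q: "?Q \<in> carrier_mat d d" by (rule mult_carrier_mat[OF mult_carrier_mat[OF Rc c] Ra])
  note dims = carrier_matD[OF c] carrier_matD[OF Rc]
  have "?Q * ?Q = R * (P * ((mat_adjoint R * R) * (P * mat_adjoint R)))"
    using dims by (simp add: mult_mat_assoc_dim)
  also have "(mat_adjoint R * R) * (P * mat_adjoint R) = P * mat_adjoint R"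
    unfolding RR using c Ra by simp
  also have "R * (P * (P * mat_adjoint R)) = R * ((P * P) * mat_adjoint R)"
    using dims by (simp add: mult_mat_assoc_dim)
  also have "\<dots> = ?Q" unfolding PP using dims by (simp add: mult_mat_assoc_dim)
  finally have idem: "?Q * ?Q = ?Q" .
  have adjQ: "mat_adjoint ?Q = ?Q" using dims adj by (simp add: mat_adjoint_mult mult_mat_assoc_dim)
  have Qv: "?Q *\<^sub>v w = R *\<^sub>v (P *\<^sub>v (mat_adjoint R *\<^sub>v w))" if "w \<in> carrier_vec d" for w
    unfolding assoc_mult_mat_vec[OF mult_carrier_mat[OF Rc c] Ra that]
      assoc_mult_mat_vec[OF Rc c mult_mat_vec_carrier[OF Ra that]] ..
  have "(\<lambda>v. ?Q *\<^sub>v v) ` carrier_vec d = S"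
  proof (intro equalityI subsetI)
    fix v assume "v \<in> (\<lambda>v. ?Q *\<^sub>v v) ` carrier_vec d"
    then obtain u where u: "u \<in> carrier_vec d" "v = ?Q *\<^sub>v u" by auto
    have "v = R *\<^sub>v (P *\<^sub>v (mat_adjoint R *\<^sub>v u))"
      unfolding u(2) by (rule Qv[OF u(1)])
    moreover have "P *\<^sub>v (mat_adjoint R *\<^sub>v u) \<in> S"
      unfolding range[symmetric] using Ra u(1) by (intro imageI) simp
    ultimately show "v \<in> S" using inv by simp
  next
    fix v assume v: "v \<in> S"
    then have vc: "v \<in> carrier_vec d" by (rule S)
    have "mat_adjoint R *\<^sub>v v \<in> S" using inv v by simp
    then obtain u where u: "u \<in> carrier_vec d" "mat_adjoint R *\<^sub>v v = P *\<^sub>v u"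
      unfolding range[symmetric] by auto
    have "P *\<^sub>v (mat_adjoint R *\<^sub>v v) = (P * P) *\<^sub>v u"
      using u c assoc_mult_mat_vec[of P d d P d u] by simp
    then have "P *\<^sub>v (mat_adjoint R *\<^sub>v v) = mat_adjoint R *\<^sub>v v" using PP u by simp
    then have "?Q *\<^sub>v v = R *\<^sub>v (mat_adjoint R *\<^sub>v v)"
      unfolding Qv[OF vc] by simp
    also have "\<dots> = (R * mat_adjoint R) *\<^sub>v v" using assoc_mult_mat_vec[OF Rc Ra vc] by simp
    also have "\<dots> = v" unfolding RR using vc by simp
    finally show "v \<in> (\<lambda>v. ?Q *\<^sub>v v) ` carrier_vec d" using vc by (intro image_eqI[where x = v]) auto
  qed
  then show "is_orth_proj d S ?Q" using Q idem adjQ by (simp add: is_orth_proj_def)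
qed

lemma P_minus_rot:
  assumes norm: "\<alpha> * cnj \<alpha> + \<beta> * cnj \<beta> = 1"
  shows "rot_tensor \<alpha> \<beta> n N * P_minus (real n / 2) (real N / 2) * mat_adjoint (rot_tensor \<alpha> \<beta> n N)
    = P_minus (real n / 2) (real N / 2)"
proof (rule orth_proj_conj[OF P_minus_orth_proj(1) rot_tensor_unitary[OF norm]])
  let ?S = "total_spin_space (real n / 2) (real N / 2) \<bar>real N / 2 - real n / 2\<bar>" and ?R = "rot_tensor \<alpha> \<beta> n N"
  let ?C = "total_casimir (real n / 2) (real N / 2)" and ?d = "Suc n * Suc N"
  obtain k where k: "?S = {v \<in> carrier_vec ?d. ?C *\<^sub>v v = k \<cdot>\<^sub>v v}"
    unfolding total_spin_space_def spin_dim_half by blast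
  show "v \<in> carrier_vec ?d" if "v \<in> ?S" for v using that unfolding k by blast
  have Cc: "?C \<in> carrier_mat ?d ?d" by (rule total_casimir_carrier)
  have R: "unitary ?d ?R" by (rule rot_tensor_unitary[OF norm])
  have inv: "X *\<^sub>v v \<in> ?S" if v: "v \<in> ?S" and X: "X \<in> carrier_mat ?d ?d" "X * ?C = ?C * X" for X v
  proof -
    from v have vc: "v \<in> carrier_vec ?d" and ev: "?C *\<^sub>v v = k \<cdot>\<^sub>v v" unfolding k by auto
    have "?C *\<^sub>v (X *\<^sub>v v) = (?C * X) *\<^sub>v v" by (rule assoc_mult_mat_vec[OF Cc X(1) vc, symmetric])
    also have "\<dots> = X *\<^sub>v (?C *\<^sub>v v)" unfolding X(2)[symmetric] by (rule assoc_mult_mat_vec[OF X(1) Cc vc])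
    also have "\<dots> = k \<cdot>\<^sub>v (X *\<^sub>v v)" unfolding ev by (rule mult_mat_vec[OF X(1) vc])
    finally show ?thesis unfolding k using mult_mat_vec_carrier[OF X(1) vc] by blast
  qed
  show "?R *\<^sub>v v \<in> ?S" if "v \<in> ?S" for v
    by (rule inv[OF that rot_tensor_carrier rot_tensor_casimir[OF norm]])
  have "mat_adjoint ?R * ?C = ?C * mat_adjoint ?R"
  proof -
    note dims = carrier_matD[OF Cc] unitary_dims[OF R]
    have "mat_adjoint ?R * ?C = mat_adjoint ?R * (?C * (?R * mat_adjoint ?R))"
      using R Cc by (simp add: unitary_def del: mult_Suc mult_Suc_right)
    also have "\<dots> = mat_adjoint ?R * ((?C * ?R) * mat_adjoint ?R)" using dims by (simp add: mult_mat_assoc_dim)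
    also have "\<dots> = (mat_adjoint ?R * ?R) * (?C * mat_adjoint ?R)"
      unfolding rot_tensor_casimir[OF norm, symmetric] using dims by (simp add: mult_mat_assoc_dim)
    also have "\<dots> = ?C * mat_adjoint ?R" using R Cc by (simp add: unitary_def del: mult_Suc mult_Suc_right)
    finally show ?thesis .
  qed
  then show "mat_adjoint ?R *\<^sub>v v \<in> ?S" if "v \<in> ?S" for v
    by (intro inv[OF that mat_adjoint_carrier[OF rot_tensor_carrier]])
qed

lemma unitary_adjoint: "unitary n U \<Longrightarrow> unitary n (mat_adjoint U)"
  by (simp add: unitary_def)

lemma conj_entry:
  assumes "unitary n U" "A \<in> carrier_mat n n" "i < n" "j < n"
  shows "(U * A * mat_adjoint U) $$ (i, j) = (\<Sum>x<n. \<Sum>y<n. A $$ (x, y) * cnj (U $$ (j, y)) * U $$ (i, x))"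
  using unitary_conj_entry[OF unitary_adjoint[OF assms(1)] assms(2-4)] unitary_dims[OF assms(1)] assms(3,4) by simp

text \<open>The columns of \<open>U\<close> are orthonormal, so on the factor that is traced out the
  conjugation cancels.\<close>

lemma partial_trace_conj:
  assumes U: "unitary p U" and V: "unitary q V" and X: "X \<in> carrier_mat (p * q) (p * q)"
  shows "partial_trace_fst p q (tensor_mat U V * X * mat_adjoint (tensor_mat U V))
    = V * partial_trace_fst p q X * mat_adjoint V"
proof (rule eq_matI)
  have Uc: "U \<in> carrier_mat p p" and Vc: "V \<in> carrier_mat q q" using U V by (auto simp: unitary_def)
  have Y: "partial_trace_fst p q X \<in> carrier_mat q q" by (simp add: partial_trace_fst_def)
  fix j j' assume "j < dim_row (V * partial_trace_fst p q X * mat_adjoint V)"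
    "j' < dim_col (V * partial_trace_fst p q X * mat_adjoint V)"
  then have jj: "j < q" "j' < q" using Vc by auto
  let ?x = "\<lambda>a b c d. X $$ (pair_index q a b, pair_index q c d)"
  let ?v = "\<lambda>b d. cnj (V $$ (j', d)) * V $$ (j, b)"
  have "partial_trace_fst p q (tensor_mat U V * X * mat_adjoint (tensor_mat U V)) $$ (j, j')
      = (\<Sum>k<p. \<Sum>a<p. \<Sum>b<q. \<Sum>c<p. \<Sum>d<q. ?x a b c d * ?v b d * (U $$ (k, a) * cnj (U $$ (k, c))))"
    unfolding partial_trace_fst_entry[OF jj]
  proof (intro sum.cong refl)
    fix k assume "k \<in> {..<p}"
    then have k: "k < p" by simp
    show "(tensor_mat U V * X * mat_adjoint (tensor_mat U V)) $$ (pair_index q k j, pair_index q k j')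
      = (\<Sum>a<p. \<Sum>b<q. \<Sum>c<p. \<Sum>d<q. ?x a b c d * ?v b d * (U $$ (k, a) * cnj (U $$ (k, c))))"
      unfolding conj_entry[OF tensor_mat_unitary[OF U V] X pair_index_less[OF k jj(1)] pair_index_less[OF k jj(2)]]
        sum_pair_index
      using k jj by (intro sum.cong refl) (simp add: tensor_mat_entry[OF Uc Vc])
  qed
  also have "\<dots> = (\<Sum>a<p. \<Sum>b<q. \<Sum>c<p. \<Sum>d<q. \<Sum>k<p. ?x a b c d * ?v b d * (U $$ (k, a) * cnj (U $$ (k, c))))"
    by (rule trans[OF sum.swap], rule sum.cong[OF refl], rule trans[OF sum.swap], rule sum.cong[OF refl],
        rule trans[OF sum.swap], rule sum.cong[OF refl], rule sum.swap)
  also have "\<dots> = (\<Sum>a<p. \<Sum>b<q. \<Sum>c<p. \<Sum>d<q. if c = a then ?x a b a d * ?v b d else 0)"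
  proof (intro sum.cong refl)
    fix a b c d assume *: "a \<in> {..<p}" "c \<in> {..<p}"
    have "(\<Sum>k<p. U $$ (k, a) * cnj (U $$ (k, c))) = (if a = c then 1 else 0)"
      using unitary_frame[OF U order_refl] * by (simp add: frame_def)
    then show "(\<Sum>k<p. ?x a b c d * ?v b d * (U $$ (k, a) * cnj (U $$ (k, c)))) = (if c = a then ?x a b a d * ?v b d else 0)"
      unfolding sum_distrib_left[symmetric] by auto
  qed
  also have "\<dots> = (\<Sum>a<p. \<Sum>b<q. \<Sum>d<q. ?x a b a d * ?v b d)"
  proof (rule sum.cong[OF refl], rule sum.cong[OF refl])
    fix a b assume "a \<in> {..<p}"
    then show "(\<Sum>c<p. \<Sum>d<q. if c = a then ?x a b a d * ?v b d else 0) = (\<Sum>d<q. ?x a b a d * ?v b d)"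
      by (subst sum.swap) simp
  qed
  also have "\<dots> = (\<Sum>b<q. \<Sum>d<q. \<Sum>a<p. ?x a b a d * ?v b d)"
    by (rule trans[OF sum.swap], rule sum.cong[OF refl], rule sum.swap)
  also have "\<dots> = (V * partial_trace_fst p q X * mat_adjoint V) $$ (j, j')"
    unfolding conj_entry[OF V Y jj] by (intro sum.cong refl) (simp add: partial_trace_fst_entry sum_distrib_right mult.assoc)
  finally show "partial_trace_fst p q (tensor_mat U V * X * mat_adjoint (tensor_mat U V)) $$ (j, j')
    = (V * partial_trace_fst p q X * mat_adjoint V) $$ (j, j')" .
qed (use V in \<open>auto simp: partial_trace_fst_def unitary_def\<close>)

lemma P_minus_carrier: "P_minus (real n / 2) (real N / 2) \<in> carrier_mat (Suc n * Suc N) (Suc n * Suc N)"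
  using P_minus_orth_proj(1)[of n N] unfolding is_orth_proj_def by blast

lemma Phi_rot:
  assumes norm: "\<alpha> * cnj \<alpha> + \<beta> * cnj \<beta> = 1" and \<rho>: "\<rho> \<in> carrier_mat (Suc n) (Suc n)"
  shows "Phi (real n / 2) (real N / 2) (rot_op \<alpha> \<beta> n * \<rho> * mat_adjoint (rot_op \<alpha> \<beta> n))
    = rot_op \<alpha> \<beta> N * Phi (real n / 2) (real N / 2) \<rho> * mat_adjoint (rot_op \<alpha> \<beta> N)"
proof -
  let ?U = "rot_op \<alpha> \<beta> n" and ?V = "rot_op \<alpha> \<beta> N" and ?R = "rot_tensor \<alpha> \<beta> n N"
  let ?P = "P_minus (real n / 2) (real N / 2)" and ?d = "Suc n * Suc N" and ?I = "1\<^sub>m (Suc N) :: complex mat"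
  have U: "unitary (Suc n) ?U" and V: "unitary (Suc N) ?V" by (rule rot_op_unitary[OF norm])+
  have Uc: "?U \<in> carrier_mat (Suc n) (Suc n)" and Vc: "?V \<in> carrier_mat (Suc N) (Suc N)" by (rule rot_op_carrier)+
  have Ua: "mat_adjoint ?U \<in> carrier_mat (Suc n) (Suc n)" and Va: "mat_adjoint ?V \<in> carrier_mat (Suc N) (Suc N)"
    using Uc Vc by simp_all
  have U\<rho>: "?U * \<rho> * mat_adjoint ?U \<in> carrier_mat (Suc n) (Suc n)"
    by (rule mult_carrier_mat[OF mult_carrier_mat[OF Uc \<rho>] Ua])
  have T: "tensor_mat \<rho> ?I \<in> carrier_mat ?d ?d" by (rule tensor_mat_carrier[OF \<rho> one_carrier_mat])
  have R: "?R \<in> carrier_mat ?d ?d" by (rule rot_tensor_carrier)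
  have Ra: "mat_adjoint ?R \<in> carrier_mat ?d ?d" by (rule mat_adjoint_carrier[OF R])
  have "mat_adjoint ?R * tensor_mat (?U * \<rho> * mat_adjoint ?U) ?I
      = tensor_mat (mat_adjoint ?U * (?U * \<rho> * mat_adjoint ?U)) (mat_adjoint ?V * ?I)"
    unfolding rot_tensor_def tensor_mat_adjoint by (rule tensor_mat_mult[OF Ua Va U\<rho> one_carrier_mat])
  also have "mat_adjoint ?U * (?U * \<rho> * mat_adjoint ?U) = (mat_adjoint ?U * ?U) * (\<rho> * mat_adjoint ?U)"
    using \<rho> by (simp add: mult_mat_assoc_dim)
  also have "\<dots> = \<rho> * mat_adjoint ?U" using U \<rho> Ua by (simp add: unitary_def)
  \<comment> \<open>The identity on the second factor commutes with the rotation, so the adjoint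
    rotation passes to the right of \<open>tensor_mat \<rho> ?I\<close>.\<close>
  also have "mat_adjoint ?V * ?I = ?I * mat_adjoint ?V" using Va by simp
  also have "tensor_mat (\<rho> * mat_adjoint ?U) (?I * mat_adjoint ?V) = tensor_mat \<rho> ?I * mat_adjoint ?R"
    unfolding rot_tensor_def tensor_mat_adjoint by (rule tensor_mat_mult[OF \<rho> one_carrier_mat Ua Va, symmetric])
  finally have move: "mat_adjoint ?R * tensor_mat (?U * \<rho> * mat_adjoint ?U) ?I = tensor_mat \<rho> ?I * mat_adjoint ?R" .
  note dims = carrier_matD[OF R] carrier_matD[OF T] carrier_matD[OF P_minus_carrier[of n N]]
    carrier_matD[OF tensor_mat_carrier[OF U\<rho> one_carrier_mat[of "Suc N"]]]
  have "?P * tensor_mat (?U * \<rho> * mat_adjoint ?U) ?I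
      = (?R * ?P * mat_adjoint ?R) * tensor_mat (?U * \<rho> * mat_adjoint ?U) ?I"
    by (simp only: P_minus_rot[OF norm])
  also have "\<dots> = (?R * ?P) * (mat_adjoint ?R * tensor_mat (?U * \<rho> * mat_adjoint ?U) ?I)"
    using dims by (simp add: mult_mat_assoc_dim del: mult_Suc mult_Suc_right)
  also have "\<dots> = ?R * (?P * tensor_mat \<rho> ?I) * mat_adjoint ?R"
    unfolding move using dims by (simp add: mult_mat_assoc_dim del: mult_Suc mult_Suc_right)
  finally have eq: "?P * tensor_mat (?U * \<rho> * mat_adjoint ?U) ?I = ?R * (?P * tensor_mat \<rho> ?I) * mat_adjoint ?R" .
  have PT: "?P * tensor_mat \<rho> ?I \<in> carrier_mat ?d ?d" by (rule mult_carrier_mat[OF P_minus_carrier T])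
  show ?thesis
    unfolding Phi_def spin_dim_half eq rot_tensor_def partial_trace_conj[OF U V PT]
    using Vc by (simp add: smult_mult_mat_dim partial_trace_fst_def)
qed

section \<open>Coherent states as rotated highest weight states\<close>

lemma spin_z_number_op:
  "spin_z (real n / 2) = (1 / 2) \<cdot>\<^sub>m number_op 0 0 n + (- 1 / 2) \<cdot>\<^sub>m number_op 1 1 n"
proof (rule eq_matI)
  fix i j assume "i < dim_row ((1 / 2) \<cdot>\<^sub>m number_op 0 0 n + (- 1 / 2) \<cdot>\<^sub>m number_op 1 1 n)"
    "j < dim_col ((1 / 2) \<cdot>\<^sub>m number_op 0 0 n + (- 1 / 2) \<cdot>\<^sub>m number_op 1 1 n)"
  then have ij: "i < Suc n" "j < Suc n" by auto
  then show "spin_z (real n / 2) $$ (i, j) = ((1 / 2) \<cdot>\<^sub>m number_op 0 0 n + (- 1 / 2) \<cdot>\<^sub>m number_op 1 1 n) $$ (i, j)"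
    by (auto simp: spin_half number_op_entry(1) number_op_entry(2)[unfolded One_nat_def] of_nat_diff field_simps)
qed (simp_all add: spin_dims[OF refl spin_dim_half])

text \<open>The hypotheses say that \<open>\<omega>\<close> is the image of the spinor
  \<open>(\<alpha>, \<beta>)\<close> under the Hopf map. Then \<open>\<omega> \<cdot> S\<close> is
  half the difference of the occupations of the two rotated modes.\<close>

lemma spin_dir_number_rot:
  assumes "complex_of_real (vec_nth \<omega> 3) = \<alpha> * cnj \<alpha> - \<beta> * cnj \<beta>"
    and "complex_of_real (vec_nth \<omega> 1) + \<i> * complex_of_real (vec_nth \<omega> 2) = 2 * cnj \<alpha> * \<beta>"
    and "complex_of_real (vec_nth \<omega> 1) - \<i> * complex_of_real (vec_nth \<omega> 2) = 2 * \<alpha> * cnj \<beta>"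
  shows "spin_dir \<omega> (real n / 2) = (1 / 2) \<cdot>\<^sub>m number_rot \<alpha> \<beta> 0 0 n + (- 1 / 2) \<cdot>\<^sub>m number_rot \<alpha> \<beta> 1 1 n"
proof (rule eq_matI)
  fix i j assume "i < dim_row ((1 / 2) \<cdot>\<^sub>m number_rot \<alpha> \<beta> 0 0 n + (- 1 / 2) \<cdot>\<^sub>m number_rot \<alpha> \<beta> 1 1 n)"
    "j < dim_col ((1 / 2) \<cdot>\<^sub>m number_rot \<alpha> \<beta> 0 0 n + (- 1 / 2) \<cdot>\<^sub>m number_rot \<alpha> \<beta> 1 1 n)"
  then have ij: "i < Suc n" "j < Suc n" by auto
  define r s z where "r = raise_entry n i j" and "s = raise_entry n j i" and "z = spin_z (real n / 2) $$ (i, j)"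
  have z: "number_op 0 0 n $$ (i, j) - number_op 1 1 n $$ (i, j) = 2 * z"
    using ij by (simp add: z_def spin_z_number_op)
  define x y where "x = complex_of_real (vec_nth \<omega> 1)" and "y = complex_of_real (vec_nth \<omega> 2)"
  have "spin_dir \<omega> (real n / 2) $$ (i, j)
      = x * ((r + s) / 2) + y * ((r - s) / (2 * \<i>)) + complex_of_real (vec_nth \<omega> 3) * z"
    using ij by (simp add: spin_dir_def spin_half(4,5) spin_dims[OF refl spin_dim_half] r_def s_def z_def x_def y_def)
  also have "\<dots> = ((x - \<i> * y) * r + (x + \<i> * y) * s) / 2 + complex_of_real (vec_nth \<omega> 3) * z"
    by (simp add: field_simps)
  also have "\<dots> = \<alpha> * cnj \<beta> * r + cnj \<alpha> * \<beta> * s + (\<alpha> * cnj \<alpha> - \<beta> * cnj \<beta>) * z"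
    using assms unfolding x_def y_def by simp
  also have "\<dots> = ((1 / 2) \<cdot>\<^sub>m number_rot \<alpha> \<beta> 0 0 n + (- 1 / 2) \<cdot>\<^sub>m number_rot \<alpha> \<beta> 1 1 n) $$ (i, j)"
  proof -
    have z': "number_op 0 0 n $$ (i, j) = 2 * z + number_op 1 1 n $$ (i, j)" using z by (simp add: algebra_simps)
    have "number_rot \<alpha> \<beta> p q n $$ (i, j) = (rot \<alpha> \<beta> 0 p * cnj (rot \<alpha> \<beta> 0 q) * number_op 0 0 n $$ (i, j)
        + rot \<alpha> \<beta> 0 p * cnj (rot \<alpha> \<beta> 1 q) * r)
        + (rot \<alpha> \<beta> 1 p * cnj (rot \<alpha> \<beta> 0 q) * s + rot \<alpha> \<beta> 1 p * cnj (rot \<alpha> \<beta> 1 q) * number_op 1 1 n $$ (i, j))" for p q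
      using ij unfolding number_rot_def sum_two r_def s_def number_op_entry(3,4)[OF ij, symmetric] by simp
    then show ?thesis using ij by (simp add: rot_def z' field_simps)
  qed
  finally show "spin_dir \<omega> (real n / 2) $$ (i, j)
    = ((1 / 2) \<cdot>\<^sub>m number_rot \<alpha> \<beta> 0 0 n + (- 1 / 2) \<cdot>\<^sub>m number_rot \<alpha> \<beta> 1 1 n) $$ (i, j)" .
qed (simp_all add: spin_dir_def spin_dims[OF refl spin_dim_half])

text \<open>A preimage under the Hopf map with \<open>\<alpha>\<close> real and positive, namely
  \<open>sqrt ((1 + z) / 2)\<close>. At the south pole this degenerates, and \<open>(0, 1)\<close>
  is taken instead.\<close>

lemma sphere_spinor:
  fixes \<omega> :: "real ^ 3"
  assumes "\<omega> \<in> sphere 0 1"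
  obtains \<alpha> \<beta> where "\<alpha> * cnj \<alpha> + \<beta> * cnj \<beta> = 1"
    and "complex_of_real (vec_nth \<omega> 3) = \<alpha> * cnj \<alpha> - \<beta> * cnj \<beta>"
    and "complex_of_real (vec_nth \<omega> 1) + \<i> * complex_of_real (vec_nth \<omega> 2) = 2 * cnj \<alpha> * \<beta>"
    and "complex_of_real (vec_nth \<omega> 1) - \<i> * complex_of_real (vec_nth \<omega> 2) = 2 * \<alpha> * cnj \<beta>"
proof -
  define x y z where "x = vec_nth \<omega> 1" and "y = vec_nth \<omega> 2" and "z = vec_nth \<omega> 3"
  have n: "x\<^sup>2 + y\<^sup>2 + z\<^sup>2 = 1"
    using assms by (simp add: norm_vec_def L2_set_def sum_3 x_def y_def z_def)
  show ?thesis
  proof (cases "z = - 1")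
    case True
    then have "x = 0" "y = 0" using n by (simp_all add: sum_power2_eq_zero_iff)
    with True that[of 0 1] show ?thesis by (simp add: x_def y_def z_def)
  next
    case False
    have "z\<^sup>2 \<le> 1" using n by (smt (verit) zero_le_power2)
    then have "\<bar>z\<bar> \<le> 1" by (simp add: abs_square_le_1)
    with False have z: "z + 1 > 0" by linarith
    define a where "a = sqrt ((1 + z) / 2)"
    have a: "a > 0" "a * a = (1 + z) / 2" using z by (simp_all add: a_def)
    define b where "b = Complex (x / (2 * a)) (y / (2 * a))"
    have "b * cnj b = complex_of_real ((x\<^sup>2 + y\<^sup>2) / (4 * (a * a)))"
      unfolding b_def complex_mult_cnj using a(1) by (simp add: power_divide power_mult_distrib add_divide_distrib power2_eq_square)
    also have "(x\<^sup>2 + y\<^sup>2) / (4 * (a * a)) = (1 - z) / 2"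
    proof -
      have "x\<^sup>2 + y\<^sup>2 = (1 - z) * (1 + z)" using n by (simp add: algebra_simps power2_eq_square)
      then show ?thesis unfolding a(2) using z by (simp add: field_simps)
    qed
    finally have b: "b * cnj b = complex_of_real ((1 - z) / 2)" .
    have aa: "complex_of_real a * cnj (complex_of_real a) = complex_of_real ((1 + z) / 2)"
      unfolding complex_cnj_complex_of_real of_real_mult[symmetric] a(2) ..
    have ab: "2 * cnj (complex_of_real a) * b = complex_of_real x + \<i> * complex_of_real y"
      "2 * complex_of_real a * cnj b = complex_of_real x - \<i> * complex_of_real y"
      using a(1) by (simp_all add: b_def complex_eq_iff)
    show ?thesis
      by (rule that[of "complex_of_real a" b]; simp only: aa b ab x_def[symmetric] y_def[symmetric] z_def[symmetric]
          of_real_add[symmetric] of_real_diff[symmetric]) (simp_all add: field_simps)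
  qed
qed

definition highest_state :: "nat \<Rightarrow> complex mat" where
  "highest_state n = mat (Suc n) (Suc n) (\<lambda>(i, j). if i = 0 \<and> j = 0 then 1 else 0)"

text \<open>\<open>\<omega> \<cdot> S\<close> is the conjugate of \<open>spin_z\<close> by the
  rotation, and the top eigenvalue of \<open>spin_z\<close> is simple. So a coherent state is the
  rotated first basis vector up to a phase, which \<open>ketbra\<close> cancels.\<close>

lemma coherent_state_rot:
  assumes \<omega>: "\<omega> \<in> sphere 0 1" and v: "coherent_state (real n / 2) \<omega> v"
  obtains \<alpha> \<beta> where "\<alpha> * cnj \<alpha> + \<beta> * cnj \<beta> = 1"
    and "ketbra v = rot_op \<alpha> \<beta> n * highest_state n * mat_adjoint (rot_op \<alpha> \<beta> n)"
proof -
  from sphere_spinor[OF \<omega>] obtain \<alpha> \<beta> where norm: "\<alpha> * cnj \<alpha> + \<beta> * cnj \<beta> = 1" and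
    dir: "spin_dir \<omega> (real n / 2) = (1 / 2) \<cdot>\<^sub>m number_rot \<alpha> \<beta> 0 0 n + (- 1 / 2) \<cdot>\<^sub>m number_rot \<alpha> \<beta> 1 1 n"
    using spin_dir_number_rot by metis
  let ?U = "rot_op \<alpha> \<beta> n"
  have U: "unitary (Suc n) ?U" by (rule rot_op_unitary[OF norm])
  have Uc: "?U \<in> carrier_mat (Suc n) (Suc n)" by (rule rot_op_carrier)
  then have Ua: "mat_adjoint ?U \<in> carrier_mat (Suc n) (Suc n)" by simp
  from v have vc: "v \<in> carrier_vec (Suc n)" and v1: "v \<bullet>c v = 1"
    and ev: "spin_dir \<omega> (real n / 2) *\<^sub>v v = complex_of_real (real n / 2) \<cdot>\<^sub>v v"
    by (auto simp: coherent_state_def spin_dim_half)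
  have conj: "spin_dir \<omega> (real n / 2) = ?U * spin_z (real n / 2) * mat_adjoint ?U"
    unfolding dir spin_z_number_op
    by (simp add: mat_dim_simps flip: rot_op_conj[OF norm])
  define x where "x = mat_adjoint ?U *\<^sub>v v"
  have xc: "x \<in> carrier_vec (Suc n)" using Ua vc by (simp add: x_def)
  have vx: "v = ?U *\<^sub>v x"
  proof -
    have "?U *\<^sub>v x = (?U * mat_adjoint ?U) *\<^sub>v v" unfolding x_def by (rule assoc_mult_mat_vec[OF Uc Ua vc, symmetric])
    then show ?thesis using U vc by (simp add: unitary_def)
  qed
  have Z: "spin_z (real n / 2) \<in> carrier_mat (Suc n) (Suc n)" by (rule spin_half)
  have "spin_z (real n / 2) *\<^sub>v x = complex_of_real (real n / 2) \<cdot>\<^sub>v x"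
  proof -
    have "mat_adjoint ?U * spin_dir \<omega> (real n / 2) = spin_z (real n / 2) * mat_adjoint ?U"
    proof -
      have "mat_adjoint ?U * spin_dir \<omega> (real n / 2) = (mat_adjoint ?U * ?U) * (spin_z (real n / 2) * mat_adjoint ?U)"
        unfolding conj using Z by (simp add: mult_mat_assoc_dim)
      then show ?thesis using U Z Ua by (simp add: unitary_def)
    qed
    moreover have D: "spin_dir \<omega> (real n / 2) \<in> carrier_mat (Suc n) (Suc n)" 
      unfolding conj by (rule mult_carrier_mat[OF mult_carrier_mat[OF Uc Z] Ua])
    ultimately have "spin_z (real n / 2) *\<^sub>v x = mat_adjoint ?U *\<^sub>v (spin_dir \<omega> (real n / 2) *\<^sub>v v)"
      unfolding x_def using assoc_mult_mat_vec[OF Z Ua vc] assoc_mult_mat_vec[OF Ua D vc] by simp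
    also have "\<dots> = complex_of_real (real n / 2) \<cdot>\<^sub>v x" unfolding ev x_def by (rule mult_mat_vec[OF Ua vc])
    finally show ?thesis .
  qed
  then have "(spin_z (real n / 2) *\<^sub>v x) $ i = complex_of_real (real n / 2) * x $ i" if "i < Suc n" for i
    using that xc by simp
  moreover have "(spin_z (real n / 2) *\<^sub>v x) $ i = complex_of_real (real n / 2 - real i) * x $ i" if "i < Suc n" for i
  proof -
    have "(spin_z (real n / 2) *\<^sub>v x) $ i = (\<Sum>k<Suc n. spin_z (real n / 2) $$ (i, k) * x $ k)"
      using Z xc that by (subst mult_mat_vec_entry) auto
    also have "\<dots> = (\<Sum>k<Suc n. if k = i then complex_of_real (real n / 2 - real i) * x $ i else 0)"
      using that by (intro sum.cong) (auto simp: spin_half)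
    finally show ?thesis using that by simp
  qed
  ultimately have x0: "x $ i = 0" if "0 < i" "i < Suc n" for i
    using that by (force simp: algebra_simps)
  have ventry: "v $ a = ?U $$ (a, 0) * x $ 0" if "a < Suc n" for a
  proof -
    have "v $ a = (\<Sum>k<Suc n. ?U $$ (a, k) * x $ k)"
      unfolding vx using that Uc xc by (subst mult_mat_vec_entry) auto
    also have "\<dots> = (\<Sum>k<Suc n. if k = 0 then ?U $$ (a, 0) * x $ 0 else 0)"
      using x0 by (intro sum.cong) auto
    finally show ?thesis by simp
  qed
  have col: "(\<Sum>a<Suc n. ?U $$ (a, 0) * cnj (?U $$ (a, 0))) = 1"
    using unitary_frame[OF U order_refl] by (simp add: frame_def del: sum.lessThan_Suc)
  have "v \<bullet>c v = (\<Sum>a<Suc n. (?U $$ (a, 0) * cnj (?U $$ (a, 0))) * (x $ 0 * cnj (x $ 0)))"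
    unfolding cscalar_prod_eq_inner_sum[OF vc vc] inner_sum_def by (intro sum.cong) (auto simp: ventry)
  then have phase: "x $ 0 * cnj (x $ 0) = 1" unfolding sum_distrib_right[symmetric] col using v1 by simp
  have H: "highest_state n \<in> carrier_mat (Suc n) (Suc n)" by (simp add: highest_state_def)
  have "ketbra v = ?U * highest_state n * mat_adjoint ?U"
  proof (rule eq_matI)
    fix a b assume "a < dim_row (?U * highest_state n * mat_adjoint ?U)" "b < dim_col (?U * highest_state n * mat_adjoint ?U)"
    then have ab: "a < Suc n" "b < Suc n" by auto
    have "(?U * highest_state n * mat_adjoint ?U) $$ (a, b)
        = (\<Sum>k<Suc n. \<Sum>l<Suc n. if k = 0 \<and> l = 0 then cnj (?U $$ (b, l)) * ?U $$ (a, k) else 0)"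
      unfolding conj_entry[OF U H ab] by (intro sum.cong refl) (auto simp: highest_state_def)
    also have "\<dots> = cnj (?U $$ (b, 0)) * ?U $$ (a, 0)" unfolding sum_double_delta by simp
    also have "\<dots> = (x $ 0 * cnj (x $ 0)) * (cnj (?U $$ (b, 0)) * ?U $$ (a, 0))" unfolding phase by simp
    also have "\<dots> = ketbra v $$ (a, b)" using ab vc by (simp add: ketbra_def ventry)
    finally show "ketbra v $$ (a, b) = (?U * highest_state n * mat_adjoint ?U) $$ (a, b)" ..
  qed (use vc in \<open>auto simp: ketbra_def\<close>)
  with norm that show ?thesis by blast
qed

lemma Phi_carrier: "Phi (real n / 2) (real N / 2) \<rho> \<in> carrier_mat (Suc N) (Suc N)"
  by (simp add: Phi_def partial_trace_fst_def spin_dim_half)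

lemma eigenvalue_seq_coherent:
  assumes "\<omega> \<in> sphere 0 1" "coherent_state (real n / 2) \<omega> v"
  shows "eigenvalue_seq (Phi (real n / 2) (real N / 2) (ketbra v))
    = eigenvalue_seq (Phi (real n / 2) (real N / 2) (highest_state n))"
proof -
  from coherent_state_rot[OF assms] obtain \<alpha> \<beta> where norm: "\<alpha> * cnj \<alpha> + \<beta> * cnj \<beta> = 1"
    and v: "ketbra v = rot_op \<alpha> \<beta> n * highest_state n * mat_adjoint (rot_op \<alpha> \<beta> n)" .
  have "highest_state n \<in> carrier_mat (Suc n) (Suc n)" by (simp add: highest_state_def)
  from Phi_rot[OF norm this, of N] eigenvalue_seq_unitary[OF unitary_adjoint[OF rot_op_unitary[OF norm]] Phi_carrier, of N n "highest_state n"]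
  show ?thesis unfolding v by simp
qed

section \<open>Majorization\<close>

lemma Phi_entry:
  assumes \<rho>: "\<rho> \<in> carrier_mat (Suc n) (Suc n)" and j: "j \<le> N" "j' \<le> N"
  shows "Phi (real n / 2) (real N / 2) \<rho> $$ (j, j')
    = complex_of_real ((real n + 1) / (real (min_dim n N) + 1)) *
      (\<Sum>k\<le>n. \<Sum>i\<le>n. complex_of_real (\<Sum>l\<le>min_dim n N. min_vec n N l k j * min_vec n N l i j') * \<rho> $$ (i, k))"
proof -
  let ?P = "P_minus (real n / 2) (real N / 2)" and ?d = "Suc n * Suc N" and ?T = "tensor_mat \<rho> (1\<^sub>m (Suc N))"
  have T: "?T \<in> carrier_mat ?d ?d" by (rule tensor_mat_carrier[OF \<rho> one_carrier_mat])
  have jj: "j < Suc N" "j' < Suc N" using j by auto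
  have c: "(2 * (real n / 2) + 1) / (2 * \<bar>real N / 2 - real n / 2\<bar> + 1) = (real n + 1) / (real (min_dim n N) + 1)"
    by (auto simp: min_dim_def of_nat_diff)
  have "partial_trace_fst (Suc n) (Suc N) (?P * ?T) $$ (j, j')
      = (\<Sum>k<Suc n. \<Sum>i<Suc n. \<Sum>b<Suc N. ?P $$ (pair_index (Suc N) k j, pair_index (Suc N) i b)
          * ?T $$ (pair_index (Suc N) i b, pair_index (Suc N) k j'))"
    unfolding partial_trace_fst_entry[OF jj]
  proof (intro sum.cong refl)
    fix k assume "k \<in> {..<Suc n}"
    then have k: "k < Suc n" by simp
    show "(?P * ?T) $$ (pair_index (Suc N) k j, pair_index (Suc N) k j')
      = (\<Sum>i<Suc n. \<Sum>b<Suc N. ?P $$ (pair_index (Suc N) k j, pair_index (Suc N) i b)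
          * ?T $$ (pair_index (Suc N) i b, pair_index (Suc N) k j'))"
      by (rule mult_pair_entry[OF P_minus_carrier T pair_index_less[OF k jj(1)] pair_index_less[OF k jj(2)]])
  qed
  also have "\<dots> = (\<Sum>k<Suc n. \<Sum>i<Suc n. \<Sum>b<Suc N. if b = j' then
      complex_of_real (\<Sum>l\<le>min_dim n N. min_vec n N l k j * min_vec n N l i j') * \<rho> $$ (i, k) else 0)"
  proof (intro sum.cong refl)
    fix k i b assume *: "k \<in> {..<Suc n}" "i \<in> {..<Suc n}" "b \<in> {..<Suc N}"
    then have "?T $$ (pair_index (Suc N) i b, pair_index (Suc N) k j') = \<rho> $$ (i, k) * (1\<^sub>m (Suc N) $$ (b, j'))"
      using jj by (intro tensor_mat_entry[OF \<rho> one_carrier_mat]) auto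
    moreover have "?P $$ (pair_index (Suc N) k j, pair_index (Suc N) i b)
        = complex_of_real (\<Sum>l\<le>min_dim n N. min_vec n N l k j * min_vec n N l i b)"
      using * j by (intro P_minus_orth_proj(2)) auto
    ultimately show "?P $$ (pair_index (Suc N) k j, pair_index (Suc N) i b)
          * ?T $$ (pair_index (Suc N) i b, pair_index (Suc N) k j') = (if b = j' then
      complex_of_real (\<Sum>l\<le>min_dim n N. min_vec n N l k j * min_vec n N l i j') * \<rho> $$ (i, k) else 0)"
      using * jj by auto
  qed
  also have "\<dots> = (\<Sum>k\<le>n. \<Sum>i\<le>n. complex_of_real (\<Sum>l\<le>min_dim n N. min_vec n N l k j * min_vec n N l i j') * \<rho> $$ (i, k))"
    using jj by (simp add: lessThan_Suc_atMost del: sum.lessThan_Suc)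
  finally show ?thesis
    unfolding Phi_def spin_dim_half c using jj by (simp add: partial_trace_fst_def del: sum.lessThan_Suc)
qed

text \<open>The partial trace of \<open>P_minus\<close> over spin \<open>K\<close>, a multiple of
  the identity on spin \<open>J\<close> as Schur's lemma predicts. This is what makes
  \<open>Phi\<close> trace preserving.\<close>

lemma min_vec_partial_trace:
  assumes "i \<le> n" "k \<le> n"
  shows "(\<Sum>l\<le>min_dim n N. \<Sum>j\<le>N. min_vec n N l k j * min_vec n N l i j)
    = (if k = i then (real (min_dim n N) + 1) / (real n + 1) else 0)"
proof (cases "k = i")
  case False
  then have "min_vec n N l k j * min_vec n N l i j = 0" for l j
    by (auto simp: min_vec_def min_vec_le_def)
  with False show ?thesis by simp
next
  case k: True
  show ?thesis
  proof (cases "n \<le> N")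
    case True
    define m where "m = N - n"
    define c where "c = (real m + 1) / (real N + 1)"
    have "(\<Sum>l\<le>m. \<Sum>j\<le>N. min_vec_le n N l i j * min_vec_le n N l i j)
        = (\<Sum>l\<le>m. c * (real (m choose l) * real (n choose (n - i)) / real (m + n choose (l + (n - i)))))"
    proof (intro sum.cong refl)
      fix l assume l: "l \<in> {..m}"
      have "(\<Sum>j\<le>N. min_vec_le n N l i j * min_vec_le n N l i j)
          = (\<Sum>j\<le>N. if j = l + (n - i) then c * (real (m choose l) * real (n choose (n - i)) / real (m + n choose (l + (n - i)))) else 0)"
        unfolding min_vec_le_sq using assms True binomial_symmetric[of i n]
        by (intro sum.cong) (auto simp: c_def m_def)
      also have "\<dots> = c * (real (m choose l) * real (n choose (n - i)) / real (m + n choose (l + (n - i))))"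
      proof -
        have "l + (n - i) \<in> {..N}" using l True by (auto simp: m_def)
        then show ?thesis by (subst sum.delta) auto
      qed
      finally show "(\<Sum>j\<le>N. min_vec_le n N l i j * min_vec_le n N l i j)
          = c * (real (m choose l) * real (n choose (n - i)) / real (m + n choose (l + (n - i))))" .
    qed
    also have "\<dots> = c * ((real (m + n) + 1) / (real n + 1))"
      unfolding sum_distrib_left[symmetric] by (subst sum_choose_ratio) auto
    also have "\<dots> = (real m + 1) / (real n + 1)"
      using True by (simp add: c_def m_def add_eq_0_iff_both_eq_0)
    finally show ?thesis using True k by (simp add: min_vec_def min_dim_def m_def)
  next
    case False
    define m where "m = n - N"
    define c where "c = (real m + 1) / (real n + 1)"
    have "(\<Sum>l\<le>m. \<Sum>j\<le>N. min_vec_le N n l j i * min_vec_le N n l j i)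
        = (\<Sum>l\<le>m. \<Sum>t\<le>N. c * (cg N m l i t * cg N m l i t))"
    proof (rule sum.cong[OF refl])
      fix l
      \<comment> \<open>Squared, and with the index on the smaller spin reversed, these coefficients
        are those of \<open>cg\<close> up to the factor \<open>c\<close>.\<close>
      have "min_vec_le N n l t i * min_vec_le N n l t i = c * (cg N m l i (N - t) * cg N m l i (N - t))" if "t \<le> N" for t
        unfolding min_vec_le_sq cg_sq using that False binomial_symmetric[of t N]
        by (auto simp: c_def m_def)
      then show "(\<Sum>j\<le>N. min_vec_le N n l j i * min_vec_le N n l j i) = (\<Sum>t\<le>N. c * (cg N m l i t * cg N m l i t))"
        by (intro sum.reindex_bij_witness[of _ "\<lambda>t. N - t" "\<lambda>t. N - t"]) auto
    qed
    also have "\<dots> = c"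
      unfolding sum_distrib_left[symmetric] using cg_partial_trace[of i N m] assms False by (simp add: m_def)
    finally show ?thesis using False k by (simp add: min_vec_def min_dim_def m_def c_def)
  qed
qed

lemma mat_trace_Phi:
  assumes \<rho>: "\<rho> \<in> carrier_mat (Suc n) (Suc n)"
  shows "mat_trace (Phi (real n / 2) (real N / 2) \<rho>) = mat_trace \<rho>"
proof -
  define c where "c = (real n + 1) / (real (min_dim n N) + 1)"
  have "mat_trace (Phi (real n / 2) (real N / 2) \<rho>) = (\<Sum>j\<le>N. Phi (real n / 2) (real N / 2) \<rho> $$ (j, j))"
    using Phi_carrier[of n N \<rho>] by (auto simp: mat_trace_def lessThan_Suc_atMost)
  also have "\<dots> = complex_of_real c * (\<Sum>j\<le>N. \<Sum>k\<le>n. \<Sum>i\<le>n.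
      complex_of_real (\<Sum>l\<le>min_dim n N. min_vec n N l k j * min_vec n N l i j) * \<rho> $$ (i, k))"
    by (simp add: Phi_entry[OF \<rho>] c_def sum_distrib_left)
  also have "(\<Sum>j\<le>N. \<Sum>k\<le>n. \<Sum>i\<le>n.
      complex_of_real (\<Sum>l\<le>min_dim n N. min_vec n N l k j * min_vec n N l i j) * \<rho> $$ (i, k))
    = (\<Sum>k\<le>n. \<Sum>i\<le>n. \<Sum>j\<le>N. complex_of_real (\<Sum>l\<le>min_dim n N. min_vec n N l k j * min_vec n N l i j) * \<rho> $$ (i, k))"
    by (rule trans[OF sum.swap], rule sum.cong[OF refl], rule sum.swap)
  also have "\<dots> = (\<Sum>k\<le>n. \<Sum>i\<le>n. if i = k then complex_of_real (1 / c) * \<rho> $$ (k, k) else 0)"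
  proof (intro sum.cong refl)
    fix k i assume *: "k \<in> {..n}" "i \<in> {..n}"
    have "(\<Sum>j\<le>N. complex_of_real (\<Sum>l\<le>min_dim n N. min_vec n N l k j * min_vec n N l i j) * \<rho> $$ (i, k))
      = complex_of_real (\<Sum>j\<le>N. \<Sum>l\<le>min_dim n N. min_vec n N l k j * min_vec n N l i j) * \<rho> $$ (i, k)"
      by (simp only: of_real_sum sum_distrib_right)
    also have "(\<Sum>j\<le>N. \<Sum>l\<le>min_dim n N. min_vec n N l k j * min_vec n N l i j)
      = (if k = i then 1 / c else 0)"
      using * by (subst sum.swap, subst min_vec_partial_trace) (auto simp: c_def)
    finally show "(\<Sum>j\<le>N. complex_of_real (\<Sum>l\<le>min_dim n N. min_vec n N l k j * min_vec n N l i j) * \<rho> $$ (i, k))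
      = (if i = k then complex_of_real (1 / c) * \<rho> $$ (k, k) else 0)" by auto
  qed
  also have "\<dots> = complex_of_real (1 / c) * (\<Sum>k\<le>n. \<rho> $$ (k, k))" by (simp add: sum_distrib_left)
  also have "complex_of_real c * (complex_of_real (1 / c) * (\<Sum>k\<le>n. \<rho> $$ (k, k))) = (\<Sum>k\<le>n. \<rho> $$ (k, k))"
  proof -
    have "c * (1 / c) = 1" by (simp add: c_def add_eq_0_iff_both_eq_0)
    then show ?thesis unfolding mult.assoc[symmetric] of_real_mult[symmetric] by (simp only: of_real_1 mult_1_left)
  qed
  also have "\<dots> = mat_trace \<rho>" using \<rho> by (auto simp: mat_trace_def lessThan_Suc_atMost)
  finally show ?thesis .
qed

lemma pos_semidefI:
  assumes A: "A \<in> carrier_mat n n" and "finite I" "0 \<le> c"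
    and entry: "\<And>x y. x < n \<Longrightarrow> y < n \<Longrightarrow> A $$ (x, y) = complex_of_real c * (\<Sum>s\<in>I. w s x * cnj (w s y))"
  shows "pos_semidef n A"
  unfolding pos_semidef_def
proof (intro conjI ballI)
  fix v :: "complex Matrix.vec" assume v: "v \<in> carrier_vec n"
  have "(A *\<^sub>v v) \<bullet>c v = (\<Sum>x<n. (\<Sum>y<n. A $$ (x, y) * v $ y) * cnj (v $ x))"
    unfolding cscalar_prod_eq_inner_sum[OF mult_mat_vec_carrier[OF A v] v] inner_sum_def
    using A v by (intro sum.cong refl) (auto simp: mult_mat_vec_entry simp del: index_mult_mat_vec)
  also have "\<dots> = (\<Sum>x<n. \<Sum>y<n. \<Sum>s\<in>I. complex_of_real c * ((w s x * cnj (v $ x)) * cnj (w s y * cnj (v $ y))))"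
    by (simp add: entry sum_distrib_left sum_distrib_right ac_simps)
  also have "\<dots> = (\<Sum>s\<in>I. \<Sum>x<n. \<Sum>y<n. complex_of_real c * ((w s x * cnj (v $ x)) * cnj (w s y * cnj (v $ y))))"
    by (simp only: sum.swap[of _ _ I])
  also have "\<dots> = (\<Sum>s\<in>I. complex_of_real c * ((\<Sum>x<n. w s x * cnj (v $ x)) * cnj (\<Sum>y<n. w s y * cnj (v $ y))))"
    unfolding cnj_sum sum_product by (simp only: sum_distrib_left)
  also have "\<dots> = complex_of_real (c * (\<Sum>s\<in>I. (cmod (\<Sum>x<n. w s x * cnj (v $ x)))\<^sup>2))"
    by (simp only: complex_norm_square[symmetric] of_real_mult of_real_sum sum_distrib_left)
  finally show "0 \<le> (A *\<^sub>v v) \<bullet>c v"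
    using assms(3) by (simp add: less_eq_complex_def sum_nonneg del: of_real_mult of_real_sum)
qed (rule A)

text \<open>A Kraus form: \<open>\<rho>\<close> is split into the rank one terms of
  \<open>\<phi> t\<close> and the projection into those of \<open>min_vec\<close>, and each pair
  contributes a rank one term.\<close>

lemma Phi_pos_semidef:
  assumes \<rho>: "pos_semidef (Suc n) \<rho>"
  shows "pos_semidef (Suc N) (Phi (real n / 2) (real N / 2) \<rho>)"
proof -
  have \<rho>c: "\<rho> \<in> carrier_mat (Suc n) (Suc n)" using \<rho> by (simp add: pos_semidef_def)
  from pos_semidef_decomposition[OF \<rho>] obtain \<phi> where
    \<phi>: "\<And>x y. x < Suc n \<Longrightarrow> y < Suc n \<Longrightarrow> \<rho> $$ (x, y) = (\<Sum>t<Suc n. \<phi> t x * cnj (\<phi> t y))" by blast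
  define w where "w = (\<lambda>(l, t) j. \<Sum>k\<le>n. complex_of_real (min_vec n N l k j) * cnj (\<phi> t k))"
  show ?thesis
  proof (rule pos_semidefI[OF Phi_carrier, where I = "{..min_dim n N} \<times> {..n}" and w = w
        and c = "(real n + 1) / (real (min_dim n N) + 1)"])
    fix j j' assume "j < Suc N" "j' < Suc N"
    then have j: "j \<le> N" "j' \<le> N" by auto
    have "(\<Sum>k\<le>n. \<Sum>i\<le>n. complex_of_real (\<Sum>l\<le>min_dim n N. min_vec n N l k j * min_vec n N l i j') * \<rho> $$ (i, k))
        = (\<Sum>k\<le>n. \<Sum>i\<le>n. \<Sum>l\<le>min_dim n N. \<Sum>t\<le>n. (complex_of_real (min_vec n N l k j) * cnj (\<phi> t k))
            * cnj (complex_of_real (min_vec n N l i j') * cnj (\<phi> t i)))"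
    proof (rule sum.cong[OF refl], rule sum.cong[OF refl])
      fix k i assume "k \<in> {..n}" "i \<in> {..n}"
      then have "\<rho> $$ (i, k) = (\<Sum>t\<le>n. \<phi> t i * cnj (\<phi> t k))"
        using \<phi>[of i k] by (simp only: less_Suc_eq_le lessThan_Suc_atMost atMost_iff)
      then show "complex_of_real (\<Sum>l\<le>min_dim n N. min_vec n N l k j * min_vec n N l i j') * \<rho> $$ (i, k)
        = (\<Sum>l\<le>min_dim n N. \<Sum>t\<le>n. (complex_of_real (min_vec n N l k j) * cnj (\<phi> t k))
            * cnj (complex_of_real (min_vec n N l i j') * cnj (\<phi> t i)))"
        by (simp only: of_real_sum sum_product) (simp add: ac_simps)
    qed
    also have "\<dots> = (\<Sum>k\<le>n. \<Sum>l\<le>min_dim n N. \<Sum>t\<le>n. \<Sum>i\<le>n. (complex_of_real (min_vec n N l k j) * cnj (\<phi> t k))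
            * cnj (complex_of_real (min_vec n N l i j') * cnj (\<phi> t i)))"
      by (rule sum.cong[OF refl], rule trans[OF sum.swap], rule sum.cong[OF refl], rule sum.swap)
    also have "\<dots> = (\<Sum>l\<le>min_dim n N. \<Sum>t\<le>n. \<Sum>k\<le>n. \<Sum>i\<le>n. (complex_of_real (min_vec n N l k j) * cnj (\<phi> t k))
            * cnj (complex_of_real (min_vec n N l i j') * cnj (\<phi> t i)))"
      by (rule trans[OF sum.swap], rule sum.cong[OF refl], rule sum.swap)
    also have "\<dots> = (\<Sum>l\<le>min_dim n N. \<Sum>t\<le>n. w (l, t) j * cnj (w (l, t) j'))"
      unfolding w_def prod.case cnj_sum sum_product ..
    also have "\<dots> = (\<Sum>s\<in>{..min_dim n N} \<times> {..n}. w s j * cnj (w s j'))"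
      by (simp add: sum.cartesian_product)
    finally show "Phi (real n / 2) (real N / 2) \<rho> $$ (j, j')
      = complex_of_real ((real n + 1) / (real (min_dim n N) + 1)) * (\<Sum>s\<in>{..min_dim n N} \<times> {..n}. w s j * cnj (w s j'))"
      unfolding Phi_entry[OF \<rho>c j] by (simp only:)
  qed auto
qed

lemma Phi_density:
  assumes "density_matrix (Suc n) \<rho>"
  shows "density_matrix (Suc N) (Phi (real n / 2) (real N / 2) \<rho>)"
  using assms Phi_pos_semidef[of n \<rho> N] mat_trace_Phi[of \<rho> n N]
  by (simp add: density_matrix_def pos_semidef_def)

text \<open>
  The map \<open>Phi\<close> transposes its argument; the time reversal \<open>e\<^sub>i \<mapsto> (- 1)\<^sup>i e\<^sub>n\<^sub>-\<^sub>i\<close> turns the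
  projection onto the minimal spin in \<open>J \<otimes> K\<close> into the coupling of \<open>J\<close> and \<open>K - J\<close> to \<open>K\<close>.
\<close>

lemma Phi_clone:
  assumes nN: "n \<le> N" and \<rho>: "\<rho> \<in> carrier_mat (Suc n) (Suc n)" and j: "j \<le> N" "j' \<le> N"
  shows "Phi (real n / 2) (real N / 2) \<rho> $$ (j, j')
    = clone n (N - n) (\<lambda>a b. (- 1) ^ (a + b) * \<rho> $$ (n - b, n - a)) j j'"
proof -
  define m where "m = N - n"
  have m: "n + m = N" "min_dim n N = m" using nN by (auto simp: m_def min_dim_def)
  define c where "c = (real m + 1) / (real N + 1)"
  have mv: "min_vec n N l (n - a) j * min_vec n N l (n - b) j'
      = c * ((- 1) ^ (a + b) * (cg n m l j a * cg n m l j' b))" if "a \<le> n" "b \<le> n" for l a b j j'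
  proof -
    \<comment> \<open>Replacing \<open>a\<close> by \<open>n - a\<close> is the index reversal in
      the time reversal; the sign \<open>(- 1) ^ n\<close> is common to both factors and squares to
      one.\<close>
    have one: "min_vec n N l (n - a) j = (- 1) ^ n * (- 1) ^ a * (sqrt c * cg n m l j a)" if "a \<le> n" for a j
    proof -
      have "(- 1) ^ (n - a) = (- 1) ^ n * ((- 1) ^ a :: real)"
        using that by (simp add: minus_one_power_iff)
      moreover have "sqrt_binom n (n - a) = sqrt_binom n a"
        unfolding sqrt_binom_def using that binomial_symmetric[of a n] by simp
      moreover have "n - a + j = n + l \<longleftrightarrow> j = a + l" using that by auto
      ultimately show ?thesis
        using nN unfolding min_vec_def min_vec_le_def cg_def c_def m(1) m_def[symmetric] by simp
    qed
    have sq: "sqrt c * sqrt c = c" by (simp add: c_def)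
    have ring: "(- 1) ^ n * (- 1) ^ a * (s * x) * ((- 1) ^ n * (- 1) ^ b * (s * y))
        = ((- 1) ^ n * (- 1) ^ n) * ((s * s) * ((- 1) ^ (a + b) * (x * y)))" for s x y :: real
      by (simp add: power_add ac_simps)
    have sign: "(- 1) ^ n * (- 1) ^ n = (1 :: real)" by (simp flip: power_add)
    show ?thesis unfolding one[OF that(1)] one[OF that(2)] ring sq sign by simp
  qed
  have reflect: "(\<Sum>k\<le>n. f k) = (\<Sum>a\<le>n. f (n - a))" for f :: "nat \<Rightarrow> complex"
    by (rule sum.reindex_bij_witness[of _ "\<lambda>a. n - a" "\<lambda>a. n - a"]) auto
  have "(\<Sum>k\<le>n. \<Sum>i\<le>n. complex_of_real (\<Sum>l\<le>m. min_vec n N l k j * min_vec n N l i j') * \<rho> $$ (i, k))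
      = (\<Sum>a\<le>n. \<Sum>b\<le>n. complex_of_real (\<Sum>l\<le>m. min_vec n N l (n - a) j * min_vec n N l (n - b) j') * \<rho> $$ (n - b, n - a))"
    by (subst reflect, rule sum.cong[OF refl], subst reflect, rule refl)
  also have "\<dots> = (\<Sum>a\<le>n. \<Sum>b\<le>n. \<Sum>l\<le>m. complex_of_real c *
      (complex_of_real (cg n m l j a * cg n m l j' b) * ((- 1) ^ (a + b) * \<rho> $$ (n - b, n - a))))"
  proof (rule sum.cong[OF refl], rule sum.cong[OF refl])
    fix a b assume "a \<in> {..n}" "b \<in> {..n}"
    then show "complex_of_real (\<Sum>l\<le>m. min_vec n N l (n - a) j * min_vec n N l (n - b) j') * \<rho> $$ (n - b, n - a)
      = (\<Sum>l\<le>m. complex_of_real c *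
      (complex_of_real (cg n m l j a * cg n m l j' b) * ((- 1) ^ (a + b) * \<rho> $$ (n - b, n - a))))"
      unfolding of_real_sum sum_distrib_right by (intro sum.cong refl) (simp add: mv)
  qed
  also have "\<dots> = (\<Sum>l\<le>m. \<Sum>a\<le>n. \<Sum>b\<le>n. complex_of_real c *
      (complex_of_real (cg n m l j a * cg n m l j' b) * ((- 1) ^ (a + b) * \<rho> $$ (n - b, n - a))))"
    by (rule trans[OF sum.cong[OF refl sum.swap] sum.swap])
  also have "\<dots> = complex_of_real c * (\<Sum>l\<le>m. \<Sum>a\<le>n. \<Sum>b\<le>n.
      complex_of_real (cg n m l j a * cg n m l j' b) * ((- 1) ^ (a + b) * \<rho> $$ (n - b, n - a)))"
    by (simp only: sum_distrib_left)
  finally have eq: "(\<Sum>k\<le>n. \<Sum>i\<le>n. complex_of_real (\<Sum>l\<le>m. min_vec n N l k j * min_vec n N l i j') * \<rho> $$ (i, k)) = \<dots>" .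
  have "(real n + 1) / (real m + 1) * c = (real n + 1) / (real (n + m) + 1)"
    unfolding c_def m(1) by (simp add: add_eq_0_iff_both_eq_0)
  then show ?thesis
    unfolding Phi_entry[OF \<rho> j] m(2) eq clone_def m_def[symmetric] mult.assoc[symmetric] of_real_mult[symmetric]
    by (simp only:)
qed

section \<open>Comparison with the image of the highest weight state\<close>

text \<open>A density matrix is a sum of rank one terms whose squared norms add up to its trace, and
  the bound for pure states is linear in the squared norm.\<close>

lemma Phi_ky_fan:
  assumes nN: "n \<le> N" and \<rho>: "density_matrix (Suc n) \<rho>"
  shows "ky_fan_le (Suc N) (\<lambda>x y. Phi (real n / 2) (real N / 2) \<rho> $$ (x, y)) k (coherent_sum n (N - n) k)"
proof -
  have psd: "pos_semidef (Suc n) \<rho>" and \<rho>c: "\<rho> \<in> carrier_mat (Suc n) (Suc n)" and tr: "mat_trace \<rho> = 1"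
    using \<rho> by (auto simp: density_matrix_def pos_semidef_def)
  from pos_semidef_decomposition[OF psd] obtain \<phi> where
    \<phi>: "\<And>x y. x < Suc n \<Longrightarrow> y < Suc n \<Longrightarrow> \<rho> $$ (x, y) = (\<Sum>t<Suc n. \<phi> t x * cnj (\<phi> t y))" by blast
  \<comment> \<open>Time reversal is antilinear, whence the conjugate, which also accounts for the
    transposition performed by \<open>Phi\<close>.\<close>
  define \<psi> where "\<psi> t a = (- 1) ^ a * cnj (\<phi> t (n - a))" for t a
  have "complex_of_real (\<Sum>t\<le>n. \<Sum>a\<le>n. (cmod (\<psi> t a))\<^sup>2) = (\<Sum>t\<le>n. \<Sum>a\<le>n. \<phi> t (n - a) * cnj (\<phi> t (n - a)))"
    unfolding \<psi>_def by (simp add: norm_mult norm_power flip: complex_norm_square)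
  also have "\<dots> = (\<Sum>t\<le>n. \<Sum>i\<le>n. \<phi> t i * cnj (\<phi> t i))"
    by (intro sum.cong refl sum.reindex_bij_witness[of _ "\<lambda>a. n - a" "\<lambda>a. n - a"]) auto
  also have "\<dots> = (\<Sum>i\<le>n. \<rho> $$ (i, i))"
    by (subst sum.swap) (simp add: \<phi> less_Suc_eq_le lessThan_Suc_atMost del: sum.lessThan_Suc)
  also have "\<dots> = 1" using tr \<rho>c by (simp add: mat_trace_def lessThan_Suc_atMost del: sum.lessThan_Suc)
  finally have norm: "(\<Sum>t\<le>n. \<Sum>a\<le>n. (cmod (\<psi> t a))\<^sup>2) = 1" by (simp only: of_real_eq_1_iff)
  have "ky_fan_le (Suc (n + (N - n))) (\<lambda>x y. \<Sum>t\<le>n. clone n (N - n) (\<lambda>a b. \<psi> t a * cnj (\<psi> t b)) x y) k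
      (\<Sum>t\<le>n. coherent_sum n (N - n) k * (\<Sum>a\<le>n. (cmod (\<psi> t a))\<^sup>2))"
    by (intro ky_fan_le_sum clone_pure_ky_fan)
  then have kf: "ky_fan_le (Suc N) (\<lambda>x y. \<Sum>t\<le>n. clone n (N - n) (\<lambda>a b. \<psi> t a * cnj (\<psi> t b)) x y) k
      (coherent_sum n (N - n) k)"
    using nN unfolding sum_distrib_left[symmetric] norm by simp
  show ?thesis
  proof (rule ky_fan_le_cong[OF kf _ refl])
    fix x y assume "x < Suc N" "y < Suc N"
    then have xy: "x \<le> N" "y \<le> N" by auto
    have \<sigma>: "(- 1) ^ (a + b) * \<rho> $$ (n - b, n - a) = (\<Sum>t\<le>n. \<psi> t a * cnj (\<psi> t b))" if "a \<le> n" "b \<le> n" for a b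
      using that by (simp add: \<phi> \<psi>_def less_Suc_eq_le lessThan_Suc_atMost sum_distrib_left power_add ac_simps del: sum.lessThan_Suc)
    have "clone n (N - n) (\<lambda>a b. (- 1) ^ (a + b) * \<rho> $$ (n - b, n - a)) x y
        = clone n (N - n) (\<lambda>a b. \<Sum>t\<le>n. \<psi> t a * cnj (\<psi> t b)) x y"
      unfolding clone_def by (intro arg_cong2[where f = "(*)"] sum.cong refl) (simp add: \<sigma>)
    also have "\<dots> = (\<Sum>t\<le>n. clone n (N - n) (\<lambda>a b. \<psi> t a * cnj (\<psi> t b)) x y)"
    proof -
      have "(\<Sum>l\<le>N - n. \<Sum>a\<le>n. \<Sum>b\<le>n. f l a b * (\<Sum>t\<le>n. g t a b))
          = (\<Sum>t\<le>n. \<Sum>l\<le>N - n. \<Sum>a\<le>n. \<Sum>b\<le>n. f l a b * g t a b)" for f g :: "nat \<Rightarrow> nat \<Rightarrow> nat \<Rightarrow> complex"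
      proof -
        have "(\<Sum>a\<le>n. \<Sum>b\<le>n. \<Sum>t\<le>n. f l a b * g t a b) = (\<Sum>t\<le>n. \<Sum>a\<le>n. \<Sum>b\<le>n. f l a b * g t a b)" for l
          by (rule trans[OF sum.cong[OF refl sum.swap] sum.swap])
        then have "(\<Sum>l\<le>N - n. \<Sum>a\<le>n. \<Sum>b\<le>n. f l a b * (\<Sum>t\<le>n. g t a b))
            = (\<Sum>l\<le>N - n. \<Sum>t\<le>n. \<Sum>a\<le>n. \<Sum>b\<le>n. f l a b * g t a b)"
          by (simp only: sum_distrib_left)
        also have "\<dots> = (\<Sum>t\<le>n. \<Sum>l\<le>N - n. \<Sum>a\<le>n. \<Sum>b\<le>n. f l a b * g t a b)" by (rule sum.swap)
        finally show ?thesis .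
      qed
      then show ?thesis unfolding clone_def sum_distrib_left[symmetric] by (simp only:)
    qed
    finally show "(\<Sum>t\<le>n. clone n (N - n) (\<lambda>a b. \<psi> t a * cnj (\<psi> t b)) x y)
        = Phi (real n / 2) (real N / 2) \<rho> $$ (x, y)"
      unfolding Phi_clone[OF nN \<rho>c xy] ..
  qed
qed

lemma highest_state_carrier: "highest_state n \<in> carrier_mat (Suc n) (Suc n)"
  by (simp add: highest_state_def)

lemma mat_trace_highest_state: "mat_trace (highest_state n) = 1"
proof -
  have "mat_trace (highest_state n) = (\<Sum>i<Suc n. if i = 0 then 1 else 0)"
    by (auto simp: mat_trace_def highest_state_def simp del: sum.lessThan_Suc intro!: sum.cong)
  then show ?thesis by simp
qed

text \<open>From \<open>i\<close> to \<open>i + 1\<close> the ratio changes by the factor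
  \<open>(m - i) / (N - i)\<close>, at most one. Hence the terms of \<open>coherent_sum\<close> are
  in decreasing order and its partial sums are sums of largest eigenvalues.\<close>

lemma choose_ratio_antimono:
  assumes "m \<le> N" "Suc i \<le> N"
  shows "real (m choose Suc i) / real (N choose Suc i) \<le> real (m choose i) / real (N choose i)"
proof -
  have absorb: "real (Suc i) * real (M choose Suc i) = real (M - i) * real (M choose i)" for M
    unfolding of_nat_mult[symmetric] by (simp only: binomial_absorption binomial_absorb_comp)
  have pos: "real (N choose i) > 0" "real (N choose Suc i) > 0" "real (Suc i) > 0" using assms by auto
  have "real (Suc i) * real (m choose Suc i) * real (N choose i) \<le> real (Suc i) * real (N choose Suc i) * real (m choose i)"
  proof -
    have "real (m - i) * (real (m choose i) * real (N choose i)) \<le> real (N - i) * (real (m choose i) * real (N choose i))"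
      using assms by (intro mult_right_mono) auto
    then show ?thesis unfolding absorb by (simp only: ac_simps)
  qed
  then have "real (m choose Suc i) * real (N choose i) \<le> real (m choose i) * real (N choose Suc i)"
    using pos(3) by (simp add: mult.assoc mult.commute del: of_nat_Suc)
  with pos show ?thesis by (simp add: frac_le_eq divide_le_eq field_simps del: of_nat_Suc)
qed

text \<open>The diagonal is reversed because \<open>Phi\<close> inverts the direction of the spin:
  the image of the highest weight state has its largest entry at the index \<open>N\<close>.\<close>

lemma eigenvalue_seq_increasing_diagonal:
  assumes A: "A \<in> carrier_mat (Suc N) (Suc N)"
    and diag: "\<And>i j. i \<le> N \<Longrightarrow> j \<le> N \<Longrightarrow> A $$ (i, j) = (if i = j then complex_of_real (d (N - i)) else 0)"
    and anti: "\<And>i. Suc i \<le> N \<Longrightarrow> d (Suc i) \<le> d i" and k: "k \<le> Suc N"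
  shows "sum_list (take k (eigenvalue_seq A)) = (\<Sum>i<k. d i)"
proof -
  have "d j \<le> d i" if "i \<le> j" "j \<le> N" for i j
    using that by (induction j rule: dec_induct) (auto intro: order.trans[OF anti])
  then have "sorted (map (\<lambda>i. d (N - i)) [0..<Suc N])"
    by (auto simp: sorted_iff_nth_mono simp del: upt_Suc)
  moreover have "eigenvalue_seq A = rev (sort (map (\<lambda>i. d (N - i)) [0..<Suc N]))"
    by (rule eigenvalue_seq_diagonal[OF A]) (simp add: diag less_Suc_eq_le)
  ultimately have eq: "eigenvalue_seq A = rev (map (\<lambda>i. d (N - i)) [0..<Suc N])"
    by (simp only: sorted_sort_id)
  have "sum_list (take k (eigenvalue_seq A)) = (\<Sum>i<k. eigenvalue_seq A ! i)"
    using k by (intro sum_list_take_nth) (simp add: eq del: upt_Suc)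
  also have "\<dots> = (\<Sum>i<k. d i)"
    using k unfolding eq by (intro sum.cong refl) (auto simp: rev_nth simp del: upt_Suc)
  finally show ?thesis .
qed

text \<open>Time reversal moves the highest weight state to \<open>a = b = n\<close>, and then at
  most the one index \<open>l = i - n\<close> contributes to a diagonal entry.\<close>

lemma Phi_highest_state_le:
  assumes nN: "n \<le> N" and j: "i \<le> N" "j \<le> N"
  shows "Phi (real n / 2) (real N / 2) (highest_state n) $$ (i, j)
    = (if i = j then complex_of_real ((real n + 1) / (real N + 1) * (real (N - n choose (N - i)) / real (N choose (N - i)))) else 0)"
proof -
  define m where "m = N - n"
  have m: "n + m = N" using nN by (simp add: m_def)
  have entry: "(- 1) ^ (a + b) * highest_state n $$ (n - b, n - a) = (if a = n \<and> b = n then 1 else 0)"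
    if "a \<le> n" "b \<le> n" for a b
    using that by (auto simp: highest_state_def)
  have "clone n m (\<lambda>a b. (- 1) ^ (a + b) * highest_state n $$ (n - b, n - a)) i j
      = complex_of_real ((real n + 1) / (real N + 1)) *
        (\<Sum>l\<le>m. \<Sum>a<Suc n. \<Sum>b<Suc n. if a = n \<and> b = n then complex_of_real (cg n m l i a * cg n m l j b) else 0)"
    unfolding clone_def m lessThan_Suc_atMost
    by (intro arg_cong2[where f = "(*)"] sum.cong refl) (auto simp: entry)
  also have "\<dots> = complex_of_real ((real n + 1) / (real N + 1)) * complex_of_real (\<Sum>l\<le>m. cg n m l i n * cg n m l j n)"
    unfolding sum_double_delta by simp
  also have "(\<Sum>l\<le>m. cg n m l i n * cg n m l j n)
      = (if i = j then real (m choose (N - i)) / real (N choose (N - i)) else 0)"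
  proof (cases "i = j")
    case True
    have "(\<Sum>l\<le>m. cg n m l i n * cg n m l j n) = (\<Sum>l\<le>m. if i = l + n then real (m choose l) / real (N choose i) else 0)"
      unfolding True cg_sq m by (intro sum.cong) auto
    also have "\<dots> = (if n \<le> i \<and> i - n \<le> m then real (m choose (i - n)) / real (N choose i) else 0)"
      by (rule sum_shift_delta)
    also have "\<dots> = real (m choose (N - i)) / real (N choose (N - i))"
    proof (cases "n \<le> i")
      case True
      then have "m choose (i - n) = m choose (N - i)"
        using j(1) m binomial_symmetric[of "i - n" m] by (metis Nat.diff_diff_right add.commute diff_add_inverse diff_le_mono)
      moreover have "N choose i = N choose (N - i)" using j(1) by (rule binomial_symmetric)
      moreover have "i - n \<le> m" using j m by simp
      ultimately show ?thesis using True by simp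
    next
      case False
      then have "m < N - i" using m j by simp
      with False show ?thesis by (simp add: binomial_eq_0)
    qed
    finally show ?thesis using True by simp
  next
    case False
    then have "cg n m l i n * cg n m l j n = 0" for l by (auto simp: cg_def)
    with False show ?thesis by simp
  qed
  finally show ?thesis
    unfolding Phi_clone[OF nN highest_state_carrier j] m_def by auto
qed

text \<open>The only non-zero entry of \<open>min_vec\<close> with index \<open>0\<close> on spin
  \<open>J\<close> is at \<open>l = 0\<close> and index \<open>N\<close> on spin \<open>K\<close>,
  so the image is the pure state of lowest weight.\<close>

lemma Phi_highest_state_gt:
  assumes nN: "N < n" and j: "i \<le> N" "j \<le> N"
  shows "Phi (real n / 2) (real N / 2) (highest_state n) $$ (i, j)
    = (if i = j then complex_of_real (if N - i = 0 then 1 else 0) else 0)"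
proof -
  define m where "m = n - N"
  have m: "min_dim n N = m" using nN by (simp add: m_def min_dim_def)
  define c where "c = (real m + 1) / (real n + 1)"
  have "Phi (real n / 2) (real N / 2) (highest_state n) $$ (i, j)
      = complex_of_real ((real n + 1) / (real m + 1)) * (\<Sum>k<Suc n. \<Sum>r<Suc n. if k = 0 \<and> r = 0 then
          complex_of_real (\<Sum>l\<le>m. min_vec n N l k i * min_vec n N l r j) else 0)"
    unfolding Phi_entry[OF highest_state_carrier j] m lessThan_Suc_atMost
    by (intro arg_cong2[where f = "(*)"] sum.cong refl) (auto simp: highest_state_def)
  also have "\<dots> = complex_of_real ((real n + 1) / (real m + 1)) *
      complex_of_real (\<Sum>l\<le>m. min_vec n N l 0 i * min_vec n N l 0 j)"
    unfolding sum_double_delta by simp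
  also have "(\<Sum>l\<le>m. min_vec n N l 0 i * min_vec n N l 0 j) = (if i = j \<and> i = N then c else 0)"
  proof (cases "i = j \<and> i = N")
    case True
    have "(\<Sum>l\<le>m. min_vec n N l 0 i * min_vec n N l 0 j) = (\<Sum>l\<le>m. if l = 0 then c else 0)"
      using True nN by (intro sum.cong refl) (auto simp: min_vec_def min_vec_le_sq c_def m_def)
    with True show ?thesis by simp
  next
    case False
    have "min_vec n N l 0 i * min_vec n N l 0 j = 0" for l
      using False nN j by (auto simp: min_vec_def min_vec_le_def)
    then show ?thesis unfolding if_not_P[OF False] by simp
  qed
  finally have eq: "Phi (real n / 2) (real N / 2) (highest_state n) $$ (i, j)
      = complex_of_real ((real n + 1) / (real m + 1)) * complex_of_real (if i = j \<and> i = N then c else 0)" .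
  have "complex_of_real ((real n + 1) / (real m + 1)) * complex_of_real c = 1"
    unfolding c_def of_real_mult[symmetric] ratio_cancel by simp
  then show ?thesis using j unfolding eq by (cases "i = j \<and> i = N") auto
qed

theorem Phi_majorization:
  assumes \<rho>: "density_matrix (Suc n) \<rho>"
  shows "majorizes (eigenvalue_seq (Phi (real n / 2) (real N / 2) (highest_state n)))
    (eigenvalue_seq (Phi (real n / 2) (real N / 2) \<rho>))"
proof -
  let ?A = "Phi (real n / 2) (real N / 2) (highest_state n)" and ?B = "Phi (real n / 2) (real N / 2) \<rho>"
  have \<rho>c: "\<rho> \<in> carrier_mat (Suc n) (Suc n)" and tr: "mat_trace \<rho> = 1"
    using \<rho> by (auto simp: density_matrix_def pos_semidef_def)
  have A: "?A \<in> carrier_mat (Suc N) (Suc N)" and B: "?B \<in> carrier_mat (Suc N) (Suc N)" by (rule Phi_carrier)+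
  have len: "length (eigenvalue_seq ?A) = Suc N" "length (eigenvalue_seq ?B) = Suc N"
    by (rule length_eigenvalue_seq[OF A] length_eigenvalue_seq[OF B])+
  have total: "sum_list (eigenvalue_seq ?A) = 1" "sum_list (eigenvalue_seq ?B) = 1"
    unfolding sum_list_eigenvalue_seq[OF A] sum_list_eigenvalue_seq[OF B]
      mat_trace_Phi[OF highest_state_carrier] mat_trace_Phi[OF \<rho>c] mat_trace_highest_state tr by simp_all
  have "sum_list (take k (eigenvalue_seq ?B)) \<le> sum_list (take k (eigenvalue_seq ?A))" if k: "1 \<le> k" "k < Suc N" for k
  proof (cases "n \<le> N")
    case True
    have "sum_list (take k (eigenvalue_seq ?B)) \<le> coherent_sum n (N - n) k"
      using k by (intro eigenvalue_seq_ky_fan[OF B _ Phi_ky_fan[OF True \<rho>]]) auto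
    also have "\<dots> = (\<Sum>i<k. (real n + 1) / (real N + 1) * (real (N - n choose i) / real (N choose i)))"
      using True by (simp add: coherent_sum_def)
    also have "\<dots> = sum_list (take k (eigenvalue_seq ?A))"
      using k by (intro eigenvalue_seq_increasing_diagonal[OF A, symmetric] Phi_highest_state_le[OF True]
          mult_left_mono choose_ratio_antimono) auto
    finally show ?thesis .
  next
    \<comment> \<open>The image of the highest weight state has the eigenvalues
      \<open>1, 0, ..., 0\<close>, which majorize those of any density matrix.\<close>
    case False
    have psd: "pos_semidef (Suc N) ?B" using Phi_density[OF \<rho>, of N] by (simp add: density_matrix_def)
    have "sum_list (take k (eigenvalue_seq ?B)) + sum_list (drop k (eigenvalue_seq ?B)) = 1"
      unfolding sum_list_append[symmetric] append_take_drop_id by (rule total)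
    moreover have "0 \<le> sum_list (drop k (eigenvalue_seq ?B))"
      using eigenvalue_seq_nonneg[OF psd] by (intro sum_list_nonneg) (auto dest: in_set_dropD)
    ultimately have "sum_list (take k (eigenvalue_seq ?B)) \<le> 1" by simp
    also have "1 = (\<Sum>i<k. if i = 0 then 1 else 0 :: real)" using k by simp
    also have "\<dots> = sum_list (take k (eigenvalue_seq ?A))"
      using k False by (intro eigenvalue_seq_increasing_diagonal[OF A, symmetric] Phi_highest_state_gt) auto
    finally show ?thesis .
  qed
  then show ?thesis unfolding majorizes_def using len total eigenvalue_seq_sorted by auto
qed

theorem theorem2p4:
  fixes J K :: real
  assumes "is_spin J" and "is_spin K"
  shows "(\<forall>\<rho> (\<omega> :: real ^ 3) v.
            density_matrix (spin_dim J) \<rho> \<longrightarrow> \<omega> \<in> sphere 0 1 \<longrightarrow> coherent_state J \<omega> v \<longrightarrow>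
              density_matrix (spin_dim K) (Phi J K \<rho>) \<and>
              majorizes (eigenvalue_seq (Phi J K (ketbra v))) (eigenvalue_seq (Phi J K \<rho>))) \<and>
         (\<forall>(\<omega> :: real ^ 3) (\<omega>' :: real ^ 3) v v'.
            \<omega> \<in> sphere 0 1 \<longrightarrow> \<omega>' \<in> sphere 0 1 \<longrightarrow>
            coherent_state J \<omega> v \<longrightarrow> coherent_state J \<omega>' v' \<longrightarrow>
              eigenvalue_seq (Phi J K (ketbra v)) = eigenvalue_seq (Phi J K (ketbra v')))"
proof -
  obtain n where J: "J = real n / 2" by (rule is_spinE[OF assms(1)])
  obtain N where K: "K = real N / 2" by (rule is_spinE[OF assms(2)])
  show ?thesis
    unfolding J K spin_dim_half
    using Phi_density Phi_majorization eigenvalue_seq_coherent by metis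
qed

end
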